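(* Consider access to the graph only via the following queries: $\mathbf{RandEdge}$, $\mathbf{RandNbr}$, $\mathbf{Degree}$ and $\mathbf{Additive}$. There are no random vertex samples. The number of vertices $n$ is known. Let $\varepsilon\in(0,1)$. (a) There is a randomized algorithm that outputs a $(1\pm\varepsilon)$-approximation to $d$ using $\widetilde{O}\left(\varepsilon^{-2}\min\left(d, \sqrt{n/d}\right)\right)$ queries. In particular, it outputs a $(1\pm\varepsilon)$-approximation to $d$ using $\widetilde{O}\left(\varepsilon^{-2}n^{1/3}\right)$ queries. (b) Any algorithm in this setting that outputs a constant factor approximation to $d$ requires $\Omega(n^{1/3})$ samples. This holds even with the stronger full neighborhood access in place of $\mathbf{Additive}$. Moreover, if only $\mathbf{Pair}$ queries are available instead of $\mathbf{Additive}$, then any such algorithm requires $\Omega(\min(\sqrt{n},n/d))$ queries.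
   Context: $G=(V,E)$ is an unknown simple undirected graph with $n=|V|$ vertices and $m=|E|$ edges, no isolated vertices, and average degree $d=2m/n$. The queries are: - $\mathbf{RandEdge}()$ returns a uniformly random edge. - $\mathbf{RandNbr}(x)$ returns a uniformly random neighbor of $x$. - $\mathbf{Degree}(x)$ returns $\deg(x)$. - $\mathbf{Pair}(x,y)$ returns whether $\{x,y\}\in E$. - $\mathbf{Additive}(S)$, for $S\subseteq V$, returns the number of edges with both endpoints in $S$ and costs $|S|$. - $\mathbf{FullNbrHood}(x)$ returns the full adjacency list of $x$. All queries other than $\mathbf{Additive}$ cost $1$. A $(1\pm\varepsilon)$-approximation to $d$ is a value in $[(1-\varepsilon)d,(1+\varepsilon)d]$. A constant factor approximation is a value in $[d/c,cd]$ for a constant $c$. Randomized guarantees hold with probability at least $0.99$. $\widetilde{O}$ hides factors polylogarithmic in $n$.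
   Formalization: The Ω(min(√n,n/d)) bound with Pair queries fails for graphs with d≪√n (O(d) random edges and degrees suffice there), so it is stated, for each D in [1,n−1], for some hard graph of average degree Θ(max(D,√n)), with d that graph's average degree. *)

theory Defs
  imports "HOL-Probability.Probability"
begin

record graph =
  verts :: "nat set"
  edges :: "nat set set"

definition simple_graph :: "graph \<Rightarrow> bool" where
  "simple_graph G \<longleftrightarrow> finite (verts G) \<and> (\<forall>e\<in>edges G. e \<subseteq> verts G \<and> card e = 2)"

definition no_isolated :: "graph \<Rightarrow> bool" where
  "no_isolated G \<longleftrightarrow> (\<forall>v\<in>verts G. \<exists>e\<in>edges G. v \<in> e)"

definition graphs :: "nat \<Rightarrow> graph set" where
  "graphs n = {G. simple_graph G \<and> no_isolated G \<and> card (verts G) = n}"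

definition avg_degree :: "graph \<Rightarrow> real" where
  "avg_degree G = 2 * real (card (edges G)) / real (card (verts G))"

definition nbrs :: "graph \<Rightarrow> nat \<Rightarrow> nat set" where
  "nbrs G x = {y. {x, y} \<in> edges G}"

datatype query =
    RandEdge
  | RandNbr nat
  | Degree nat
  | PairQuery nat nat
  | Additive "nat set"
  | FullNbrHood nat

datatype answer =
    EdgeAns "nat set"
  | VertexAns nat
  | NumberAns nat
  | BoolAns bool
  | NbrsAns "nat set"
  | Refused

fun query_cost :: "query \<Rightarrow> nat" where
  "query_cost (Additive S) = card S"
| "query_cost _ = 1"

fun query_args :: "query \<Rightarrow> nat set" where
  "query_args RandEdge = {}"
| "query_args (RandNbr x) = {x}"
| "query_args (Degree x) = {x}"
| "query_args (PairQuery x y) = {x, y}"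
| "query_args (Additive S) = S"
| "query_args (FullNbrHood x) = {x}"

fun revealed :: "answer \<Rightarrow> nat set" where
  "revealed (EdgeAns e) = e"
| "revealed (VertexAns x) = {x}"
| "revealed (NbrsAns N) = N"
| "revealed _ = {}"

fun reply :: "graph \<Rightarrow> query \<Rightarrow> answer pmf" where
  "reply G RandEdge = map_pmf EdgeAns (pmf_of_set (edges G))"
| "reply G (RandNbr x) = map_pmf VertexAns (pmf_of_set (nbrs G x))"
| "reply G (Degree x) = return_pmf (NumberAns (card (nbrs G x)))"
| "reply G (PairQuery x y) = return_pmf (BoolAns ({x, y} \<in> edges G))"
| "reply G (Additive S) = return_pmf (NumberAns (card {e \<in> edges G. e \<subseteq> S}))"
| "reply G (FullNbrHood x) = return_pmf (NbrsAns (nbrs G x))"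

(* An algorithm cannot name a vertex before an answer has revealed it: since there are no
   vertex samples, guessing a label must not give access to a vertex. "seen" is the set of
   vertices revealed so far; a query mentioning any other vertex is refused (and still paid for). *)
definition respond :: "graph \<Rightarrow> nat set \<Rightarrow> query \<Rightarrow> answer pmf" where
  "respond G seen q = (if query_args q \<subseteq> seen then reply G q else return_pmf Refused)"

(* Adaptive randomized algorithms as well-founded decision trees: every run terminates, but the
   depth need not be bounded. Toss is internal randomness and is free; an arbitrary discrete
   distribution can be encoded as one on nat. *)
datatype algorithm =
    Output real
  | Toss "nat pmf" "nat \<Rightarrow> algorithm"
  | Ask query "answer \<Rightarrow> algorithm"

(* Joint distribution of the output and the total query cost. *)
primrec run_from :: "graph \<Rightarrow> algorithm \<Rightarrow> nat set \<Rightarrow> (real \<times> nat) pmf" where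
  "run_from G (Output r) seen = return_pmf (r, 0)"
| "run_from G (Toss p f) seen = bind_pmf p (\<lambda>i. run_from G (f i) seen)"
| "run_from G (Ask q f) seen =
     bind_pmf (respond G seen q) (\<lambda>a.
       map_pmf (\<lambda>(r, c). (r, query_cost q + c)) (run_from G (f a) (seen \<union> revealed a)))"

definition run :: "graph \<Rightarrow> algorithm \<Rightarrow> (real \<times> nat) pmf" where
  "run G A = run_from G A {}"

primrec uses_only :: "query set \<Rightarrow> algorithm \<Rightarrow> bool" where
  "uses_only Q (Output r) \<longleftrightarrow> True"
| "uses_only Q (Toss p f) \<longleftrightarrow> (\<forall>i. uses_only Q (f i))"
| "uses_only Q (Ask q f) \<longleftrightarrow> q \<in> Q \<and> (\<forall>a. uses_only Q (f a))"

definition basic_queries :: "query set" where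
  "basic_queries = {RandEdge} \<union> range RandNbr \<union> range Degree"

definition additive_queries :: "query set" where
  "additive_queries = basic_queries \<union> range Additive"

definition full_nbrhood_queries :: "query set" where
  "full_nbrhood_queries = basic_queries \<union> range FullNbrHood"

definition pair_queries :: "query set" where
  "pair_queries = basic_queries \<union> {PairQuery x y | x y. True}"

(* The cost bound belongs to the event that has probability at least 0.99. It cannot be required
   on every run when it depends on the unknown average degree: rare unlucky answers can make a
   sparse graph look like a dense one. *)
definition approximates_within_cost :: "algorithm \<Rightarrow> graph \<Rightarrow> real \<Rightarrow> real \<Rightarrow> bool" where
  "approximates_within_cost A G \<epsilon> B \<longleftrightarrow>
     measure_pmf.prob (run G A)
       {(r, c). r \<in> {(1 - \<epsilon>) * avg_degree G .. (1 + \<epsilon>) * avg_degree G} \<and> real c \<le> B}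
     \<ge> 99 / 100"

definition factor_approximates :: "algorithm \<Rightarrow> graph \<Rightarrow> real \<Rightarrow> bool" where
  "factor_approximates A G \<gamma> \<longleftrightarrow>
     measure_pmf.prob (run G A)
       {(r, c). r \<in> {avg_degree G / \<gamma> .. \<gamma> * avg_degree G}} \<ge> 99 / 100"

(* No cost bound below B is guaranteed with probability 0.99. In particular both the worst-case
   cost and 100 times the expected cost are at least B. *)
definition needs_cost :: "algorithm \<Rightarrow> graph \<Rightarrow> real \<Rightarrow> bool" where
  "needs_cost A G B \<longleftrightarrow> \<not> (measure_pmf.prob (run G A) {(r, c). real c < B} \<ge> 99 / 100)"

(* A constant-factor estimator for the n-vertex graphs; as n is known, it may depend on n. *)
definition estimator :: "query set \<Rightarrow> real \<Rightarrow> nat \<Rightarrow> algorithm \<Rightarrow> bool" where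
  "estimator Q \<gamma> n A \<longleftrightarrow> uses_only Q A \<and> (\<forall>G\<in>graphs n. factor_approximates A G \<gamma>)"

end

theory Submission
  imports Defs "HOL-Combinatorics.Permutations"
begin

text \<open>
  Upper bound. A uniformly random edge has the expected value \<open>1/d\<close> of
  \<open>1/(2 deg u) + 1/(2 deg v)\<close>, with relative variance at most \<open>d\<close>. If \<open>d\<close> is large, one instead
  samples two groups of \<open>b\<close> random edges and counts the adjacent pairs of endpoints between the groups,
  each pair weighted by about \<open>1/(deg u deg v)\<close> and restricted to vertices of degree at least \<open>t\<close>;
  the expectation is proportional to \<open>1/m\<close> times the fraction of edges that survive the restriction,
  and for \<open>t\<close> about \<open>d/4\<close> the relative variance is constant once \<open>b\<close> is about \<open>sqrt (n/d)\<close>.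
  The weights being integers, the weighted count is read off from additive queries on the binary digits
  of the weights. Doubling \<open>b\<close> until one of the two estimators certifies itself makes the search stop
  at \<open>b\<close> about \<open>min d (sqrt (n/d))\<close>.

  Lower bounds. Consider a graph of \<open>N\<close> blocks of size \<open>s\<close>, some of them cliques and the rest stars. The stars carry
  almost no edges, so that having all blocks or only a small fraction of them cliques changes \<open>d\<close> by
  a large factor, but a random edge looks the same. If the set of cliques is random, then the two cases
  differ only once two random edges share a block or lie in a star, which takes about
  \<open>min (sqrt N) s\<close> queries. If the vertices are also relabelled at random, then two revealed vertices
  of the same block can only be recognized by a pair query, which succeeds with probability about
  \<open>1/N\<close>. Both cases are compared with an ideal process in which every random edge opens a fresh block.
\<close>

section \<open>Runs of algorithms\<close>

text \<open>Two obstacles shape the lower bounds. The cost is bounded only with probability 0.99, so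
  the decision tree is truncated at the budget before anything is compared. And hidden graphs can
  give answers that the ideal process never gives, so no distance between distributions is
  estimated: a one-sided likelihood bound is enough, because it transfers rare events from the
  hidden graphs to the ideal process, whose output would then have to lie in two disjoint sets.
  Inside a discovered clique the law of every answer is independent of the hidden choice, so only
  random edges matter. With k cliques of size s, and k about n/s, an edge repeats a block with
  probability about b/k after b queries and is a star edge with probability about 1/s. Both losses
  over b queries stay small for b up to sqrt (n/s) and up to s; s = n^(1/3) balances them. If
  positions are hidden and only pairs can be tested, a repeated block is hardly ever noticed, and b
  may grow to n/s as long as it is below s. In the upper bound a random edge meets a vertex in
  proportion to its degree. The weights 1/deg cancel this bias, and truncation keeps them, and with
  them the variance, bounded.\<close>

lemma measure_bind_pmf:
  "measure_pmf.prob (bind_pmf p f) X = measure_pmf.expectation p (\<lambda>x. measure_pmf.prob (f x) X)"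
proof -
  have "ennreal (measure_pmf.prob (bind_pmf p f) X) = (\<integral>\<^sup>+x. ennreal (measure_pmf.prob (f x) X) \<partial>p)"
    by (simp add: measure_pmf.emeasure_eq_measure[symmetric])
  also have "\<dots> = ennreal (measure_pmf.expectation p (\<lambda>x. measure_pmf.prob (f x) X))"
    by (intro nn_integral_eq_integral measure_pmf.integrable_const_bound[where B=1]) auto
  finally show ?thesis
    by (simp add: integral_nonneg_AE)
qed

lemma integrable_prob [simp]:
  "integrable (measure_pmf p) (\<lambda>x. measure_pmf.prob (f x) X)"
  by (intro measure_pmf.integrable_const_bound[where B=1]) auto

lemma expectation_bind_pmf_finite:
  fixes h :: "'b \<Rightarrow> real"
  assumes "finite (set_pmf p)" "\<And>x. x \<in> set_pmf p \<Longrightarrow> finite (set_pmf (f x))"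
  shows "measure_pmf.expectation (bind_pmf p f) h
    = measure_pmf.expectation p (\<lambda>x. measure_pmf.expectation (f x) h)"
  using assms by (subst pmf_expectation_bind[where A="set_pmf p"])
     (auto simp: integral_measure_pmf_real[where A="set_pmf p"] mult.commute)

definition outputs :: "graph \<Rightarrow> algorithm \<Rightarrow> nat set \<Rightarrow> real pmf" where
  "outputs G A seen = map_pmf fst (run_from G A seen)"

lemma outputs_simps [simp]:
  "outputs G (Output r) seen = return_pmf r"
  "outputs G (Toss p f) seen = bind_pmf p (\<lambda>i. outputs G (f i) seen)"
  "outputs G (Ask q g) seen =
     bind_pmf (respond G seen q) (\<lambda>a. outputs G (g a) (seen \<union> revealed a))"
  by (simp_all add: outputs_def map_bind_pmf pmf.map_comp o_def case_prod_unfold)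

primrec cost_at_most :: "algorithm \<Rightarrow> nat \<Rightarrow> bool" where
  "cost_at_most (Output r) b \<longleftrightarrow> True"
| "cost_at_most (Toss p f) b \<longleftrightarrow> (\<forall>i. cost_at_most (f i) b)"
| "cost_at_most (Ask q f) b \<longleftrightarrow> query_cost q \<le> b \<and> (\<forall>a. cost_at_most (f a) (b - query_cost q))"

text \<open>The tree stops before the first query that would exceed the budget. The output 0 carries
  no meaning: truncated runs are only ever counted as possible failures.\<close>

primrec cut_off :: "algorithm \<Rightarrow> nat \<Rightarrow> algorithm" where
  "cut_off (Output r) b = Output r"
| "cut_off (Toss p f) b = Toss p (\<lambda>i. cut_off (f i) b)"
| "cut_off (Ask q f) b =
    (if query_cost q \<le> b then Ask q (\<lambda>a. cut_off (f a) (b - query_cost q)) else Output 0)"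

lemma cost_at_most_cut_off: "cost_at_most (cut_off A b) b"
  by (induction A arbitrary: b) auto

lemma uses_only_cut_off: "uses_only Q A \<Longrightarrow> uses_only Q (cut_off A b)"
  by (induction A arbitrary: b) auto

lemma prob_map_pmf: "measure_pmf.prob (map_pmf f p) X = measure_pmf.prob p (f -` X)"
  by (simp add: measure_map_pmf)

text \<open>A run of cost at most \<open>b\<close> is never truncated and keeps its output. A
  truncated run may happen to output an element of \<open>R\<close> as well, hence only an
  inequality.\<close>

lemma prob_cut_off:
  "measure_pmf.prob (run_from G A seen) {(r, c). r \<in> R \<and> c \<le> b}
     \<le> measure_pmf.prob (outputs G (cut_off A b) seen) R"
proof (induction A arbitrary: b seen)
  case (Output r)
  then show ?case by (auto simp: indicator_def)
next
  case (Toss p f)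
  then show ?case
    by (auto simp: measure_bind_pmf intro!: integral_mono)
next
  case (Ask q f)
  show ?case
  proof (cases "query_cost q \<le> b")
    case True
    have "(\<lambda>(r, c). (r, query_cost q + c)) -` {(r, c). r \<in> R \<and> c \<le> b}
       = {(r, c). r \<in> R \<and> c \<le> b - query_cost q}" using True by auto
    then show ?thesis using True Ask[OF rangeI]
      by (auto simp: measure_bind_pmf prob_map_pmf intro!: integral_mono)
  next
    case False
    have "(\<lambda>(r, c). (r, query_cost q + c)) -` {(r, c). r \<in> R \<and> c \<le> b} = {}" using False by auto
    then show ?thesis using False
      by (simp add: measure_bind_pmf prob_map_pmf)
  qed
qed

section \<open>Comparison of hidden graphs with an ideal process\<close>

text \<open>\<open>I\<close> will be the finite support of the ideal answers and \<open>p\<close>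
  the reply of a hidden graph; the mass outside \<open>I\<close> is dropped.\<close>

lemma sum_pmf_le_expectation:
  fixes g :: "'a \<Rightarrow> real"
  assumes "finite I" "\<And>x. 0 \<le> g x" "\<And>x. g x \<le> 1"
  shows "(\<Sum>a\<in>I. pmf p a * g a) \<le> measure_pmf.expectation p g"
proof -
  have "(\<Sum>a\<in>I. pmf p a * g a) = measure_pmf.expectation p (\<lambda>x. g x * indicator I x)"
    using assms(1) by (subst integral_measure_pmf_real[where A=I])
      (auto simp: indicator_def mult.commute split: if_splits)
  also have "\<dots> \<le> measure_pmf.expectation p g"
    using assms
    by (intro integral_mono measure_pmf.integrable_const_bound[where B=1])
       (auto simp: indicator_def)
  finally show ?thesis .
qed

primrec ideal_run ::
  "('s \<Rightarrow> query \<Rightarrow> answer pmf) \<Rightarrow> ('s \<Rightarrow> query \<Rightarrow> answer \<Rightarrow> 's) \<Rightarrow> algorithm \<Rightarrow> 's \<Rightarrow> real pmf" where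
  "ideal_run I st (Output r) x = return_pmf r"
| "ideal_run I st (Toss p f) x = bind_pmf p (\<lambda>i. ideal_run I st (f i) x)"
| "ideal_run I st (Ask q f) x = bind_pmf (I x q) (\<lambda>a. ideal_run I st (f a) (st x q a))"

text \<open>The hidden graph is \<open>G w\<close> for a uniformly random \<open>w\<close>, and \<open>\<Phi> x\<close> is the set of those \<open>w\<close>
  that are consistent with the state \<open>x\<close> reached so far. The number \<open>Z x\<close> replaces \<open>card (\<Phi> x)\<close>
  where the latter is not explicit, at the price \<open>mu\<close>. By \<open>weight\<close>, every answer of the ideal process
  is at least \<open>1 - lam * cost\<close> times as likely for the hidden graph, so that the likelihood ratios multiply
  along a run. Answers that the ideal process never gives may occur for the hidden graph and
  are simply discarded.\<close>

locale hidden_graph =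
  fixes G :: "'w \<Rightarrow> graph"
    and ideal :: "'s \<Rightarrow> query \<Rightarrow> answer pmf"
    and step :: "'s \<Rightarrow> query \<Rightarrow> answer \<Rightarrow> 's"
    and seen :: "'s \<Rightarrow> nat set"
    and \<Phi> :: "'s \<Rightarrow> 'w set"
    and Z :: "'s \<Rightarrow> real"
    and valid :: "'s \<Rightarrow> nat \<Rightarrow> bool"
    and Q :: "query set"
    and lam mu :: real
  assumes finite_\<Phi>: "finite (\<Phi> x)"
    and lam_nonneg: "0 \<le> lam"
    and mu_nonneg: "0 \<le> mu"
    and Z_pos: "valid x b \<Longrightarrow> 0 < Z x"
    and card_\<Phi>: "valid x b \<Longrightarrow> (1 - mu) * Z x \<le> card (\<Phi> x)"
    and finite_ideal: "valid x b \<Longrightarrow> q \<in> Q \<Longrightarrow> query_cost q \<le> b \<Longrightarrow> finite (set_pmf (ideal x q))"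
    and valid_step: "valid x b \<Longrightarrow> q \<in> Q \<Longrightarrow> query_cost q \<le> b \<Longrightarrow> a \<in> set_pmf (ideal x q)
       \<Longrightarrow> valid (step x q a) (b - query_cost q)"
    and seen_step: "valid x b \<Longrightarrow> q \<in> Q \<Longrightarrow> query_cost q \<le> b \<Longrightarrow> a \<in> set_pmf (ideal x q)
       \<Longrightarrow> seen (step x q a) = seen x \<union> revealed a"
    and \<Phi>_step: "valid x b \<Longrightarrow> q \<in> Q \<Longrightarrow> query_cost q \<le> b \<Longrightarrow> a \<in> set_pmf (ideal x q)
       \<Longrightarrow> \<Phi> (step x q a) \<subseteq> \<Phi> x"
    and weight: "valid x b \<Longrightarrow> q \<in> Q \<Longrightarrow> query_cost q \<le> b \<Longrightarrow> a \<in> set_pmf (ideal x q)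
       \<Longrightarrow> w \<in> \<Phi> (step x q a)
       \<Longrightarrow> (1 - lam * query_cost q) * Z x * pmf (ideal x q) a
             \<le> Z (step x q a) * pmf (respond (G w) (seen x) q) a"
begin

text \<open>The factors \<open>1 - lam * c\<close> multiply along a run, but their product is at
  least one minus the sum of the losses, so a total cost \<open>b\<close> loses only
  \<open>lam * b\<close>. The term \<open>mu\<close> enters once, at the leaf, where
  \<open>Z x\<close> is exchanged for the true number of consistent hidden graphs.\<close>

lemma ideal_run_le:
  assumes "valid x b" "cost_at_most A b" "uses_only Q A"
  shows "Z x * (measure_pmf.prob (ideal_run ideal step A x) R - mu - lam * b)
           \<le> (\<Sum>w\<in>\<Phi> x. measure_pmf.prob (outputs (G w) A (seen x)) R)"
  using assms
proof (induction A arbitrary: x b)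
  case (Output r)
  show ?case
  proof (cases "r \<in> R")
    case True
    have "Z x * (1 - mu - lam * b) \<le> (1 - mu) * Z x"
      using lam_nonneg Z_pos[OF Output(1)] by (simp add: algebra_simps)
    then show ?thesis using True card_\<Phi>[OF Output(1)] by (simp add: indicator_def)
  next
    case False
    have "0 \<le> Z x * (mu + lam * b)" using lam_nonneg mu_nonneg Z_pos[OF Output(1)] by simp
    then show ?thesis using False by (simp add: indicator_def algebra_simps)
  qed
next
  case (Toss p f)
  let ?P = "\<lambda>i. measure_pmf.prob (ideal_run ideal step (f i) x) R"
  have "Z x * (measure_pmf.prob (ideal_run ideal step (Toss p f) x) R - mu - lam * b)
      = measure_pmf.expectation p (\<lambda>i. Z x * (?P i - mu - lam * b))"
    by (simp add: measure_bind_pmf)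
  also have "\<dots> \<le> measure_pmf.expectation p
      (\<lambda>i. \<Sum>w\<in>\<Phi> x. measure_pmf.prob (outputs (G w) (f i) (seen x)) R)"
    using Toss by (intro integral_mono) auto
  also have "\<dots> = (\<Sum>w\<in>\<Phi> x. measure_pmf.prob (outputs (G w) (Toss p f) (seen x)) R)"
    by (simp add: measure_bind_pmf)
  finally show ?case .
next
  case (Ask q f)
  note v = \<open>valid x b\<close>
  let ?c = "query_cost q"
  have c: "?c \<le> b" and q: "q \<in> Q" using Ask.prems by auto
  let ?I = "set_pmf (ideal x q)"
  let ?h = "\<lambda>w a. measure_pmf.prob (outputs (G w) (f a) (seen x \<union> revealed a)) R"
  let ?r = "\<lambda>w a. pmf (respond (G w) (seen x) q) a"
  let ?P = "\<lambda>a. measure_pmf.prob (ideal_run ideal step (f a) (step x q a)) R"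
  let ?T = "measure_pmf.prob (ideal_run ideal step (Ask q f) x) R"
  have fI: "finite ?I" by (rule finite_ideal[OF v q c])
  have rhs_nonneg: "0 \<le> (\<Sum>w\<in>\<Phi> x. measure_pmf.prob (outputs (G w) (Ask q f) (seen x)) R)"
    by (intro sum_nonneg) auto
  show ?case
  proof (cases "lam * ?c \<le> 1")
    \<comment> \<open>Here the factor \<open>1 - lam * ?c\<close> would be negative; the claim is
      trivial because its left-hand side is at most 0.\<close>
    case False
    have "lam * ?c \<le> lam * b" using c lam_nonneg by (intro mult_left_mono) auto
    moreover have "?T \<le> 1" by simp
    ultimately have "?T - mu - lam * b \<le> 0" using False mu_nonneg by linarith
    then show ?thesis using rhs_nonneg Z_pos[OF v]
      by (meson dual_order.trans mult_nonneg_nonpos less_imp_le)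
  next
    case True
    have P0: "?T = (\<Sum>a\<in>?I. pmf (ideal x q) a * ?P a)"
      using fI by (simp add: measure_bind_pmf integral_measure_pmf_real[where A="?I"] mult.commute)
    have one: "(\<Sum>a\<in>?I. pmf (ideal x q) a) = 1" using fI by (simp add: sum_pmf_eq_1)
    \<comment> \<open>\<open>y\<close> is what the induction hypothesis supplies after the query,
      averaged over the answers. As \<open>y \<le> 1\<close>, the factor \<open>1 - lam * ?c\<close>
      costs at most \<open>lam * ?c\<close>, whatever the sign of \<open>y\<close>.\<close>
    define y where "y = ?T - mu - lam * (b - ?c)"
    have y1: "y \<le> 1"
    proof -
      have "?T \<le> 1" by simp
      moreover have "0 \<le> lam * (b - ?c)" using lam_nonneg by simp
      ultimately show ?thesis using mu_nonneg unfolding y_def by linarith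
    qed
    have "?T - mu - lam * b = y - lam * ?c"
      using c unfolding y_def by (simp add: of_nat_diff algebra_simps)
    also have "\<dots> \<le> (1 - lam * ?c) * y"
    proof -
      have "lam * ?c * y \<le> lam * ?c * 1" using y1 lam_nonneg by (intro mult_left_mono) auto
      then show ?thesis by (simp add: algebra_simps)
    qed
    also have "\<dots> = (\<Sum>a\<in>?I. (1 - lam * ?c) * pmf (ideal x q) a * (?P a - mu - lam * (b - ?c)))"
    proof -
      have "(\<Sum>a\<in>?I. (1 - lam * ?c) * pmf (ideal x q) a * (?P a - mu - lam * (b - ?c)))
        = (1 - lam * ?c) * ((\<Sum>a\<in>?I. pmf (ideal x q) a * ?P a)
             - (mu + lam * (b - ?c)) * (\<Sum>a\<in>?I. pmf (ideal x q) a))"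
        by (simp add: sum_distrib_left sum_subtractf[symmetric] algebra_simps)
      then show ?thesis unfolding one y_def P0 by (simp add: algebra_simps)
    qed
    finally have "Z x * (?T - mu - lam * b)
       \<le> (\<Sum>a\<in>?I. Z x * ((1 - lam * ?c) * pmf (ideal x q) a * (?P a - mu - lam * (b - ?c))))"
      using Z_pos[OF v] by (simp add: sum_distrib_left[symmetric])
    also have "\<dots> \<le> (\<Sum>a\<in>?I. \<Sum>w\<in>\<Phi> (step x q a). ?r w a * ?h w a)"
    proof (intro sum_mono)
      fix a assume a: "a \<in> ?I"
      let ?x = "step x q a"
      have v': "valid ?x (b - ?c)" by (rule valid_step[OF v q c a])
      have Z': "0 < Z ?x" by (rule Z_pos[OF v'])
      \<comment> \<open>The ideal weight of the answer, renormalised from \<open>Z x\<close> to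
        \<open>Z ?x\<close>; by \<open>weight\<close> it is at most the probability of this answer
        in every hidden graph that remains consistent.\<close>
      let ?k = "Z x * ((1 - lam * ?c) * pmf (ideal x q) a) / Z ?x"
      have k: "0 \<le> ?k" using Z' Z_pos[OF v] True by simp
      have "Z x * ((1 - lam * ?c) * pmf (ideal x q) a * (?P a - mu - lam * (b - ?c)))
         = ?k * (Z ?x * (?P a - mu - lam * (b - ?c)))"
        using Z' by simp
      also have "\<dots> \<le> ?k * (\<Sum>w\<in>\<Phi> ?x. ?h w a)"
        using k Ask.IH[of "f a" ?x "b - ?c"] v' Ask.prems seen_step[OF v q c a]
        by (intro mult_left_mono) auto
      also have "\<dots> \<le> (\<Sum>w\<in>\<Phi> ?x. ?r w a * ?h w a)"
        unfolding sum_distrib_left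
      proof (intro sum_mono mult_right_mono)
        fix w assume "w \<in> \<Phi> ?x"
        from weight[OF v q c a this] show "?k \<le> ?r w a"
          using Z' by (simp add: field_simps)
      qed auto
      finally show "Z x * ((1 - lam * ?c) * pmf (ideal x q) a * (?P a - mu - lam * (b - ?c)))
        \<le> (\<Sum>w\<in>\<Phi> ?x. ?r w a * ?h w a)" .
    qed
    \<comment> \<open>The range of \<open>w\<close> is enlarged to the graphs consistent before the
      answer. It no longer depends on \<open>a\<close>, so the sums can be exchanged.\<close>
    also have "\<dots> \<le> (\<Sum>a\<in>?I. \<Sum>w\<in>\<Phi> x. ?r w a * ?h w a)"
      by (intro sum_mono sum_mono2 finite_\<Phi> \<Phi>_step[OF v q c]) auto
    also have "\<dots> = (\<Sum>w\<in>\<Phi> x. \<Sum>a\<in>?I. ?r w a * ?h w a)"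
      by (rule sum.swap)
    also have "\<dots> \<le> (\<Sum>w\<in>\<Phi> x. measure_pmf.prob (outputs (G w) (Ask q f) (seen x)) R)"
      using fI by (intro sum_mono) (auto simp: measure_bind_pmf intro!: sum_pmf_le_expectation)
    finally show ?thesis .
  qed
qed

text \<open>\<open>ideal_run_le\<close> bounds the hidden graphs from below, so it is applied to the
  failure event \<open>- R\<close>: what is rare for every hidden graph must also be rare for the
  ideal process.\<close>

lemma ideal_run_escape:
  assumes "valid x b" "seen x = {}" "card (\<Phi> x) = Z x" "uses_only Q A"
    and "\<And>w. w \<in> \<Phi> x \<Longrightarrow> 98/100 \<le> measure_pmf.prob (run (G w) A) {(r, c). r \<in> R \<and> c \<le> b}"
  shows "measure_pmf.prob (ideal_run ideal step (cut_off A b) x) (- R) \<le> 2/100 + mu + lam * b"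
proof -
  have "Z x * (measure_pmf.prob (ideal_run ideal step (cut_off A b) x) (- R) - mu - lam * b)
     \<le> (\<Sum>w\<in>\<Phi> x. measure_pmf.prob (outputs (G w) (cut_off A b) {}) (- R))"
    using ideal_run_le[OF assms(1) cost_at_most_cut_off uses_only_cut_off[OF assms(4)]] assms(2)
    by simp
  also have "\<dots> \<le> (\<Sum>w\<in>\<Phi> x. 2/100)"
  proof (intro sum_mono)
    fix w assume "w \<in> \<Phi> x"
    have "98/100 \<le> measure_pmf.prob (outputs (G w) (cut_off A b) {}) R"
      using assms(5)[OF \<open>w \<in> \<Phi> x\<close>] prob_cut_off[of "G w" A "{}" R b] by (simp add: run_def)
    then show "measure_pmf.prob (outputs (G w) (cut_off A b) {}) (- R) \<le> 2/100"
      using measure_pmf.prob_compl[of R "outputs (G w) (cut_off A b) {}"]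
      by (simp add: Compl_eq_Diff_UNIV)
  qed
  also have "\<dots> = Z x * (2/100)" using assms(3) by simp
  finally have "measure_pmf.prob (ideal_run ideal step (cut_off A b) x) (- R) - mu - lam * b \<le> 2/100"
    using Z_pos[OF assms(1)] by (simp only: mult_le_cancel_left_pos)
  then show ?thesis by linarith
qed

end

text \<open>One ideal process serves both families, so its output lies in \<open>R1\<close>, and
  likewise in \<open>R2\<close>, except with probability at most \<open>2/100 + 1/4\<close>; the two
  exceptions together do not reach 1.\<close>

lemma indistinguishable_families:
  fixes Z1 Z2 :: "'s \<Rightarrow> real"
  assumes 1: "hidden_graph G1 ideal step seen \<Phi>1 Z1 valid1 Q lam mu"
    and 2: "hidden_graph G2 ideal step seen \<Phi>2 Z2 valid2 Q lam mu"
    and x: "valid1 x b" "valid2 x b" "seen x = {}" "card (\<Phi>1 x) = Z1 x" "card (\<Phi>2 x) = Z2 x"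
    and A: "uses_only Q A"
    and R1: "\<And>w. w \<in> \<Phi>1 x \<Longrightarrow> 98/100 \<le> measure_pmf.prob (run (G1 w) A) {(r, c). r \<in> R1 \<and> c \<le> b}"
    and R2: "\<And>w. w \<in> \<Phi>2 x \<Longrightarrow> 98/100 \<le> measure_pmf.prob (run (G2 w) A) {(r, c). r \<in> R2 \<and> c \<le> b}"
    and disjoint: "R1 \<inter> R2 = {}"
    and small: "mu + lam * b \<le> 1/4"
  shows False
proof -
  let ?I = "ideal_run ideal step (cut_off A b) x"
  have "UNIV = - R1 \<union> - R2" using disjoint by auto
  then have "1 = measure_pmf.prob ?I (- R1 \<union> - R2)"
    using measure_pmf.prob_space[of ?I] by simp
  also have "\<dots> \<le> measure_pmf.prob ?I (- R1) + measure_pmf.prob ?I (- R2)"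
    by (rule measure_Un_le) auto
  also have "\<dots> \<le> (2/100 + mu + lam * b) + (2/100 + mu + lam * b)"
    using hidden_graph.ideal_run_escape[OF 1 x(1,3,4) A R1]
      hidden_graph.ideal_run_escape[OF 2 x(2,3,5) A R2]
    by (intro add_mono) auto
  finally show False using small by linarith
qed

text \<open>Two failure events of probability at most 1/100 are united. Costs are integers, so
  \<open>c < B\<close> and \<open>B \<le> b + 1\<close> give \<open>c \<le> b\<close>; thus
  \<open>b\<close> may be a budget rounded down.\<close>

lemma approximates_and_cheap:
  assumes "factor_approximates A G \<gamma>" "\<not> needs_cost A G B" "B \<le> real b + 1"
  shows "98/100 \<le> measure_pmf.prob (run G A)
           {(r, c). r \<in> {avg_degree G / \<gamma> .. \<gamma> * avg_degree G} \<and> c \<le> b}"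
proof -
  let ?P = "measure_pmf.prob (run G A)"
  let ?X = "{(r, c). r \<in> {avg_degree G / \<gamma> .. \<gamma> * avg_degree G}} :: (real \<times> nat) set"
  let ?Y = "{(r, c). real c < B} :: (real \<times> nat) set"
  let ?XY = "{(r, c). r \<in> {avg_degree G / \<gamma> .. \<gamma> * avg_degree G} \<and> c \<le> b} :: (real \<times> nat) set"
  have "- ?XY \<subseteq> - ?X \<union> - ?Y" using assms(3) by force
  then have "?P (- ?XY) \<le> ?P (- ?X \<union> - ?Y)"
    by (intro measure_pmf.finite_measure_mono) auto
  also have "\<dots> \<le> ?P (- ?X) + ?P (- ?Y)" by (rule measure_Un_le) auto
  also have "\<dots> \<le> 1/100 + 1/100"
    using assms(1,2) measure_pmf.prob_compl[of ?X "run G A"] measure_pmf.prob_compl[of ?Y "run G A"]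
    unfolding factor_approximates_def needs_cost_def
    by (intro add_mono) (simp_all add: Compl_eq_Diff_UNIV)
  finally show ?thesis using measure_pmf.prob_compl[of ?XY "run G A"]
    by (simp add: Compl_eq_Diff_UNIV)
qed

section \<open>Graphs of cliques and stars\<close>

definition block :: "nat \<Rightarrow> nat \<Rightarrow> nat set" where
  "block s i = {i * s..<Suc i * s}"

definition clique_edges :: "nat set \<Rightarrow> nat set set" where
  "clique_edges B = {e. e \<subseteq> B \<and> card e = 2}"

definition star_edges :: "nat set \<Rightarrow> nat set set" where
  "star_edges B = (\<lambda>v. {Min B, v}) ` (B - {Min B})"

lemma mem_block: "0 < s \<Longrightarrow> v \<in> block s i \<longleftrightarrow> v div s = i"
proof -
  assume s: "0 < s"
  show ?thesis
  proof
    assume "v \<in> block s i"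
    then show "v div s = i" using s
      by (intro div_nat_eqI) (auto simp: block_def mult.commute)
  next
    assume "v div s = i"
    then show "v \<in> block s i" using s
      by (auto simp: block_def dividend_less_div_times mult.commute)
        (metis dividend_less_div_times mult.commute)
  qed
qed

lemma finite_block [simp]: "finite (block s i)"
  and card_block [simp]: "card (block s i) = s"
  by (auto simp: block_def)

lemma finite_clique_edges: "finite B \<Longrightarrow> finite (clique_edges B)"
  by (rule finite_subset[of _ "Pow B"]) (auto simp: clique_edges_def)

lemma card_clique_edges: "finite B \<Longrightarrow> card (clique_edges B) = card B choose 2"
  unfolding clique_edges_def by (rule n_subsets)

lemma pair_in_clique_edges: "{x, y} \<in> clique_edges B \<longleftrightarrow> x \<in> B \<and> y \<in> B \<and> x \<noteq> y"
  by (auto simp: clique_edges_def card_2_iff doubleton_eq_iff)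

text \<open>As stars lie inside cliques on the same vertices, an edge of either kind is confined to
  its block by the same argument.\<close>

lemma star_edges_subset:
  assumes "finite B" shows "star_edges B \<subseteq> clique_edges B"
proof
  fix e assume "e \<in> star_edges B"
  then obtain v where "e = {Min B, v}" "v \<in> B" "v \<noteq> Min B" by (auto simp: star_edges_def)
  moreover have "Min B \<in> B" using assms \<open>v \<in> B\<close> by (intro Min_in) auto
  ultimately show "e \<in> clique_edges B" by (simp add: pair_in_clique_edges)
qed

lemma card_star_edges_le: "finite B \<Longrightarrow> card (star_edges B) \<le> card B"
  unfolding star_edges_def by (meson card_image_le card_mono finite_Diff Diff_subset le_trans)

lemma star_edges_cover:
  assumes "finite B" "2 \<le> card B" "v \<in> B"
  shows "\<exists>e\<in>star_edges B. v \<in> e"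
proof (cases "v = Min B")
  case True
  have "B - {Min B} \<noteq> {}"
  proof
    assume "B - {Min B} = {}"
    then have "card B \<le> card {Min B}" by (intro card_mono) auto
    then show False using assms(2) by simp
  qed
  then obtain w where "w \<in> B - {Min B}" by blast
  then show ?thesis using True by (auto simp: star_edges_def)
next
  case False
  then show ?thesis using assms by (auto simp: star_edges_def)
qed

lemma clique_edges_cover:
  assumes "finite B" "2 \<le> card B" "v \<in> B"
  shows "\<exists>e\<in>clique_edges B. v \<in> e"
  using star_edges_cover[OF assms] star_edges_subset[OF assms(1)] by blast

text \<open>Turning a block from a clique into a star makes almost all of its edges disappear but
  leaves no vertex isolated.\<close>

definition block_graph :: "nat \<Rightarrow> nat \<Rightarrow> nat \<Rightarrow> nat set \<Rightarrow> graph" where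
  "block_graph n s N T = \<lparr>verts = {..<n},
     edges = (\<Union>i\<in>T. clique_edges (block s i)) \<union> (\<Union>i\<in>{..<N} - T. star_edges (block s i))
       \<union> star_edges {N * s..<n}\<rparr>"

text \<open>The vertices from \<open>N * s\<close> on belong to no block and form one more star.
  Having at least two of them, and at least two vertices in each block, leaves no vertex
  isolated.\<close>

locale block_params =
  fixes n s N :: nat
  assumes s: "2 \<le> s" and n: "N * s + 2 \<le> n"
begin

abbreviation "bg \<equiv> block_graph n s N"

lemma s_pos: "0 < s" using s by simp

lemma block_unique: "x \<in> block s i \<Longrightarrow> x \<in> block s j \<Longrightarrow> i = j"
  using s_pos by (simp add: mem_block)

lemma block_subset: "i < N \<Longrightarrow> block s i \<subseteq> {..<N * s}"
proof -
  assume "i < N"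
  then have "Suc i * s \<le> N * s" by (intro mult_le_mono1) auto
  then show ?thesis by (auto simp: block_def)
qed

lemma edges_bg:
  "edges (bg T) = (\<Union>i\<in>T. clique_edges (block s i)) \<union> (\<Union>i\<in>{..<N} - T. star_edges (block s i))
       \<union> star_edges {N * s..<n}"
  by (simp add: block_graph_def)

lemma finite_star_edges: "finite B \<Longrightarrow> finite (star_edges B)"
  by (simp add: star_edges_def)

lemma finite_edges: "T \<subseteq> {..<N} \<Longrightarrow> finite (edges (bg T))"
  unfolding edges_bg
  by (intro finite_UnI finite_UN_I finite_clique_edges finite_star_edges finite_block)
    (auto intro: finite_subset)

lemma edge_cases:
  assumes e: "e \<in> edges (bg T)" and T: "T \<subseteq> {..<N}"
  obtains i where "i < N" "e \<in> clique_edges (block s i)" "i \<in> T"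
  | i where "i < N" "e \<in> clique_edges (block s i)" "i \<notin> T"
  | "e \<in> clique_edges {N * s..<n}"
proof -
  consider i where "i \<in> T" "e \<in> clique_edges (block s i)"
    | i where "i \<in> {..<N} - T" "e \<in> star_edges (block s i)" | "e \<in> star_edges {N * s..<n}"
    using e unfolding edges_bg by blast
  then show thesis
  proof cases
    case 1
    then show ?thesis using that(1) T by blast
  next
    case 2
    then show ?thesis using that(2) star_edges_subset[OF finite_block, of s i] by blast
  next
    case 3
    then show ?thesis using that(3) star_edges_subset[of "{N * s..<n}"] by blast
  qed
qed

text \<open>Blocks are disjoint and every edge stays inside its block, so what is visible from a
  clique block does not depend on the rest of \<open>T\<close>.\<close>

lemma edge_meets_clique:
  assumes T: "T \<subseteq> {..<N}" and x: "x \<in> e" "x \<in> block s j" "j \<in> T"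
  shows "e \<in> edges (bg T) \<longleftrightarrow> e \<in> clique_edges (block s j)"
proof
  assume e: "e \<in> edges (bg T)"
  have *: "e \<in> clique_edges (block s j)" if i: "e \<in> clique_edges (block s i)" for i
  proof -
    have "x \<in> block s i" using i x(1) by (auto simp: clique_edges_def)
    then have "j = i" by (rule block_unique[OF x(2)])
    then show ?thesis using i by simp
  qed
  from e show "e \<in> clique_edges (block s j)"
  proof (rule edge_cases[OF _ T])
    assume "e \<in> clique_edges {N * s..<n}"
    then have "x \<ge> N * s" using x by (auto simp: clique_edges_def)
    moreover have "x < N * s" using x T block_subset[of j] by auto
    ultimately show ?thesis by simp
  qed (erule *)+
next
  assume "e \<in> clique_edges (block s j)"
  then show "e \<in> edges (bg T)" using x by (auto simp: block_graph_def)
qed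

lemma bg_in_graphs:
  assumes T: "T \<subseteq> {..<N}"
  shows "bg T \<in> graphs n"
proof -
  have *: "e \<subseteq> {..<n} \<and> card e = 2" if "e \<in> clique_edges B" "B \<subseteq> {..<n}" for e B
    using that unfolding clique_edges_def by blast
  have "N * s \<le> n" using n by simp
  then have "block s i \<subseteq> {..<n}" if "i < N" for i
    using block_subset[OF that] by (meson lessThan_subset_iff subset_trans)
  moreover have "{N * s..<n} \<subseteq> {..<n}" by auto
  ultimately have "e \<subseteq> {..<n} \<and> card e = 2" if "e \<in> edges (bg T)" for e
    using edge_cases[OF that T] * by metis
  moreover have "\<exists>e\<in>edges (bg T). v \<in> e" if "v < n" for v
  proof (cases "v < N * s")
    case True
    let ?i = "v div s"
    have i: "?i < N" using True s_pos by (simp add: less_mult_imp_div_less)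
    have v: "v \<in> block s ?i" using s_pos by (simp add: mem_block)
    show ?thesis
    proof (cases "?i \<in> T")
      case True
      moreover obtain e where "e \<in> clique_edges (block s ?i)" "v \<in> e"
        using clique_edges_cover[OF finite_block _ v] s by auto
      ultimately show ?thesis unfolding edges_bg by blast
    next
      case False
      moreover obtain e where "e \<in> star_edges (block s ?i)" "v \<in> e"
        using star_edges_cover[OF finite_block _ v] s by auto
      ultimately show ?thesis using i unfolding edges_bg by blast
    qed
  next
    case False
    then have "v \<in> {N * s..<n}" using that by simp
    then obtain e where "e \<in> star_edges {N * s..<n}" "v \<in> e"
      using star_edges_cover[of "{N * s..<n}" v] le_diff_conv2[of "N * s" n 2] n by auto
    then show ?thesis unfolding edges_bg by blast
  qed
  moreover have "verts (bg T) = {..<n}" by (simp add: block_graph_def)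
  ultimately show ?thesis
    by (simp add: graphs_def simple_graph_def no_isolated_def)
qed

lemma disjoint_clique_edges:
  assumes "i \<noteq> j"
  shows "clique_edges (block s i) \<inter> clique_edges (block s j) = {}"
proof -
  have False if e: "e \<subseteq> block s i" "e \<subseteq> block s j" "card e = 2" for e
  proof -
    have "e \<noteq> {}" using e(3) by auto
    then obtain x where "x \<in> e" by blast
    then have "x \<in> block s i" "x \<in> block s j" using e(1,2) by auto
    then show False using block_unique[of x i j] assms by simp
  qed
  then show ?thesis by (auto simp: clique_edges_def)
qed

lemma card_Union_clique_edges:
  assumes "finite U"
  shows "card (\<Union>i\<in>U. clique_edges (block s i)) = card U * (s choose 2)"
proof -
  have "card (\<Union>i\<in>U. clique_edges (block s i)) = (\<Sum>i\<in>U. card (clique_edges (block s i)))"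
    by (rule card_UN_disjoint)
      (use assms in \<open>simp_all add: finite_clique_edges disjoint_clique_edges\<close>)
  then show ?thesis by (simp add: card_clique_edges)
qed

lemma card_edges_ge:
  assumes T: "T \<subseteq> {..<N}"
  shows "card T * (s choose 2) \<le> card (edges (bg T))"
proof -
  have "card (\<Union>i\<in>T. clique_edges (block s i)) \<le> card (edges (bg T))"
    using finite_edges[OF T] by (intro card_mono) (auto simp: block_graph_def)
  then show ?thesis using T by (simp add: card_Union_clique_edges finite_subset)
qed

text \<open>A star has no more edges than vertices and the stars are vertex-disjoint, so together
  they account for the term \<open>n\<close>.\<close>

lemma card_edges_le:
  assumes T: "T \<subseteq> {..<N}"
  shows "card (edges (bg T)) \<le> card T * (s choose 2) + n"
proof -
  have fT: "finite T" using T by (rule finite_subset) simp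
  have "card (edges (bg T)) \<le> card (\<Union>i\<in>T. clique_edges (block s i))
      + card (\<Union>i\<in>{..<N} - T. star_edges (block s i)) + card (star_edges {N * s..<n})"
    unfolding block_graph_def by simp (meson add_mono card_Un_le le_refl le_trans)
  also have "card (\<Union>i\<in>{..<N} - T. star_edges (block s i))
      \<le> (\<Sum>i\<in>{..<N} - T. card (star_edges (block s i)))"
    by (rule card_UN_le) simp
  also have "\<dots> \<le> (\<Sum>i\<in>{..<N} - T. s)"
    using card_star_edges_le[OF finite_block, of s] by (intro sum_mono) simp
  also have "\<dots> \<le> N * s" using fT T by (simp add: card_Diff_subset)
  also have "card (star_edges {N * s..<n}) \<le> n - N * s"
    using card_star_edges_le[of "{N * s..<n}"] by simp
  finally show ?thesis using fT n by (simp add: card_Union_clique_edges)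
qed

lemma nbrs_clique:
  assumes "T \<subseteq> {..<N}" "j \<in> T" "x \<in> block s j"
  shows "nbrs (bg T) x = block s j - {x}"
  using edge_meets_clique[OF assms(1) _ assms(3,2)] assms
  by (auto simp: nbrs_def pair_in_clique_edges)

lemma block_minus_nonempty: "block s j - {x} \<noteq> {}"
proof
  assume "block s j - {x} = {}"
  then have "card (block s j) \<le> card {x}" by (intro card_mono) auto
  then show False using s by simp
qed

lemma edges_within:
  assumes T: "T \<subseteq> {..<N}" and U: "U \<subseteq> T" and S: "S \<subseteq> (\<Union>i\<in>U. block s i)"
  shows "{e \<in> edges (bg T). e \<subseteq> S} = {e. e \<subseteq> S \<and> (\<exists>i\<in>U. e \<in> clique_edges (block s i))}"
proof (intro set_eqI iffI)
  fix e assume e: "e \<in> {e \<in> edges (bg T). e \<subseteq> S}"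
  then have "card e = 2" using bg_in_graphs[OF T] by (auto simp: graphs_def simple_graph_def)
  then obtain x where x: "x \<in> e" by fastforce
  then obtain j where j: "j \<in> U" "x \<in> block s j" using e S by auto
  then show "e \<in> {e. e \<subseteq> S \<and> (\<exists>i\<in>U. e \<in> clique_edges (block s i))}"
    using e edge_meets_clique[OF T x j(2)] U by auto
next
  fix e assume "e \<in> {e. e \<subseteq> S \<and> (\<exists>i\<in>U. e \<in> clique_edges (block s i))}"
  then show "e \<in> {e \<in> edges (bg T). e \<subseteq> S}" using U by (auto simp: block_graph_def)
qed

text \<open>The queried vertices lie in blocks that are cliques for both choices, and edges meeting
  these blocks stay inside them. Hence additive and full neighbourhood queries are as uninformative
  as the others: only \<open>RandEdge\<close> can tell \<open>T\<close> from
  \<open>T'\<close>.\<close>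

lemma reply_agree:
  assumes T: "T \<subseteq> {..<N}" "U \<subseteq> T" and T': "T' \<subseteq> {..<N}" "U \<subseteq> T'"
    and S: "S \<subseteq> (\<Union>i\<in>U. block s i)" and q: "query_args q \<subseteq> S" "q \<noteq> RandEdge"
  shows "reply (bg T) q = reply (bg T') q"
proof -
  have *: "nbrs (bg T) x = nbrs (bg T') x" if x: "x \<in> S" for x
  proof -
    obtain j where "j \<in> U" "x \<in> block s j" using x S by auto
    then show ?thesis
      using nbrs_clique[OF T(1), of j x] nbrs_clique[OF T'(1), of j x] T(2) T'(2) by (metis subsetD)
  qed
  have within: "{e \<in> edges (bg T). e \<subseteq> R} = {e \<in> edges (bg T'). e \<subseteq> R}" if "R \<subseteq> S" for R
    using edges_within[OF T, of R] edges_within[OF T', of R] subset_trans[OF that S] by simp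
  show ?thesis
  proof (cases q)
    case (PairQuery x y)
    then have "{x, y} \<in> edges (bg T) \<longleftrightarrow> {x, y} \<in> {e \<in> edges (bg T). e \<subseteq> {x, y}}" by simp
    also have "\<dots> \<longleftrightarrow> {x, y} \<in> {e \<in> edges (bg T'). e \<subseteq> {x, y}}"
      using within[of "{x, y}"] q PairQuery by simp
    finally show ?thesis using PairQuery by simp
  next
    case (RandNbr x)
    then show ?thesis using q *[of x] by simp
  next
    case (Degree x)
    then show ?thesis using q *[of x] by simp
  next
    case (Additive R)
    then show ?thesis using q within[of R] by simp
  next
    case (FullNbrHood x)
    then show ?thesis using q *[of x] by simp
  qed (use q in simp)
qed

lemma set_pmf_reply:
  assumes T: "T \<subseteq> {..<N}" "U \<subseteq> T" and S: "S \<subseteq> (\<Union>i\<in>U. block s i)"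
    and q: "query_args q \<subseteq> S" "q \<noteq> RandEdge"
  shows "finite (set_pmf (reply (bg T) q))"
    and "a \<in> set_pmf (reply (bg T) q) \<Longrightarrow> revealed a \<subseteq> (\<Union>i\<in>U. block s i)"
proof -
  have fin: "finite (nbrs (bg T) x)" "nbrs (bg T) x \<noteq> {}"
    "nbrs (bg T) x \<subseteq> (\<Union>i\<in>U. block s i)" if x: "x \<in> S" for x
  proof -
    obtain j where j: "j \<in> U" "x \<in> block s j" using x S by blast
    then have "nbrs (bg T) x = block s j - {x}" using nbrs_clique[OF T(1), of j x] T(2) by blast
    then show "finite (nbrs (bg T) x)" "nbrs (bg T) x \<noteq> {}"
      "nbrs (bg T) x \<subseteq> (\<Union>i\<in>U. block s i)"
      using j block_minus_nonempty[of j x] by auto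
  qed
  show "finite (set_pmf (reply (bg T) q))"
  proof (cases q)
    case (RandNbr x)
    then show ?thesis using q fin[of x] by simp
  qed (use q in simp_all)
  show "revealed a \<subseteq> (\<Union>i\<in>U. block s i)" if "a \<in> set_pmf (reply (bg T) q)"
  proof (cases q)
    case (RandNbr x)
    then show ?thesis using q fin[of x] that by auto
  next
    case (FullNbrHood x)
    then show ?thesis using q fin[of x] that by auto
  qed (use q that in simp_all)
qed

end

section \<open>The lower bound for additive and neighborhood queries\<close>

lemma card_supersets:
  assumes "finite A" "U \<subseteq> A" "card U \<le> k"
  shows "card {T. T \<subseteq> A \<and> card T = k \<and> U \<subseteq> T} = (card A - card U) choose (k - card U)"
proof -
  have fU: "finite U" using assms finite_subset by blast
  have "bij_betw (\<lambda>T. T - U) {T. T \<subseteq> A \<and> card T = k \<and> U \<subseteq> T}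
      {B. B \<subseteq> A - U \<and> card B = k - card U}"
  proof (rule bij_betwI[where g="\<lambda>B. B \<union> U"])
    show "(\<lambda>T. T - U) \<in> {T. T \<subseteq> A \<and> card T = k \<and> U \<subseteq> T} \<rightarrow> {B. B \<subseteq> A - U \<and> card B = k - card U}"
      using fU by (auto simp: card_Diff_subset)
    show "(\<lambda>B. B \<union> U) \<in> {B. B \<subseteq> A - U \<and> card B = k - card U} \<rightarrow> {T. T \<subseteq> A \<and> card T = k \<and> U \<subseteq> T}"
    proof
      fix B assume B: "B \<in> {B. B \<subseteq> A - U \<and> card B = k - card U}"
      then have "finite B" using assms(1) finite_subset by blast
      then have "card (B \<union> U) = card B + card U" using fU B by (intro card_Un_disjoint) auto
      then show "B \<union> U \<in> {T. T \<subseteq> A \<and> card T = k \<and> U \<subseteq> T}" using B assms by auto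
    qed
  qed auto
  then have "card {T. T \<subseteq> A \<and> card T = k \<and> U \<subseteq> T} = card {B. B \<subseteq> A - U \<and> card B = k - card U}"
    by (rule bij_betw_same_card)
  then show ?thesis using assms fU n_subsets[of "A - U" "k - card U"] by (simp add: card_Diff_subset)
qed

lemma pmf_EdgeAns_of_set:
  assumes "finite E" "e \<in> E"
  shows "pmf (map_pmf EdgeAns (pmf_of_set E)) (EdgeAns e) = 1 / card E"
proof -
  have "E \<noteq> {}" using assms by auto
  then show ?thesis using assms
    by (subst pmf_map_inj') (auto simp: inj_on_def)
qed

context block_params
begin

text \<open>A state is the pair of the revealed vertices and the blocks already hit by a random
  edge. A random edge always comes from a clique in an unhit block. All other queries are answered
  as if every block were a clique, which by \<open>reply_agree\<close> is right for every
  \<open>T\<close> containing the hit blocks.\<close>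

definition fresh_ideal :: "nat set \<times> nat set \<Rightarrow> query \<Rightarrow> answer pmf" where
  "fresh_ideal x q = (if q = RandEdge
     then map_pmf EdgeAns (pmf_of_set (\<Union>i\<in>{..<N} - snd x. clique_edges (block s i)))
     else respond (bg {..<N}) (fst x) q)"

definition fresh_step :: "nat set \<times> nat set \<Rightarrow> query \<Rightarrow> answer \<Rightarrow> nat set \<times> nat set" where
  "fresh_step x q a = (fst x \<union> revealed a,
     if q = RandEdge then insert (Min (revealed a) div s) (snd x) else snd x)"

definition chosen :: "nat \<Rightarrow> nat set \<times> nat set \<Rightarrow> nat set set" where
  "chosen k x = {T. T \<subseteq> {..<N} \<and> card T = k \<and> snd x \<subseteq> T}"

text \<open>Only a random edge, at cost 1, adds a block, so the sum of the hit blocks and the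
  remaining budget never grows.\<close>

definition fresh_valid :: "nat \<Rightarrow> nat set \<times> nat set \<Rightarrow> nat \<Rightarrow> bool" where
  "fresh_valid m x b \<longleftrightarrow>
     snd x \<subseteq> {..<N} \<and> fst x \<subseteq> (\<Union>i\<in>snd x. block s i) \<and> card (snd x) + b \<le> m"

lemma card_chosen:
  assumes "snd x \<subseteq> {..<N}" "card (snd x) \<le> k"
  shows "card (chosen k x) = (N - card (snd x)) choose (k - card (snd x))"
  unfolding chosen_def using card_supersets[OF _ assms] by simp

lemma choose_two_pos: "0 < s choose 2"
  using s by (simp add: zero_less_binomial)

lemma fresh_edge:
  assumes "e \<in> clique_edges (block s c)"
  shows "e \<subseteq> block s c" "Min e div s = c"
proof -
  show "e \<subseteq> block s c" using assms by (simp add: clique_edges_def)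
  have "finite e" "e \<noteq> {}" using assms by (auto simp: clique_edges_def intro: card_ge_0_finite)
  then have "Min e \<in> e" by (rule Min_in)
  then show "Min e div s = c" using \<open>e \<subseteq> block s c\<close> s_pos mem_block by blast
qed

text \<open>Let \<open>u\<close> blocks be hit and \<open>C = s choose 2\<close>. A given fresh edge
  has probability \<open>1 / ((N - u) * C)\<close> in the ideal process and
  \<open>1 / card (edges (bg T))\<close> in the hidden graph, while the number of consistent
  \<open>T\<close> shrinks by the factor \<open>(k - u) / (N - u)\<close>. So \<open>N\<close>
  cancels and \<open>(k - u) * C\<close> has to be compared with the number of edges;
  \<open>bound\<close> does this at \<open>u = m\<close>. The consistent sets are counted exactly,
  hence \<open>mu = 0\<close>.\<close>

lemma hidden_blocks:
  fixes lam :: real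
  assumes k: "m \<le> k" "k \<le> N" and lam: "0 \<le> lam"
    and bound: "(1 - lam) * (k * (s choose 2) + n) \<le> (real k - m) * (s choose 2)"
  shows "hidden_graph bg fresh_ideal fresh_step fst (chosen k) (\<lambda>x. real (card (chosen k x)))
           (fresh_valid m) UNIV lam 0"
proof
  let ?full = "\<lambda>U. \<Union>i\<in>{..<N} - U. clique_edges (block s i)"
  show fin: "finite (chosen k x)" for x
    by (rule finite_subset[of _ "Pow {..<N}"]) (auto simp: chosen_def)
  show "0 \<le> lam" by (rule lam)
  show Zpos: "0 < real (card (chosen k x))" if "fresh_valid m x b" for x b
    using that k by (subst card_chosen) (auto simp: fresh_valid_def zero_less_binomial_iff)
  show "(1 - 0) * real (card (chosen k x)) \<le> real (card (chosen k x))" for x by simp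
  fix x b q
  assume v: "fresh_valid m x b" and c: "query_cost q \<le> b"
  obtain S U where x: "x = (S, U)" by (cases x)
  from v have U: "U \<subseteq> {..<N}" and S: "S \<subseteq> (\<Union>i\<in>U. block s i)" and card: "card U + b \<le> m"
    by (auto simp: fresh_valid_def x)
  have fU: "finite U" using U finite_subset by blast
  have fE: "finite (?full U)" by (simp add: finite_clique_edges)
  have cardE: "card (?full U) = (N - card U) * (s choose 2)"
    using U fU by (subst card_Union_clique_edges) (auto simp: card_Diff_subset)
  have nonempty: "?full U \<noteq> {}" if "q = RandEdge"
  proof -
    have "0 < (N - card U) * (s choose 2)" using card c that k choose_two_pos by simp
    then show ?thesis using cardE by (metis card.empty less_numeral_extra(3))
  qed
  have RE: "\<exists>e c. a = EdgeAns e \<and> c \<in> {..<N} - U \<and> e \<in> clique_edges (block s c)"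
    if "q = RandEdge" "a \<in> set_pmf (fresh_ideal x q)" for a
    using that nonempty fE by (auto simp: fresh_ideal_def x)
  have other: "a \<in> set_pmf (respond (bg {..<N}) S q)" if "q \<noteq> RandEdge" "a \<in> set_pmf (fresh_ideal x q)" for a
    using that by (auto simp: fresh_ideal_def x)
  have revealed: "revealed a \<subseteq> (\<Union>i\<in>U. block s i)" if "q \<noteq> RandEdge" "a \<in> set_pmf (fresh_ideal x q)" for a
    using other[OF that] set_pmf_reply(2)[OF subset_refl U S _ that(1)]
    by (auto simp: respond_def split: if_splits)
  show "finite (set_pmf (fresh_ideal x q))"
  proof (cases "q = RandEdge")
    case True
    then show ?thesis using nonempty fE by (simp add: fresh_ideal_def x)
  next
    case False
    then show ?thesis using set_pmf_reply(1)[OF subset_refl U S _ False]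
      by (auto simp: fresh_ideal_def x respond_def)
  qed
  fix a assume a: "a \<in> set_pmf (fresh_ideal x q)"
  show "fresh_valid m (fresh_step x q a) (b - query_cost q)"
  proof (cases "q = RandEdge")
    case True
    from RE[OF True a] obtain e d where e: "a = EdgeAns e" "d < N" "d \<notin> U" "e \<in> clique_edges (block s d)"
      by blast
    then show ?thesis using fresh_edge[OF e(4)] U S card c fU True
      by (auto simp: fresh_valid_def fresh_step_def x)
  next
    case False
    then show ?thesis using revealed[OF False a] U S card
      by (auto simp: fresh_valid_def fresh_step_def x)
  qed
  show "fst (fresh_step x q a) = fst x \<union> revealed a" by (simp add: fresh_step_def)
  show sub: "chosen k (fresh_step x q a) \<subseteq> chosen k x" by (auto simp: chosen_def fresh_step_def)
  fix T assume T: "T \<in> chosen k (fresh_step x q a)"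
  show "(1 - lam * query_cost q) * real (card (chosen k x)) * pmf (fresh_ideal x q) a
          \<le> real (card (chosen k (fresh_step x q a))) * pmf (respond (bg T) (fst x) q) a"
  proof (cases "q = RandEdge")
    case True
    from RE[OF True a] obtain e d where e: "a = EdgeAns e" "d < N" "d \<notin> U" "e \<in> clique_edges (block s d)"
      by blast
    have step: "fresh_step x q a = (S \<union> e, insert d U)"
      using True e fresh_edge[OF e(4)] by (simp add: fresh_step_def x)
    have T: "T \<subseteq> {..<N}" "card T = k" "insert d U \<subseteq> T" using T by (auto simp: chosen_def step)
    let ?u = "card U" let ?C = "s choose 2" let ?m = "card (edges (bg T))"
    have u: "?u < m" using card c True by simp
    have id: "(N - ?u) * card (chosen k (fresh_step x q a)) = (k - ?u) * card (chosen k x)"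
    proof -
      have "card (chosen k (fresh_step x q a)) = (N - ?u - 1) choose (k - ?u - 1)"
        using e(2,3) fU u k U by (subst card_chosen) (auto simp: step)
      moreover have "card (chosen k x) = (N - ?u) choose (k - ?u)"
        using u k U by (subst card_chosen) (auto simp: x)
      moreover have "(k - ?u) * ((N - ?u) choose (k - ?u)) = (N - ?u) * ((N - ?u - 1) choose (k - ?u - 1))"
        using u k by (intro times_binomial_minus1_eq) simp
      ultimately show ?thesis by simp
    qed
    have eT: "e \<in> edges (bg T)" using e T by (auto simp: block_graph_def)
    have r: "pmf (respond (bg T) (fst x) q) a = 1 / ?m"
      using True e(1) pmf_EdgeAns_of_set[OF finite_edges[OF T(1)] eT] by (simp add: respond_def)
    have i: "pmf (fresh_ideal x q) a = 1 / ((real N - ?u) * ?C)"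
      using pmf_EdgeAns_of_set[OF fE, of e] e True cardE u k
      by (auto simp: fresh_ideal_def x of_nat_diff)
    have m: "0 < ?m" using eT finite_edges[OF T(1)] card_gt_0_iff by blast
    have Nu: "0 < real N - ?u" using u k by simp
    have "(1 - lam) * ?m \<le> (real k - ?u) * ?C"
    proof (cases "lam \<le> 1")
      case True
      have "real ?m \<le> k * ?C + n"
        using of_nat_mono[OF card_edges_le[OF T(1)], where 'a=real] T(2) by simp
      then have "(1 - lam) * ?m \<le> (1 - lam) * (k * ?C + n)"
        using True by (intro mult_left_mono) auto
      also have "\<dots> \<le> (real k - m) * ?C" by (rule bound)
      also have "\<dots> \<le> (real k - ?u) * ?C" using u by (intro mult_right_mono) auto
      finally show ?thesis .
    next
      case False
      then have "(1 - lam) * ?m \<le> 0" by (intro mult_nonpos_nonneg) auto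
      also have "0 \<le> (real k - ?u) * ?C" using u k by (intro mult_nonneg_nonneg) auto
      finally show ?thesis .
    qed
    then have "(1 - lam) * ?m * card (chosen k x) \<le> (real k - ?u) * ?C * card (chosen k x)"
      by (intro mult_right_mono) auto
    also have "\<dots> = ?C * ((real N - ?u) * card (chosen k (fresh_step x q a)))"
    proof -
      have "(real N - ?u) * card (chosen k (fresh_step x q a)) = (real k - ?u) * card (chosen k x)"
        using arg_cong[OF id, of real] u k by (simp add: of_nat_diff)
      then show ?thesis by simp
    qed
    finally show ?thesis using m Nu choose_two_pos True
      unfolding r i by (simp add: field_simps)
  next
    case False
    have T: "T \<subseteq> {..<N}" "U \<subseteq> T" using T by (auto simp: chosen_def fresh_step_def x)
    have "respond (bg T) S q = respond (bg {..<N}) S q"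
      using reply_agree[OF T subset_refl U S _ False] by (auto simp: respond_def)
    then have "pmf (respond (bg T) (fst x) q) a = pmf (fresh_ideal x q) a"
      using False by (simp add: fresh_ideal_def x)
    moreover have "chosen k (fresh_step x q a) = chosen k x"
      using False by (auto simp: chosen_def fresh_step_def)
    moreover have "(1 - lam * query_cost q) * (real (card (chosen k x)) * pmf (fresh_ideal x q) a)
        \<le> 1 * (real (card (chosen k x)) * pmf (fresh_ideal x q) a)"
      using lam by (intro mult_right_mono) auto
    ultimately show ?thesis by (simp add: mult.assoc)
  qed
qed simp

end

section \<open>Two families with a gap in average degree\<close>

lemma real_choose_two: "2 * real (s choose 2) = real s * (real s - 1)"
proof (cases s)
  case (Suc t)
  have "2 * (s choose 2) = s * t" using Suc by (simp add: choose_two)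
  then have "real (2 * (s choose 2)) = real (s * t)" by (rule arg_cong)
  then show ?thesis using Suc by (simp add: algebra_simps)
qed simp

context block_params
begin

lemma avg_degree_bg:
  assumes T: "T \<subseteq> {..<N}"
  shows "card T * s * (real s - 1) / n \<le> avg_degree (bg T)"
    and "avg_degree (bg T) \<le> card T * s * (real s - 1) / n + 2"
proof -
  have n0: "0 < real n" using n by simp
  have avg: "avg_degree (bg T) = 2 * real (card (edges (bg T))) / n"
    by (simp add: avg_degree_def block_graph_def)
  have C: "card T * s * (real s - 1) = 2 * real (card T * (s choose 2))"
    by (simp add: mult.assoc real_choose_two flip: mult.left_commute[of 2])
  have "2 * real (card T * (s choose 2)) \<le> 2 * real (card (edges (bg T)))"
    using of_nat_mono[OF card_edges_ge[OF T], where 'a=real] by simp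
  then show "card T * s * (real s - 1) / n \<le> avg_degree (bg T)"
    unfolding avg C by (intro divide_right_mono) auto
  have "real (card (edges (bg T))) \<le> real (card T * (s choose 2)) + n"
    using of_nat_mono[OF card_edges_le[OF T], where 'a=real] by simp
  then have "2 * real (card (edges (bg T))) / n \<le> (2 * real (card T * (s choose 2)) + 2 * n) / n"
    using n0 by (intro divide_right_mono) auto
  then show "avg_degree (bg T) \<le> card T * s * (real s - 1) / n + 2"
    unfolding avg C using n0 by (simp add: add_divide_distrib)
qed

end

text \<open>The dense family makes all \<open>N\<close> blocks cliques, the sparse one only
  \<open>k\<close>, about \<open>N / K\<close> of them. Subtracting 1 in \<open>N\<close> reserves
  between \<open>s\<close> and \<open>2 * s\<close> vertices for the final star;
  \<open>4 * K * s \<le> n\<close> makes \<open>N\<close> at least \<open>2 * K\<close>, so that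
  each rounding loses at most a factor 2.\<close>

locale two_scales =
  fixes n s N K k :: nat
  assumes K: "2 \<le> K" and s: "2 \<le> s" and sK: "4 * K * s \<le> n"
    and N_def: "N = n div s - 1" and k_def: "k = N div K"
begin

lemma n_ge: "8 * s \<le> n"
proof -
  have "2 * (4 * s) \<le> K * (4 * s)" by (intro mult_le_mono1 K)
  also have "\<dots> = 4 * K * s" by simp
  finally show ?thesis using sK by linarith
qed

lemma div_le: "n div s * s \<le> n" by simp

lemma div_gt: "n < n div s * s + s"
  using s by (metis add.commute dividend_less_div_times gr0I not_numeral_le_zero)

lemma N_s: "N * s + s \<le> n" "n < N * s + 2 * s"
proof -
  have "n div s \<ge> 8" using n_ge s by (simp add: less_eq_div_iff_mult_less_eq)
  then have "n div s * s = N * s + s" by (simp add: N_def algebra_simps)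
  then show "N * s + s \<le> n" "n < N * s + 2 * s" using div_le div_gt by linarith+
qed

sublocale block_params n s N
  using s N_s by unfold_locales auto

lemma n_le_N: "n \<le> 2 * (N * s)"
  using N_s(2) n_ge by linarith

lemma N_ge: "2 * K \<le> N"
proof -
  have "2 * K * s \<le> N * s" using n_le_N sK by linarith
  then show ?thesis using s by simp
qed

lemma k_le: "k * K \<le> N" by (simp add: k_def)

lemma k_le_N: "k \<le> N" by (simp add: k_def)

lemma N_le: "N \<le> 2 * (k * K)"
proof -
  have "N < k * K + K" unfolding k_def
    using K by (metis add.commute dividend_less_div_times gr0I not_numeral_le_zero)
  then show ?thesis using N_ge by linarith
qed

lemma n_le_k: "n \<le> 4 * K * (k * s)"
proof -
  have "2 * (N * s) \<le> 2 * (2 * (k * K) * s)" by (intro mult_le_mono N_le) auto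
  also have "\<dots> = 4 * K * (k * s)" by simp
  finally show ?thesis using n_le_N by (rule le_trans[rotated])
qed

lemma k_pos: "0 < k"
  using N_ge K unfolding k_def by (simp add: div_greater_zero_iff)

lemma avg_degree_dense:
  assumes "T \<subseteq> {..<N}" "card T = N"
  shows "(real s - 1) / 2 \<le> avg_degree (bg T)"
    and "avg_degree (bg T) \<le> real s + 1"
proof -
  have n0: "0 < real n" using N_s s by linarith
  have "real n \<le> 2 * (real N * real s)" using of_nat_mono[OF n_le_N, where 'a=real] by simp
  then have "(real s - 1) / 2 \<le> N * s * (real s - 1) / n"
    using n0 s mult_right_mono[of "real n" "2 * (real N * real s)" "real s - 1"]
    by (simp add: field_simps)
  then show "(real s - 1) / 2 \<le> avg_degree (bg T)"
    using avg_degree_bg(1)[OF assms(1)] unfolding assms(2) by (rule order_trans)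
  have "N * s \<le> n" using N_s by simp
  then have "real N * real s \<le> n" by (metis of_nat_le_iff of_nat_mult)
  then have "N * s * (real s - 1) / n \<le> real s - 1"
    using n0 s mult_right_mono[of "real N * real s" n "real s - 1"] by (simp add: field_simps)
  then show "avg_degree (bg T) \<le> real s + 1"
    using avg_degree_bg(2)[OF assms(1)] assms(2) by simp
qed

lemma avg_degree_sparse:
  assumes "T \<subseteq> {..<N}" "card T = k"
  shows "(real s - 1) / (4 * K) \<le> avg_degree (bg T)"
    and "avg_degree (bg T) \<le> (real s - 1) / K + 2"
proof -
  have n0: "0 < real n" using N_s s by linarith
  have K0: "0 < real K" using K by simp
  have "real n \<le> 4 * K * (real k * real s)" using of_nat_mono[OF n_le_k, where 'a=real] by simp
  then have "(real s - 1) / (4 * K) \<le> k * s * (real s - 1) / n"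
    using n0 s K0 mult_right_mono[of "real n" "4 * K * (real k * real s)" "real s - 1"]
    by (simp add: field_simps)
  then show "(real s - 1) / (4 * K) \<le> avg_degree (bg T)"
    using avg_degree_bg(1)[OF assms(1)] assms(2) by simp
  have "k * K * s \<le> N * s" by (intro mult_le_mono1 k_le)
  then have "k * K * s \<le> n" using N_s(1) by linarith
  then have "real k * real K * real s \<le> n" by (metis of_nat_le_iff of_nat_mult)
  then have "k * s * (real s - 1) / n \<le> (real s - 1) / K"
    using n0 s K0 mult_right_mono[of "real k * real K * real s" n "real s - 1"]
    by (simp add: field_simps)
  then show "avg_degree (bg T) \<le> (real s - 1) / K + 2"
    using avg_degree_bg(2)[OF assms(1)] assms(2) by simp
qed

text \<open>Even after both approximation factors \<gamma> the degree ranges stay apart: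
  \<open>4 * \<gamma>\<^sup>2 \<le> K\<close> takes care of the cliques, and
  \<open>8 * \<gamma>\<^sup>2 < s - 1\<close> of the additive 2 contributed by the stars.\<close>

lemma degree_gap:
  fixes \<gamma> :: real
  assumes "1 \<le> \<gamma>" "4 * \<gamma>\<^sup>2 \<le> K" "8 * \<gamma>\<^sup>2 < real s - 1"
  shows "\<gamma> * ((real s - 1) / K + 2) < (real s - 1) / 2 / \<gamma>"
proof -
  have "\<gamma>\<^sup>2 * ((real s - 1) / K + 2) = (4 * \<gamma>\<^sup>2) * (real s - 1) / (4 * K) + 2 * \<gamma>\<^sup>2"
    using K by (simp add: field_simps)
  also have "\<dots> \<le> K * (real s - 1) / (4 * K) + 2 * \<gamma>\<^sup>2"
    using assms s by (intro add_right_mono divide_right_mono mult_right_mono) auto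
  also have "K * (real s - 1) / (4 * K) = (real s - 1) / 4" using K by simp
  also have "(real s - 1) / 4 + 2 * \<gamma>\<^sup>2 < (real s - 1) / 2" using assms(3) by argo
  finally show ?thesis using assms(1) by (simp add: field_simps power2_eq_square)
qed

end

text \<open>\<open>Q\<close> is arbitrary because apart from random edges the replies do not depend
  on the hidden set. The choice of \<open>s\<close> as about \<open>n^(1/3)\<close> gives about
  \<open>n^(2/3)\<close> blocks, and repeated blocks and star edges then become likely at the same
  order of \<open>b\<close>, namely \<open>n^(1/3)\<close>.\<close>

theorem cube_root_lower_bound:
  fixes \<gamma> :: real
  assumes \<gamma>: "1 \<le> \<gamma>"
  shows "\<exists>\<kappa>>0. \<exists>n\<^sub>0. \<forall>n\<ge>n\<^sub>0. \<forall>A. estimator Q \<gamma> n A \<longrightarrow>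
           (\<exists>G\<in>graphs n. needs_cost A G (\<kappa> * real n powr (1/3)))"
proof -
  define K where "K = nat \<lceil>4 * \<gamma>\<^sup>2\<rceil> + 2"
  \<comment> \<open>Chosen for the fact \<open>kC\<close> below:
    \<open>32 * K * \<kappa> = 1/8\<close>. The repetition term \<open>b * b / k\<close> is then far
    below its own share of 1/8.\<close>
  define \<kappa> where "\<kappa> = 1 / (256 * real K)"
  \<comment> \<open>\<open>L \<le> c\<close> will give \<open>4 * K * s \<le> n\<close> and
    \<open>8 * \<gamma>\<^sup>2 < s - 1\<close>.\<close>
  define L where "L = 8 * \<gamma>\<^sup>2 + 4 + 4 * real K"
  have K2: "2 \<le> K" and K\<gamma>: "4 * \<gamma>\<^sup>2 \<le> K" unfolding K_def by linarith+
  have \<kappa>: "0 < \<kappa>" using K2 by (simp add: \<kappa>_def)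
  have "\<exists>G\<in>graphs n. needs_cost A G (\<kappa> * real n powr (1/3))"
    if n: "nat \<lceil>L ^ 3\<rceil> \<le> n" and A: "estimator Q \<gamma> n A" for n A
  proof (rule ccontr)
    assume cheap: "\<not> ?thesis"
    define c where "c = real n powr (1/3)"
    have L: "4 \<le> L" "4 * real K \<le> L" "8 * \<gamma>\<^sup>2 + 4 \<le> L" by (auto simp: L_def)
    have "L ^ 3 \<le> n" using n by linarith
    have cL: "L \<le> c"
    proof -
      have "L = (L ^ 3) powr (1/3)" using L by (simp add: powr_powr flip: powr_numeral)
      also have "\<dots> \<le> c" unfolding c_def using \<open>L ^ 3 \<le> n\<close> L by (intro powr_mono2) auto
      finally show ?thesis .
    qed
    have c3: "c ^ 3 = n" using cL L by (simp add: c_def powr_powr flip: powr_numeral)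
    define s where "s = nat \<lfloor>c\<rfloor>"
    have sc: "real s \<le> c" "c < real s + 1" using cL L unfolding s_def by linarith+
    have "4 * real K * real s \<le> 4 * real K * c" using sc by (intro mult_left_mono) auto
    also have "\<dots> \<le> c * c" using cL L by (intro mult_right_mono) auto
    also have "\<dots> * 1 \<le> c * c * c" using cL L by (intro mult_left_mono) auto
    finally have "4 * real K * real s \<le> real n" using c3 by (simp add: power3_eq_cube)
    then have sK: "4 * K * s \<le> n" by (metis of_nat_le_iff of_nat_mult of_nat_numeral)
    define N where "N = n div s - 1"
    define k where "k = N div K"
    interpret two_scales n s N K k
      by unfold_locales (use K2 sK sc cL L N_def k_def in linarith)+
    define b where "b = nat \<lfloor>\<kappa> * c\<rfloor>"
    have "0 \<le> \<kappa> * c" using \<kappa> cL L by simp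
    then have b: "real b \<le> \<kappa> * c" "\<kappa> * c \<le> real b + 1" unfolding b_def by linarith+
    let ?C = "s choose 2"
    have k0: "0 < real k" and C0: "0 < real ?C" using k_pos choose_two_pos by auto
    have K0: "0 < real K" using K2 by simp
    have kn: "real n \<le> 4 * K * (real k * s)" using of_nat_mono[OF n_le_k, where 'a=real] by simp
    have kc: "c\<^sup>2 \<le> 4 * K * real k"
    proof -
      have "c * c\<^sup>2 \<le> 4 * K * (real k * s)" using kn c3 by (simp add: power3_eq_cube power2_eq_square)
      also have "\<dots> \<le> 4 * K * (real k * c)" using sc by (intro mult_left_mono) auto
      finally have "c * c\<^sup>2 \<le> c * (4 * K * real k)" by (simp add: algebra_simps)
      then show ?thesis using cL L by simp
    qed
    have kC: "n * c \<le> 32 * K * (real k * ?C)"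
    proof -
      have "c \<le> 4 * (real s - 1)" using sc(2) cL L(1) by argo
      then have "n * c \<le> (4 * K * (real k * s)) * (4 * (real s - 1))"
        using kn cL L by (intro mult_mono) auto
      also have "\<dots> = 16 * K * real k * (real s * (real s - 1))" by simp
      also have "\<dots> = 16 * K * real k * (2 * real ?C)" by (simp only: real_choose_two)
      finally show ?thesis by simp
    qed
    \<comment> \<open>The first term pays for a random edge in one of up to \<open>b\<close> hit
      cliques, the second for a random edge in a star.\<close>
    define lam where "lam = b / k + n / (k * ?C)"
    have lam0: "0 \<le> lam" by (simp add: lam_def)
    have bk: "real b * b \<le> k / 8"
    proof -
      have "real b * b \<le> (\<kappa> * c) * (\<kappa> * c)" using b \<kappa> by (intro mult_mono) auto
      also have "\<dots> = \<kappa>\<^sup>2 * c\<^sup>2" by (simp add: power2_eq_square)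
      also have "\<dots> \<le> \<kappa>\<^sup>2 * (4 * K * real k)" using kc by (intro mult_left_mono) auto
      also have "\<dots> = k / (16384 * K)" using K0 by (simp add: \<kappa>_def power2_eq_square field_simps)
      also have "\<dots> \<le> k / 8" using K0 K2 by (intro divide_left_mono) auto
      finally show ?thesis .
    qed
    have "b \<le> b * b" by (cases b) auto
    then have "real b \<le> real b * b" by (metis of_nat_le_iff of_nat_mult)
    then have "real b \<le> k" using bk k0 by linarith
    then have bk': "b \<le> k" by simp
    have small: "0 + lam * b \<le> 1/4"
    proof -
      have "n * real b \<le> n * (\<kappa> * c)" using b by (intro mult_left_mono) auto
      also have "\<dots> = \<kappa> * (n * c)" by simp
      also have "\<dots> \<le> \<kappa> * (32 * K * (real k * ?C))" using kC \<kappa> by (intro mult_left_mono) auto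
      also have "\<dots> = k * ?C / 8" using K0 by (simp add: \<kappa>_def)
      finally have "n * real b / (k * ?C) \<le> 1/8" using k0 C0 by (simp add: field_simps)
      moreover have "real b * b / k \<le> 1/8" using bk k0 by (simp add: field_simps)
      moreover have "lam * b = real b * b / k + n * real b / (k * ?C)"
        by (simp add: lam_def distrib_right)
      ultimately show ?thesis by linarith
    qed
    \<comment> \<open>One \<open>lam\<close> serves both families: it is fitted to
      \<open>j = k\<close>, and with more cliques the relative losses only decrease.\<close>
    have bound: "(1 - lam) * (j * ?C + n) \<le> (real j - b) * ?C" if "k \<le> j" for j
    proof -
      have j: "real k \<le> real j" using that by simp
      have "b * ?C + real n = (real b / k + n / (k * ?C)) * (k * ?C)"
        using k0 C0 by (simp add: field_simps)
      also have "\<dots> \<le> lam * (j * ?C + n)" unfolding lam_def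
        using mult_right_mono[OF j, of "real ?C"] by (intro mult_left_mono) auto
      finally show ?thesis by (simp add: algebra_simps)
    qed
    have uses: "uses_only UNIV A" by (induction A) auto
    note 1 = hidden_blocks[OF le_trans[OF bk' k_le_N] order_refl lam0 bound[OF k_le_N]]
    note 2 = hidden_blocks[OF bk' k_le_N lam0 bound[OF order_refl]]
    have approx: "98/100 \<le> measure_pmf.prob (run (bg T) A)
        {(r, x). r \<in> {avg_degree (bg T) / \<gamma> .. \<gamma> * avg_degree (bg T)} \<and> x \<le> b}"
      if "T \<subseteq> {..<N}" for T
      using A cheap bg_in_graphs[OF that] b(2) unfolding estimator_def c_def
      by (intro approximates_and_cheap) auto
    show False
    proof (rule indistinguishable_families[OF 1 2, of "({}, {})" b A
          "{(real s - 1) / 2 / \<gamma>..}" "{..\<gamma> * ((real s - 1) / K + 2)}"])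
      show "fresh_valid b ({}, {}) b" "fresh_valid b ({}, {}) b" by (auto simp: fresh_valid_def)
      fix T assume T: "T \<in> chosen N ({}, {})"
      then have "T \<subseteq> {..<N}" "card T = N" by (auto simp: chosen_def)
      then have "(real s - 1) / 2 / \<gamma> \<le> avg_degree (bg T) / \<gamma>"
        using avg_degree_dense(1) \<gamma> by (intro divide_right_mono) auto
      then show "98/100 \<le> measure_pmf.prob (run (bg T) A) {(r, x). r \<in> {(real s - 1) / 2 / \<gamma>..} \<and> x \<le> b}"
        using \<open>T \<subseteq> {..<N}\<close>
        by (intro order_trans[OF approx measure_pmf.finite_measure_mono]) auto
    next
      fix T assume T: "T \<in> chosen k ({}, {})"
      then have "T \<subseteq> {..<N}" "card T = k" by (auto simp: chosen_def)
      then have "\<gamma> * avg_degree (bg T) \<le> \<gamma> * ((real s - 1) / K + 2)"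
        using avg_degree_sparse(2) \<gamma> by (intro mult_left_mono) auto
      then show "98/100 \<le> measure_pmf.prob (run (bg T) A)
          {(r, x). r \<in> {..\<gamma> * ((real s - 1) / K + 2)} \<and> x \<le> b}"
        using \<open>T \<subseteq> {..<N}\<close>
        by (intro order_trans[OF approx measure_pmf.finite_measure_mono]) auto
    next
      have "8 * \<gamma>\<^sup>2 < real s - 1" using sc cL L by linarith
      from degree_gap[OF \<gamma> K\<gamma> this]
      show "{(real s - 1) / 2 / \<gamma>..} \<inter> {..\<gamma> * ((real s - 1) / K + 2)} = {}" by force
    qed (use small uses in auto)
  qed
  then show ?thesis using \<kappa> by blast
qed

section \<open>The lower bound for pair queries\<close>

text \<open>\<open>\<sigma>\<close> sends a label to its position in \<open>G\<close>, so edges are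
  pulled back along it; the block of a label \<open>x\<close> is then simply
  \<open>\<sigma> x div s\<close>.\<close>

definition relabel :: "(nat \<Rightarrow> nat) \<Rightarrow> graph \<Rightarrow> graph" where
  "relabel \<sigma> G = \<lparr>verts = verts G, edges = {e. \<sigma> ` e \<in> edges G}\<rparr>"

lemma bij_relabel_edges:
  assumes "bij \<sigma>"
  shows "bij_betw ((`) \<sigma>) {e. \<sigma> ` e \<in> E} E"
proof (rule bij_betwI[where g="(`) (inv \<sigma>)"])
  have 1: "\<sigma> ` inv \<sigma> ` e = e" for e using assms by (simp only: image_f_inv_f bij_is_surj)
  show "(`) (inv \<sigma>) \<in> E \<rightarrow> {e. \<sigma> ` e \<in> E}"
    by (rule funcsetI) (simp only: mem_Collect_eq 1)
  show "inv \<sigma> ` \<sigma> ` e = e" for e using assms by (simp only: image_inv_f_f bij_is_inj)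
  show "\<sigma> ` inv \<sigma> ` e = e" for e by (rule 1)
  show "(`) \<sigma> \<in> {e. \<sigma> ` e \<in> E} \<rightarrow> E" by (rule funcsetI) (simp only: mem_Collect_eq)
qed

lemma card_relabel_edges: "bij \<sigma> \<Longrightarrow> card {e. \<sigma> ` e \<in> E} = card E"
  by (rule bij_betw_same_card[OF bij_relabel_edges])

lemma finite_relabel_edges: "bij \<sigma> \<Longrightarrow> finite {e. \<sigma> ` e \<in> E} \<longleftrightarrow> finite E"
  by (rule bij_betw_finite[OF bij_relabel_edges])

lemma avg_degree_relabel: "bij \<sigma> \<Longrightarrow> avg_degree (relabel \<sigma> G) = avg_degree G"
  by (simp add: avg_degree_def relabel_def card_relabel_edges)

lemma relabel_in_graphs:
  assumes G: "G \<in> graphs n" and \<sigma>: "\<sigma> permutes verts G"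
  shows "relabel \<sigma> G \<in> graphs n"
proof -
  have inj: "inj \<sigma>" using \<sigma> by (rule permutes_inj)
  have "e \<subseteq> verts G \<and> card e = 2" if "\<sigma> ` e \<in> edges G" for e
  proof -
    have "\<sigma> ` e \<subseteq> verts G" "card (\<sigma> ` e) = 2"
      using that G by (auto simp: graphs_def simple_graph_def)
    moreover have "\<sigma> ` e \<subseteq> verts G \<Longrightarrow> e \<subseteq> verts G"
      using permutes_in_image[OF \<sigma>] by blast
    moreover have "card (\<sigma> ` e) = card e"
      using inj by (intro card_image) (auto intro: inj_on_subset)
    ultimately show ?thesis by simp
  qed
  moreover have "\<exists>e. \<sigma> ` e \<in> edges G \<and> v \<in> e" if "v \<in> verts G" for v
  proof -
    have "\<sigma> v \<in> verts G" using that permutes_in_image[OF \<sigma>] by simp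
    then obtain e where e: "e \<in> edges G" "\<sigma> v \<in> e"
      using G by (auto simp: graphs_def no_isolated_def)
    have "\<sigma> ` inv \<sigma> ` e = e" using permutes_surj[OF \<sigma>] by (simp only: image_f_inv_f)
    then have "\<sigma> ` inv \<sigma> ` e \<in> edges G" using e(1) by (simp only:)
    moreover have "v \<in> inv \<sigma> ` e" using e(2) inj by (metis image_eqI inv_f_f)
    ultimately show ?thesis by blast
  qed
  ultimately show ?thesis using G
    by (auto simp: graphs_def simple_graph_def no_isolated_def relabel_def)
qed

text \<open>Exchanges blocks \<open>a\<close> and \<open>c\<close>, but only at the offsets in
  \<open>I\<close>. It is an involution and preserves offsets; these two facts allow the move in
  \<open>card_collision\<close> to be undone.\<close>

definition swap_blocks :: "nat \<Rightarrow> nat \<Rightarrow> nat \<Rightarrow> nat set \<Rightarrow> nat \<Rightarrow> nat" where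
  "swap_blocks s a c I p = (if p mod s \<in> I \<and> p div s = a then c * s + p mod s
     else if p mod s \<in> I \<and> p div s = c then a * s + p mod s else p)"

lemma swap_blocks_mod: "swap_blocks s a c I p mod s = p mod s"
  by (simp add: swap_blocks_def)

lemma swap_blocks_swap_blocks: "0 < s \<Longrightarrow> swap_blocks s a c I (swap_blocks s a c I p) = p"
  by (auto simp: swap_blocks_def)

lemma swap_blocks_less:
  assumes "0 < s" "a < k" "c < k" shows "swap_blocks s a c I p < k * s \<longleftrightarrow> p < k * s"
proof -
  have "swap_blocks s a c I p < k * s" if "p < k * s" for p
  proof -
    have "b * s + p mod s < k * s" if "b < k" for b
    proof -
      have "b * s + p mod s < b * s + s" using assms by simp
      also have "\<dots> \<le> k * s" using that mult_le_mono1[of "Suc b" k s] by simp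
      finally show ?thesis .
    qed
    then show ?thesis using assms that by (simp add: swap_blocks_def)
  qed
  then show ?thesis using swap_blocks_swap_blocks[OF assms(1)] by metis
qed

lemma swap_blocks_permutes:
  assumes "0 < s" "a < k" "c < k" "k * s \<le> n"
  shows "swap_blocks s a c I permutes {..<n}"
proof (rule bij_imp_permutes)
  have "swap_blocks s a c I p < n" if "p < n" for p
  proof (cases "p < k * s")
    case True
    then show ?thesis using swap_blocks_less[OF assms(1-3)] assms(4) by (meson order_less_le_trans)
  next
    case False
    then have "k \<le> p div s" using assms(1) by (simp add: less_eq_div_iff_mult_less_eq)
    then show ?thesis using that assms by (simp add: swap_blocks_def)
  qed
  then show "bij_betw (swap_blocks s a c I) {..<n} {..<n}"
    using swap_blocks_swap_blocks[OF assms(1)]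
    by (intro bij_betwI[where g="swap_blocks s a c I"]) auto
  fix p assume "p \<notin> {..<n}"
  then have "k * s \<le> p" using assms(4) by simp
  then have "k \<le> p div s" using assms(1) by (simp add: less_eq_div_iff_mult_less_eq)
  then show "swap_blocks s a c I p = p" using assms by (simp add: swap_blocks_def)
qed

section \<open>Relabellings consistent with the revealed groups\<close>

context block_params
begin

text \<open>A permutation assigns positions to labels; \<open>consistent k S \<gamma>\<close> are the
  permutations that put all labels in \<open>S\<close> into the first \<open>k\<close> blocks and labels
  with equal values of \<open>\<gamma>\<close> into the same block.\<close>

definition consistent :: "nat \<Rightarrow> nat set \<Rightarrow> (nat \<Rightarrow> nat) \<Rightarrow> (nat \<Rightarrow> nat) set" where
  "consistent k S \<gamma> = {\<sigma>. \<sigma> permutes {..<n} \<and> (\<forall>x\<in>S. \<sigma> x < k * s)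
     \<and> (\<forall>x\<in>S. \<forall>y\<in>S. \<gamma> x = \<gamma> y \<longrightarrow> \<sigma> x div s = \<sigma> y div s)}"

definition same_block :: "(nat \<Rightarrow> nat) \<Rightarrow> nat \<Rightarrow> nat \<Rightarrow> bool" where
  "same_block \<sigma> x y \<longleftrightarrow> \<sigma> x div s = \<sigma> y div s"

lemma consistentD:
  assumes "\<sigma> \<in> consistent k S \<gamma>"
  shows "\<sigma> permutes {..<n}" "x \<in> S \<Longrightarrow> \<sigma> x < k * s"
    "x \<in> S \<Longrightarrow> y \<in> S \<Longrightarrow> \<gamma> x = \<gamma> y \<Longrightarrow> \<sigma> x div s = \<sigma> y div s"
  using assms unfolding consistent_def by blast+

lemma consistentI:
  assumes "\<sigma> permutes {..<n}" "\<And>x. x \<in> S \<Longrightarrow> \<sigma> x < k * s"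
    "\<And>x y. x \<in> S \<Longrightarrow> y \<in> S \<Longrightarrow> \<gamma> x = \<gamma> y \<Longrightarrow> \<sigma> x div s = \<sigma> y div s"
  shows "\<sigma> \<in> consistent k S \<gamma>"
  using assms unfolding consistent_def by blast

lemma finite_consistent: "finite (consistent k S \<gamma>)"
  by (rule finite_subset[OF _ finite_permutations[of "{..<n}"]]) (auto simp: consistent_def)

lemma less_k_s_iff: "p < k * s \<longleftrightarrow> p div s < k"
  using s_pos by (simp add: div_less_iff_less_mult)

text \<open>If \<open>x\<close> and \<open>y\<close> share a block, move the group of \<open>x\<close> to a block without revealed labels
  by exchanging positions of equal offset; the old block can be read off at \<open>y\<close>.\<close>

lemma card_collision:
  assumes k: "k \<le> N" and S: "finite S" "x \<in> S" "y \<in> S" and xy: "\<gamma> x \<noteq> \<gamma> y"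
  shows "card {\<sigma> \<in> consistent k S \<gamma>. same_block \<sigma> x y} * (k - card S) \<le> card (consistent k S \<gamma>)"
proof -
  define B where "B = {\<sigma> \<in> consistent k S \<gamma>. same_block \<sigma> x y}"
  \<comment> \<open>The possible targets of the move, at least \<open>k - card S\<close> in number.
    Only the offsets \<open>I\<close> of the group of \<open>x\<close> are exchanged, so other
    labels of the old block stay where they are.\<close>
  define free where "free = (\<lambda>\<sigma>. {..<k} - (\<lambda>z. \<sigma> z div s) ` S)"
  define I where "I = (\<lambda>\<sigma>. (\<lambda>z. \<sigma> z mod s) ` {z \<in> S. \<gamma> z = \<gamma> x})"
  define \<tau> where "\<tau> = (\<lambda>\<sigma> c. swap_blocks s (\<sigma> x div s) c (I \<sigma>))"
  have ks: "k * s \<le> n" using k n mult_le_mono1[OF k, of s] by linarith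
  have Bc: "\<sigma> \<in> consistent k S \<gamma>" if "\<sigma> \<in> B" for \<sigma> using that by (simp add: B_def)
  have on_group: "\<tau> \<sigma> c (\<sigma> z) div s = c" if "\<sigma> \<in> B" "z \<in> S" "\<gamma> z = \<gamma> x" for \<sigma> c z
  proof -
    have "\<sigma> z mod s \<in> I \<sigma>" unfolding I_def using that by (intro imageI) simp
    moreover have "\<sigma> z div s = \<sigma> x div s" by (rule consistentD(3)[OF Bc[OF that(1)] that(2) S(2) that(3)])
    ultimately show ?thesis using s_pos by (simp add: \<tau>_def swap_blocks_def)
  qed
  have off_group: "\<tau> \<sigma> c (\<sigma> z) = \<sigma> z"
    if "\<sigma> \<in> B" "c \<in> free \<sigma>" "z \<in> S" "\<gamma> z \<noteq> \<gamma> x" for \<sigma> c z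
  proof -
    have 1: "\<sigma> z div s \<noteq> c" using that(2,3) by (auto simp: free_def)
    \<comment> \<open>A label outside the group cannot occupy an exchanged position of the old
      block, since that position already belongs to a member of the group.\<close>
    have 2: "\<not> (\<sigma> z mod s \<in> I \<sigma> \<and> \<sigma> z div s = \<sigma> x div s)"
    proof
      assume *: "\<sigma> z mod s \<in> I \<sigma> \<and> \<sigma> z div s = \<sigma> x div s"
      then obtain w where w: "w \<in> S" "\<gamma> w = \<gamma> x" "\<sigma> z mod s = \<sigma> w mod s"
        unfolding I_def by auto
      have "\<sigma> w div s = \<sigma> x div s" by (rule consistentD(3)[OF Bc[OF that(1)] w(1) S(2) w(2)])
      then have "\<sigma> w = \<sigma> z" using w(3) * by (metis div_mult_mod_eq)
      then have "w = z" using permutes_inj[OF consistentD(1)[OF Bc[OF that(1)]]] by (simp add: inj_eq)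
      then show False using w that by simp
    qed
    show ?thesis unfolding \<tau>_def swap_blocks_def using 1 2 by argo
  qed
  have maps: "\<tau> \<sigma> c \<circ> \<sigma> \<in> consistent k S \<gamma>" if \<sigma>: "\<sigma> \<in> B" and c: "c \<in> free \<sigma>" for \<sigma> c
  proof -
    have ck: "c < k" using c by (simp add: free_def)
    have a: "\<sigma> x div s < k" using consistentD(2)[OF Bc[OF \<sigma>] S(2)] by (simp add: less_k_s_iff)
    have 1: "\<tau> \<sigma> c \<circ> \<sigma> permutes {..<n}" unfolding \<tau>_def
      by (rule permutes_compose[OF consistentD(1)[OF Bc[OF \<sigma>]] swap_blocks_permutes[OF s_pos a ck ks]])
    have 2: "(\<tau> \<sigma> c \<circ> \<sigma>) z < k * s" if "z \<in> S" for z
      using swap_blocks_less[OF s_pos a ck] consistentD(2)[OF Bc[OF \<sigma>] that] by (simp add: \<tau>_def)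
    have 3: "(\<tau> \<sigma> c \<circ> \<sigma>) z div s = (\<tau> \<sigma> c \<circ> \<sigma>) w div s"
      if zw: "z \<in> S" "w \<in> S" "\<gamma> z = \<gamma> w" for z w
    proof (cases "\<gamma> z = \<gamma> x")
      case True
      then show ?thesis using on_group[OF \<sigma> zw(1)] on_group[OF \<sigma> zw(2)] zw(3) by simp
    next
      case False
      then have "\<tau> \<sigma> c (\<sigma> z) = \<sigma> z" "\<tau> \<sigma> c (\<sigma> w) = \<sigma> w"
        using off_group[OF \<sigma> c] zw by simp_all
      then show ?thesis using consistentD(3)[OF Bc[OF \<sigma>] zw] by simp
    qed
    show ?thesis by (rule consistentI[OF 1 2 3])
  qed
  \<comment> \<open>Decoding: \<open>c\<close> is the block where \<open>x\<close> now lies, the old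
    block is the one of \<open>y\<close>, which did not move, and the offsets \<open>I\<close> are
    unchanged. So the swap is known and, being an involution, can be reversed.\<close>
  have inj: "inj_on (\<lambda>(\<sigma>, c). \<tau> \<sigma> c \<circ> \<sigma>) (SIGMA \<sigma>:B. free \<sigma>)"
  proof (rule inj_onI, clarify)
    fix \<sigma> c \<sigma>' c'
    assume \<sigma>: "\<sigma> \<in> B" "c \<in> free \<sigma>" and \<sigma>': "\<sigma>' \<in> B" "c' \<in> free \<sigma>'"
      and "\<tau> \<sigma> c \<circ> \<sigma> = \<tau> \<sigma>' c' \<circ> \<sigma>'"
    then have eq: "\<tau> \<sigma> c (\<sigma> z) = \<tau> \<sigma>' c' (\<sigma>' z)" for z by (metis comp_apply)
    have cc: "c = c'"
      using on_group[OF \<sigma>(1) S(2) refl, of c] on_group[OF \<sigma>'(1) S(2) refl, of c'] eq[of x] by simp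
    have "\<sigma> y = \<sigma>' y"
      using off_group[OF \<sigma> S(3)] off_group[OF \<sigma>' S(3)] eq[of y] xy by simp
    moreover have "\<sigma> x div s = \<sigma> y div s" "\<sigma>' x div s = \<sigma>' y div s"
      using \<sigma>(1) \<sigma>'(1) by (simp_all add: B_def same_block_def)
    ultimately have a: "\<sigma> x div s = \<sigma>' x div s" by simp
    have "\<sigma> z mod s = \<sigma>' z mod s" for z
      using arg_cong[OF eq[of z], of "\<lambda>p. p mod s"] by (simp add: \<tau>_def swap_blocks_mod)
    then have I: "I \<sigma> = I \<sigma>'" by (simp add: I_def)
    have \<tau>: "\<tau> \<sigma> c = \<tau> \<sigma>' c'" by (simp only: \<tau>_def a I cc)
    have "\<sigma> z = \<sigma>' z" for z
    proof -
      have "\<tau> \<sigma>' c' (\<tau> \<sigma>' c' (\<sigma> z)) = \<tau> \<sigma>' c' (\<tau> \<sigma>' c' (\<sigma>' z))"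
        using eq[of z] unfolding \<tau> by simp
      then show ?thesis by (simp only: \<tau>_def swap_blocks_swap_blocks[OF s_pos])
    qed
    then show "\<sigma> = \<sigma>' \<and> c = c'" using cc by auto
  qed
  have fB: "finite B" unfolding B_def using finite_consistent[of k S \<gamma>] by simp
  have "card B * (k - card S) = (\<Sum>\<sigma>\<in>B. k - card S)" by simp
  also have "\<dots> \<le> (\<Sum>\<sigma>\<in>B. card (free \<sigma>))"
  proof (intro sum_mono)
    fix \<sigma> :: "nat \<Rightarrow> nat"
    have "card {..<k} - card ((\<lambda>z. \<sigma> z div s) ` S) \<le> card (free \<sigma>)"
      unfolding free_def using S by (intro diff_card_le_card_Diff) auto
    moreover have "card ((\<lambda>z. \<sigma> z div s) ` S) \<le> card S" using S by (intro card_image_le) auto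
    ultimately show "k - card S \<le> card (free \<sigma>)" by simp
  qed
  also have "\<dots> = card (SIGMA \<sigma>:B. free \<sigma>)"
    using fB by (intro card_SigmaI[symmetric]) (auto simp: free_def)
  also have "\<dots> \<le> card (consistent k S \<gamma>)"
    using maps by (intro card_inj_on_le[OF inj _ finite_consistent]) auto
  finally show ?thesis by (simp only: B_def)
qed

text \<open>Adding \<open>y\<close> to the group of \<open>x\<close> amounts to conditioning on a
  shared block; that \<open>y\<close> lies in the first \<open>k\<close> blocks is then inherited
  from \<open>x\<close>.\<close>

lemma consistent_insert:
  assumes x: "x \<in> S" and y: "y \<notin> S"
  shows "consistent k (insert y S) (\<gamma>(y := \<gamma> x)) = {\<sigma> \<in> consistent k S \<gamma>. same_block \<sigma> x y}"
proof (intro set_eqI iffI)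
  fix \<sigma> assume \<sigma>: "\<sigma> \<in> consistent k (insert y S) (\<gamma>(y := \<gamma> x))"
  have "\<sigma> \<in> consistent k S \<gamma>"
  proof (rule consistentI)
    show "\<sigma> permutes {..<n}" by (rule consistentD(1)[OF \<sigma>])
    show "\<sigma> z < k * s" if "z \<in> S" for z using that by (intro consistentD(2)[OF \<sigma>]) simp
    show "\<sigma> z div s = \<sigma> w div s" if "z \<in> S" "w \<in> S" "\<gamma> z = \<gamma> w" for z w
    proof (rule consistentD(3)[OF \<sigma>])
      have "z \<noteq> y" "w \<noteq> y" using that y by auto
      then show "(\<gamma>(y := \<gamma> x)) z = (\<gamma>(y := \<gamma> x)) w" using that(3) by simp
    qed (use that in simp_all)
  qed
  moreover have "\<sigma> x div s = \<sigma> y div s"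
  proof (rule consistentD(3)[OF \<sigma>])
    have "x \<noteq> y" using x y by auto
    then show "(\<gamma>(y := \<gamma> x)) x = (\<gamma>(y := \<gamma> x)) y" by simp
  qed (use x in simp_all)
  ultimately show "\<sigma> \<in> {\<sigma> \<in> consistent k S \<gamma>. same_block \<sigma> x y}"
    by (simp only: same_block_def mem_Collect_eq simp_thms)
next
  fix \<sigma> assume "\<sigma> \<in> {\<sigma> \<in> consistent k S \<gamma>. same_block \<sigma> x y}"
  then have \<sigma>: "\<sigma> \<in> consistent k S \<gamma>" and xy: "\<sigma> x div s = \<sigma> y div s"
    by (simp_all only: same_block_def mem_Collect_eq)
  define r where "r = (\<lambda>v. if v = y then x else v)"
  have r: "\<sigma> (r v) div s = \<sigma> v div s" "(\<gamma>(y := \<gamma> x)) v = \<gamma> (r v)" for v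
    using xy by (simp_all add: r_def)
  have rS: "r v \<in> S" if "v \<in> insert y S" for v using that x by (auto simp: r_def)
  show "\<sigma> \<in> consistent k (insert y S) (\<gamma>(y := \<gamma> x))"
  proof (rule consistentI)
    show "\<sigma> permutes {..<n}" by (rule consistentD(1)[OF \<sigma>])
    show "\<sigma> z < k * s" if "z \<in> insert y S" for z
      using consistentD(2)[OF \<sigma> rS[OF that]] r(1)[of z] by (simp add: less_k_s_iff)
    show "\<sigma> z div s = \<sigma> w div s"
      if "z \<in> insert y S" "w \<in> insert y S" "(\<gamma>(y := \<gamma> x)) z = (\<gamma>(y := \<gamma> x)) w" for z w
      using consistentD(3)[OF \<sigma> rS[OF that(1)] rS[OF that(2)]] that(3) unfolding r by simp
  qed
qed

text \<open>Labels not yet revealed are exchangeable, as transposing two of them respects all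
  recorded constraints. This replaces an explicit formula for the number of consistent
  permutations.\<close>

lemma consistent_transpose:
  assumes \<sigma>: "\<sigma> \<in> consistent k S \<gamma>" and "y \<notin> S" "z \<notin> S" "y < n" "z < n"
  shows "\<sigma> \<circ> Transposition.transpose y z \<in> consistent k S \<gamma>"
proof (rule consistentI)
  have unmoved: "Transposition.transpose y z x = x" if "x \<in> S" for x
    using that assms by (auto simp: Transposition.transpose_def)
  show "\<sigma> \<circ> Transposition.transpose y z permutes {..<n}"
    using assms by (intro permutes_compose[OF permutes_swap_id consistentD(1)[OF \<sigma>]]) auto
  show "(\<sigma> \<circ> Transposition.transpose y z) x < k * s" if "x \<in> S" for x
    using consistentD(2)[OF \<sigma> that] unmoved[OF that] by simp
  show "(\<sigma> \<circ> Transposition.transpose y z) x div s = (\<sigma> \<circ> Transposition.transpose y z) w div s"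
    if "x \<in> S" "w \<in> S" "\<gamma> x = \<gamma> w" for x w
    using consistentD(3)[OF \<sigma> that] unmoved that by simp
qed

lemma card_consistent_transpose:
  assumes "y \<notin> S" "z \<notin> S" "y < n" "z < n"
    and P: "\<And>\<sigma>. P' \<sigma> \<longleftrightarrow> P (\<sigma> \<circ> Transposition.transpose y z)"
  shows "card {\<sigma> \<in> consistent k S \<gamma>. P' \<sigma>} = card {\<sigma> \<in> consistent k S \<gamma>. P \<sigma>}"
proof (rule bij_betw_same_card[of "\<lambda>\<sigma>. \<sigma> \<circ> Transposition.transpose y z"])
  show "bij_betw (\<lambda>\<sigma>. \<sigma> \<circ> Transposition.transpose y z)
      {\<sigma> \<in> consistent k S \<gamma>. P' \<sigma>} {\<sigma> \<in> consistent k S \<gamma>. P \<sigma>}"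
  proof (rule bij_betwI[where g="\<lambda>\<sigma>. \<sigma> \<circ> Transposition.transpose y z"])
    have *: "\<sigma> \<circ> Transposition.transpose y z \<circ> Transposition.transpose y z = \<sigma>" for \<sigma> :: "nat \<Rightarrow> nat"
      by (simp add: comp_assoc)
    show "(\<lambda>\<sigma>. \<sigma> \<circ> Transposition.transpose y z) \<in> {\<sigma> \<in> consistent k S \<gamma>. P' \<sigma>} \<rightarrow> {\<sigma> \<in> consistent k S \<gamma>. P \<sigma>}"
      using assms(1-4) P consistent_transpose by (auto simp del: comp_apply)
    show "(\<lambda>\<sigma>. \<sigma> \<circ> Transposition.transpose y z) \<in> {\<sigma> \<in> consistent k S \<gamma>. P \<sigma>} \<rightarrow> {\<sigma> \<in> consistent k S \<gamma>. P' \<sigma>}"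
      using assms(1-4) P consistent_transpose by (auto simp: * simp del: comp_apply)
  qed (simp_all add: comp_assoc)
qed

end

section \<open>Shares of the permutations that admit a fresh edge or neighbour\<close>

context block_params
begin

abbreviation cliques :: "nat \<Rightarrow> nat set set" where
  "cliques k \<equiv> \<Union>i\<in>{..<k}. clique_edges (block s i)"

lemma card_cliques: "card (cliques k) = k * (s choose 2)"
  by (subst card_Union_clique_edges) auto

lemma pair_in_cliques:
  "{p, q} \<in> cliques k \<longleftrightarrow> p \<noteq> q \<and> p div s = q div s \<and> p < k * s"
  using s_pos by (auto simp: pair_in_clique_edges mem_block less_k_s_iff)

text \<open>As \<gamma> maps \<open>S\<close> into \<open>S\<close> and \<open>c \<notin> S\<close>,
  the value \<open>c\<close> names a new group: the two labels are tied to each other but to no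
  older label.\<close>

lemma cliques_insert:
  assumes "x \<notin> S" "y \<notin> S" "x \<noteq> y" and \<gamma>: "\<gamma> ` S \<subseteq> S" and c: "c \<notin> S"
  shows "consistent k (S \<union> {x, y}) (\<lambda>z. if z \<in> {x, y} then c else \<gamma> z)
    = {\<sigma> \<in> consistent k S \<gamma>. \<sigma> ` {x, y} \<in> cliques k}" (is "consistent k ?S ?\<gamma> = _")
proof (intro set_eqI iffI)
  fix \<sigma> assume \<sigma>: "\<sigma> \<in> consistent k ?S ?\<gamma>"
  have "\<sigma> \<in> consistent k S \<gamma>"
  proof (rule consistentI)
    show "\<sigma> permutes {..<n}" by (rule consistentD(1)[OF \<sigma>])
    show "\<sigma> z < k * s" if "z \<in> S" for z using that by (intro consistentD(2)[OF \<sigma>]) simp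
    show "\<sigma> z div s = \<sigma> w div s" if "z \<in> S" "w \<in> S" "\<gamma> z = \<gamma> w" for z w
    proof (rule consistentD(3)[OF \<sigma>])
      have "z \<notin> {x, y}" "w \<notin> {x, y}" using that assms by auto
      then show "?\<gamma> z = ?\<gamma> w" using that(3) by simp
    qed (use that in simp_all)
  qed
  moreover have "\<sigma> x \<noteq> \<sigma> y" using permutes_inj[OF consistentD(1)[OF \<sigma>]] assms by (simp add: inj_eq)
  moreover have "\<sigma> x div s = \<sigma> y div s" by (rule consistentD(3)[OF \<sigma>]) simp_all
  moreover have "\<sigma> x < k * s" by (rule consistentD(2)[OF \<sigma>]) simp
  ultimately have "\<sigma> \<in> consistent k S \<gamma>" "{\<sigma> x, \<sigma> y} \<in> cliques k"
    by (simp_all only: pair_in_cliques simp_thms)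
  then show "\<sigma> \<in> {\<sigma> \<in> consistent k S \<gamma>. \<sigma> ` {x, y} \<in> cliques k}" by simp
next
  fix \<sigma> assume "\<sigma> \<in> {\<sigma> \<in> consistent k S \<gamma>. \<sigma> ` {x, y} \<in> cliques k}"
  then have \<sigma>: "\<sigma> \<in> consistent k S \<gamma>" and "{\<sigma> x, \<sigma> y} \<in> cliques k" by simp_all
  then have xy: "\<sigma> x div s = \<sigma> y div s" "\<sigma> x < k * s" by (simp_all only: pair_in_cliques)
  show "\<sigma> \<in> consistent k ?S ?\<gamma>"
  proof (rule consistentI)
    show "\<sigma> permutes {..<n}" by (rule consistentD(1)[OF \<sigma>])
    show "\<sigma> z < k * s" if "z \<in> ?S" for z
    proof (cases "z \<in> S")
      case True
      then show ?thesis by (rule consistentD(2)[OF \<sigma>])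
    next
      case False
      then have "z = x \<or> z = y" using that by simp
      then have "\<sigma> z div s = \<sigma> x div s" using xy by metis
      then show ?thesis using xy(2) by (simp add: less_k_s_iff)
    qed
    show "\<sigma> z div s = \<sigma> w div s" if zw: "z \<in> ?S" "w \<in> ?S" "?\<gamma> z = ?\<gamma> w" for z w
    proof (cases "z \<in> {x, y}")
      case True
      have "w \<in> {x, y}"
      proof (rule ccontr)
        assume w: "w \<notin> {x, y}"
        then have "\<gamma> w \<in> S" using zw \<gamma> by auto
        moreover have "\<gamma> w = c" using zw(3) w True by simp
        ultimately show False using c by simp
      qed
      then show ?thesis using True xy by auto
    next
      case False
      have w: "w \<notin> {x, y}"
      proof
        assume w: "w \<in> {x, y}"
        have "\<gamma> z \<in> S" using zw False \<gamma> by auto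
        moreover have "\<gamma> z = c" using zw(3) w False by simp
        ultimately show False using c by simp
      qed
      have "z \<in> S" "w \<in> S" "\<gamma> z = \<gamma> w" using zw False w by auto
      then show ?thesis by (rule consistentD(3)[OF \<sigma>])
    qed
  qed
qed

lemma transpose_image_pair:
  assumes "x \<noteq> y" "x \<noteq> z"
  shows "Transposition.transpose y z ` {x, y} = {x, z}"
  using assms by (auto simp: Transposition.transpose_def)

lemma card_cliques_one_step:
  assumes "x \<notin> S" "y \<notin> S" "z \<notin> S" "y < n" "z < n" "x \<noteq> y" "x \<noteq> z"
  shows "card {\<sigma> \<in> consistent k S \<gamma>. \<sigma> ` {x, y} \<in> cliques k}
       = card {\<sigma> \<in> consistent k S \<gamma>. \<sigma> ` {x, z} \<in> cliques k}"
proof (rule card_consistent_transpose[OF assms(2-5)])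
  fix \<sigma> :: "nat \<Rightarrow> nat"
  have "(\<sigma> \<circ> Transposition.transpose y z) ` {x, z} = \<sigma> ` (Transposition.transpose z y ` {x, z})"
    by (simp only: image_comp transpose_commute)
  then show "\<sigma> ` {x, y} \<in> cliques k \<longleftrightarrow> (\<sigma> \<circ> Transposition.transpose y z) ` {x, z} \<in> cliques k"
    using transpose_image_pair[OF assms(7,6)] by (simp only:)
qed

text \<open>One endpoint is replaced at a time. The intermediate pair \<open>{x, y'}\<close> must
  not degenerate, hence the separate case \<open>y' = x\<close>.\<close>

lemma card_cliques_symmetric:
  assumes e: "e \<subseteq> {..<n} - S" "card e = 2" and f: "f \<subseteq> {..<n} - S" "card f = 2"
  shows "card {\<sigma> \<in> consistent k S \<gamma>. \<sigma> ` e \<in> cliques k}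
       = card {\<sigma> \<in> consistent k S \<gamma>. \<sigma> ` f \<in> cliques k}" (is "?Q e = ?Q f")
proof -
  obtain x y where xy: "e = {x, y}" "x \<noteq> y" using e(2) by (auto simp: card_2_iff)
  obtain x' y' where xy': "f = {x', y'}" "x' \<noteq> y'" using f(2) by (auto simp: card_2_iff)
  have in_e: "x < n" "y < n" "x \<notin> S" "y \<notin> S" using e(1) xy by auto
  have in_f: "x' < n" "y' < n" "x' \<notin> S" "y' \<notin> S" using f(1) xy' by auto
  show ?thesis
  proof (cases "y' = x")
    case True
    then have "x' \<noteq> x" using xy' by simp
    then have "?Q {x, y} = ?Q {x, x'}"
      by (rule card_cliques_one_step[OF in_e(3,4) in_f(3) in_e(2) in_f(1) xy(2) not_sym])
    moreover have "f = {x, x'}" using xy' True by auto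
    ultimately show ?thesis by (simp only: xy(1))
  next
    case False
    then have "x \<noteq> y'" by simp
    then have "?Q {x, y} = ?Q {x, y'}"
      by (rule card_cliques_one_step[OF in_e(3,4) in_f(4) in_e(2) in_f(2) xy(2)])
    also have "{x, y'} = {y', x}" by auto
    also have "?Q {y', x} = ?Q {y', x'}"
      by (rule card_cliques_one_step[OF in_f(4) in_e(3) in_f(3) in_e(1) in_f(1) False not_sym[OF xy'(2)]])
    also have "{y', x'} = f" using xy' by auto
    finally show ?thesis by (simp only: xy(1))
  qed
qed

lemma card_block_preimage:
  assumes "\<sigma> permutes {..<n}" "\<sigma> x < k * s" "k \<le> N"
  shows "card {y. same_block \<sigma> x y} = s" "{y. same_block \<sigma> x y} \<subseteq> {..<n}"
proof -
  have bij: "bij \<sigma>" using assms(1) by (rule permutes_bij)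
  have eq: "\<sigma> ` {y. same_block \<sigma> x y} = block s (\<sigma> x div s)"
  proof (intro set_eqI iffI)
    fix p assume "p \<in> \<sigma> ` {y. same_block \<sigma> x y}"
    then show "p \<in> block s (\<sigma> x div s)" using s_pos by (auto simp: same_block_def mem_block)
  next
    fix p assume "p \<in> block s (\<sigma> x div s)"
    then have "p div s = \<sigma> x div s" using s_pos by (simp add: mem_block)
    moreover have "p = \<sigma> (inv \<sigma> p)" using bij by (simp add: bij_is_surj surj_f_inv_f)
    ultimately show "p \<in> \<sigma> ` {y. same_block \<sigma> x y}" by (metis (mono_tags, lifting) same_block_def image_eqI mem_Collect_eq)
  qed
  have "card (\<sigma> ` {y. same_block \<sigma> x y}) = card {y. same_block \<sigma> x y}"
    using bij by (intro card_image) (auto intro: inj_on_subset bij_is_inj)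
  then show "card {y. same_block \<sigma> x y} = s" unfolding eq by simp
  show "{y. same_block \<sigma> x y} \<subseteq> {..<n}"
  proof
    fix y assume "y \<in> {y. same_block \<sigma> x y}"
    then have "\<sigma> y < k * s" using assms(2) by (simp add: same_block_def less_k_s_iff)
    also have "k * s \<le> n" using assms(3) n mult_le_mono1[of k N s] by linarith
    finally show "y \<in> {..<n}" using permutes_in_image[OF assms(1)] by blast
  qed
qed

text \<open>Every label in \<open>S\<close> lies on \<open>s - 1\<close> clique edges, so discarding
  all edges that meet \<open>S\<close> loses at most \<open>card S * (s - 1)\<close> of
  them.\<close>

lemma fresh_clique_edges:
  assumes k: "k \<le> N" and S: "finite S" and \<sigma>: "\<sigma> \<in> consistent k S \<gamma>"
  shows "k * (s choose 2) \<le> card {e. e \<subseteq> {..<n} - S \<and> card e = 2 \<and> \<sigma> ` e \<in> cliques k} + card S * (s - 1)"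
proof -
  note perm = consistentD(1)[OF \<sigma>]
  let ?E = "{e. \<sigma> ` e \<in> cliques k}"
  let ?F = "{e. e \<subseteq> {..<n} - S \<and> card e = 2 \<and> \<sigma> ` e \<in> cliques k}"
  let ?star = "\<lambda>x. (\<lambda>y. {x, y}) ` ({y. same_block \<sigma> x y} - {x})"
  have bij: "bij \<sigma>" using perm by (rule permutes_bij)
  have ks: "k * s \<le> n" using k n mult_le_mono1[OF k, of s] by linarith
  have pair: "\<exists>x y. e = {x, y} \<and> x \<noteq> y \<and> same_block \<sigma> x y \<and> x < n \<and> y < n" if "e \<in> ?E" for e
  proof -
    have "card (\<sigma> ` e) = 2" using that by (auto simp: clique_edges_def)
    moreover have "card (\<sigma> ` e) = card e"
      using bij by (intro card_image) (auto intro: inj_on_subset bij_is_inj)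
    ultimately obtain x y where xy: "e = {x, y}" "x \<noteq> y" by (auto simp: card_2_iff)
    have "{\<sigma> x, \<sigma> y} \<in> cliques k" using that xy by simp
    then have *: "\<sigma> x div s = \<sigma> y div s" "\<sigma> x < k * s" by (simp_all only: pair_in_cliques)
    then have "\<sigma> y < k * s" by (simp add: less_k_s_iff)
    then have "x < n" "y < n" using * ks permutes_in_image[OF perm]
      by (meson lessThan_iff order_less_le_trans)+
    then show ?thesis using xy * unfolding same_block_def by blast
  qed
  have "?E \<subseteq> ?F \<union> (\<Union>x\<in>S. ?star x)"
  proof
    fix e assume e: "e \<in> ?E"
    from pair[OF e] obtain x y where xy: "e = {x, y}" "x \<noteq> y" "same_block \<sigma> x y" "x < n" "y < n" by blast
    have "same_block \<sigma> y x" using xy(3) by (simp add: same_block_def)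
    then show "e \<in> ?F \<union> (\<Union>x\<in>S. ?star x)"
    proof (cases "x \<in> S \<or> y \<in> S")
      case True
      then show ?thesis
      proof
        assume "x \<in> S"
        moreover have "e \<in> ?star x" using xy by blast
        ultimately show ?thesis by blast
      next
        assume "y \<in> S"
        moreover have "e = {y, x}" using xy(1) by blast
        then have "e \<in> ?star y" using xy(2) \<open>same_block \<sigma> y x\<close> by blast
        ultimately show ?thesis by blast
      qed
    next
      case False
      then have "e \<subseteq> {..<n} - S" "card e = 2" using xy by auto
      then show ?thesis using e by blast
    qed
  qed
  moreover have "finite ?F" by (rule finite_subset[of _ "Pow {..<n}"]) auto
  moreover have fin: "finite {y. same_block \<sigma> x y}" if "x \<in> S" for x
    using card_block_preimage(2)[OF perm consistentD(2)[OF \<sigma> that] k] finite_subset by blast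
  ultimately have "card ?E \<le> card (?F \<union> (\<Union>x\<in>S. ?star x))"
    using S by (intro card_mono) auto
  also have "\<dots> \<le> card ?F + card (\<Union>x\<in>S. ?star x)" by (rule card_Un_le)
  also have "card (\<Union>x\<in>S. ?star x) \<le> (\<Sum>x\<in>S. card (?star x))" using S by (rule card_UN_le)
  also have "\<dots> \<le> (\<Sum>x\<in>S. s - 1)"
  proof (intro sum_mono)
    fix x assume x: "x \<in> S"
    have "card (?star x) \<le> card ({y. same_block \<sigma> x y} - {x})" using fin[OF x] by (intro card_image_le) auto
    also have "\<dots> = card {y. same_block \<sigma> x y} - 1"
      by (rule card_Diff_singleton) (simp add: same_block_def)
    also have "\<dots> = s - 1"
      by (simp only: card_block_preimage(1)[OF perm consistentD(2)[OF \<sigma> x] k])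
    finally show "card (?star x) \<le> s - 1" .
  qed
  finally show ?thesis using card_relabel_edges[OF bij, of "cliques k"] card_cliques by simp
qed

text \<open>Double counting of permutations and fresh pairs: each permutation has many fresh pairs
  as clique edges, and by symmetry every fresh pair receives the same share.\<close>

lemma card_fresh_edge:
  assumes k: "k \<le> N" and S: "finite S" "S \<subseteq> {..<n}" and e: "e \<subseteq> {..<n} - S" "card e = 2"
  shows "real (card (consistent k S \<gamma>)) * (k * (s choose 2) - card S * (real s - 1))
    \<le> card {\<sigma> \<in> consistent k S \<gamma>. \<sigma> ` e \<in> cliques k} * ((n - card S) choose 2)"
proof -
  let ?C = "consistent k S \<gamma>"
  let ?W = "{f. f \<subseteq> {..<n} - S \<and> card f = 2}"
  have fW: "finite ?W" by (rule finite_subset[of _ "Pow {..<n}"]) auto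
  have "real (card ?C) * (k * (s choose 2) - card S * (real s - 1))
      = (\<Sum>\<sigma>\<in>?C. k * (s choose 2) - card S * (real s - 1))" by simp
  also have "\<dots> \<le> (\<Sum>\<sigma>\<in>?C. real (card {f\<in>?W. \<sigma> ` f \<in> cliques k}))"
  proof (intro sum_mono)
    fix \<sigma> assume "\<sigma> \<in> ?C"
    from fresh_clique_edges[OF k S(1) this]
    have "k * (s choose 2) \<le> card {f\<in>?W. \<sigma> ` f \<in> cliques k} + card S * (s - 1)"
      by (simp add: conj_assoc)
    from of_nat_mono[OF this, where 'a=real]
    show "k * (s choose 2) - card S * (real s - 1) \<le> real (card {f\<in>?W. \<sigma> ` f \<in> cliques k})"
      using s by (simp add: of_nat_diff)
  qed
  also have "\<dots> = (\<Sum>\<sigma>\<in>?C. \<Sum>f\<in>?W. if \<sigma> ` f \<in> cliques k then 1 else 0)"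
    using fW by (simp add: sum.If_cases Int_def)
  also have "\<dots> = (\<Sum>f\<in>?W. \<Sum>\<sigma>\<in>?C. if \<sigma> ` f \<in> cliques k then 1 else 0)" by (rule sum.swap)
  also have "\<dots> = (\<Sum>f\<in>?W. real (card {\<sigma>\<in>?C. \<sigma> ` f \<in> cliques k}))"
    using finite_consistent by (simp add: sum.If_cases Int_def)
  also have "\<dots> = (\<Sum>f\<in>?W. real (card {\<sigma>\<in>?C. \<sigma> ` e \<in> cliques k}))"
    using card_cliques_symmetric[OF _ _ e] by (intro sum.cong) auto
  also have "\<dots> = card {\<sigma>\<in>?C. \<sigma> ` e \<in> cliques k} * real (card ?W)" by simp
  also have "card ?W = (n - card S) choose 2"
    using n_subsets[of "{..<n} - S" 2] S by (simp add: card_Diff_subset)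
  finally show ?thesis by simp
qed

text \<open>The block of \<open>x\<close> holds \<open>s\<close> labels. On average over the
  permutations, each member of the group of \<open>x\<close> accounts for at most 1 of them, each
  other revealed label for at most \<open>1 / (k - card S)\<close> by \<open>card_collision\<close>,
  and the fresh labels share the rest equally by symmetry.\<close>

lemma card_fresh_nbr:
  assumes k: "k \<le> N" and S: "finite S" "S \<subseteq> {..<n}" "x \<in> S" "card S < k" and y: "y < n" "y \<notin> S"
  shows "real (card (consistent k S \<gamma>))
      * (real s - card {z \<in> S. \<gamma> z = \<gamma> x} - card S / (real k - card S))
    \<le> card {\<sigma> \<in> consistent k S \<gamma>. same_block \<sigma> x y} * (real n - card S)"
proof -
  let ?C = "consistent k S \<gamma>"
  let ?g = "{z \<in> S. \<gamma> z = \<gamma> x}"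
  let ?ind = "\<lambda>\<sigma> z. if same_block \<sigma> x z then 1 else 0 :: real"
  have kS: "0 < real k - card S" using S by simp
  have all: "(\<Sum>z<n. ?ind \<sigma> z) = s" if "\<sigma> \<in> ?C" for \<sigma>
  proof -
    have "{..<n} \<inter> {z. same_block \<sigma> x z} = {z. same_block \<sigma> x z}"
      using card_block_preimage(2)[OF consistentD(1)[OF that] consistentD(2)[OF that S(3)] k] by blast
    then show ?thesis
      using card_block_preimage(1)[OF consistentD(1)[OF that] consistentD(2)[OF that S(3)] k]
      by (simp add: sum.If_cases)
  qed
  have other: "(\<Sum>\<sigma>\<in>?C. ?ind \<sigma> z) \<le> card ?C / (real k - card S)" if z: "z \<in> S - ?g" for z
  proof -
    have "card {\<sigma> \<in> ?C. same_block \<sigma> x z} * (k - card S) \<le> card ?C"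
      using z S by (intro card_collision[OF k]) auto
    from of_nat_mono[OF this, where 'a=real]
    have "real (card {\<sigma> \<in> ?C. same_block \<sigma> x z}) * (real k - card S) \<le> card ?C"
      using S by (simp add: of_nat_diff)
    then show ?thesis using kS finite_consistent by (simp add: sum.If_cases Int_def field_simps)
  qed
  have sym: "(\<Sum>\<sigma>\<in>?C. ?ind \<sigma> z) = card {\<sigma> \<in> ?C. same_block \<sigma> x y}" if z: "z \<in> {..<n} - S" for z
  proof -
    have "card {\<sigma> \<in> ?C. same_block \<sigma> x z} = card {\<sigma> \<in> ?C. same_block \<sigma> x y}"
    proof (rule card_consistent_transpose)
      have "x \<noteq> z" "x \<noteq> y" using z y S by auto
      then show "same_block \<sigma> x z = same_block (\<sigma> \<circ> Transposition.transpose z y) x y" for \<sigma>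
        by (simp add: same_block_def)
    qed (use z y in auto)
    then show ?thesis using finite_consistent by (simp add: sum.If_cases Int_def)
  qed
  have split: "(\<Sum>z<n. f z) = (\<Sum>z\<in>{..<n} - S. f z) + (\<Sum>z\<in>S - ?g. f z) + (\<Sum>z\<in>?g. f z)"
    for f :: "nat \<Rightarrow> real"
    using sum.subset_diff[OF S(2) finite_lessThan, of f] sum.subset_diff[OF _ S(1), of ?g f] by simp
  let ?X = "\<lambda>z. \<Sum>\<sigma>\<in>?C. ?ind \<sigma> z"
  have "card ?C * real s = (\<Sum>\<sigma>\<in>?C. \<Sum>z<n. ?ind \<sigma> z)" by (subst sum.cong[OF refl all]) simp_all
  also have "\<dots> = (\<Sum>z<n. ?X z)" by (rule sum.swap)
  also have "\<dots> = sum ?X ({..<n} - S) + sum ?X (S - ?g) + sum ?X ?g" by (rule split)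
  finally have total: "card ?C * real s = sum ?X ({..<n} - S) + sum ?X (S - ?g) + sum ?X ?g" .
  have "sum ?X ({..<n} - S) = (\<Sum>z\<in>{..<n} - S. real (card {\<sigma> \<in> ?C. same_block \<sigma> x y}))"
    by (rule sum.cong[OF refl sym])
  then have fresh: "sum ?X ({..<n} - S) = card {\<sigma> \<in> ?C. same_block \<sigma> x y} * (real n - card S)"
    using S card_mono[OF finite_lessThan S(2)] by (simp add: card_Diff_subset of_nat_diff)
  have "sum ?X (S - ?g) \<le> (\<Sum>z\<in>S - ?g. card ?C / (real k - card S))"
    by (rule sum_mono[OF other])
  also have "\<dots> = card (S - ?g) * (card ?C / (real k - card S))" by simp
  also have "\<dots> \<le> card S * (card ?C / (real k - card S))"
    using S kS by (intro mult_right_mono) (simp_all add: card_mono)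
  finally have others: "sum ?X (S - ?g) \<le> card S * (card ?C / (real k - card S))" .
  have "sum ?X ?g \<le> (\<Sum>z\<in>?g. real (card ?C))"
    using finite_consistent by (intro sum_mono) (simp add: sum.If_cases card_mono)
  then have group: "sum ?X ?g \<le> card ?g * real (card ?C)" by simp
  have "real (card ?C) * (real s - card ?g - card S / (real k - card S))
      = card ?C * real s - card ?g * real (card ?C) - card S * (card ?C / (real k - card S))"
    by (simp add: algebra_simps)
  then show ?thesis using total fresh others group by linarith
qed

end

section \<open>The ideal process on groups of labels\<close>

type_synonym groups = "nat set \<times> (nat \<Rightarrow> nat) \<times> (nat \<times> nat) set"

lemma pmf_VertexAns_of_set:
  assumes "finite A" "A \<noteq> {}"
  shows "pmf (map_pmf VertexAns (pmf_of_set A)) (VertexAns y) = indicator A y / card A"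
  using assms by (subst pmf_map_inj') (auto simp: inj_on_def)

context block_params
begin

definition group :: "nat set \<Rightarrow> (nat \<Rightarrow> nat) \<Rightarrow> nat \<Rightarrow> nat set" where
  "group S \<gamma> x = {z \<in> S. \<gamma> z = \<gamma> x}"

text \<open>A uniform neighbour in a clique of \<open>s\<close> vertices is a known member of a
  group of size \<open>g\<close> with probability \<open>(g - 1) / (s - 1)\<close>; otherwise it is
  taken to be a uniform unrevealed label. The singleton group is kept apart because
  \<open>pmf_of_set\<close> of the empty set is unspecified.\<close>

definition nbr_ideal :: "nat set \<Rightarrow> (nat \<Rightarrow> nat) \<Rightarrow> nat \<Rightarrow> nat pmf" where
  "nbr_ideal S \<gamma> x = (if group S \<gamma> x = {x} then pmf_of_set ({..<n} - S)
     else bind_pmf (bernoulli_pmf ((real (card (group S \<gamma> x)) - 1) / (real s - 1)))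
       (\<lambda>b. if b then pmf_of_set (group S \<gamma> x - {x}) else pmf_of_set ({..<n} - S)))"

text \<open>A state \<open>(S, \<gamma>, F)\<close> records the revealed labels, a representative of the group
  of labels known to share a block, and the pairs that were found non-adjacent.\<close>

definition group_ideal :: "groups \<Rightarrow> query \<Rightarrow> answer pmf" where
  "group_ideal = (\<lambda>(S, \<gamma>, F) q. if \<not> query_args q \<subseteq> S then return_pmf Refused else
     (case q of
        RandEdge \<Rightarrow> map_pmf EdgeAns (pmf_of_set {e. e \<subseteq> {..<n} - S \<and> card e = 2})
      | RandNbr x \<Rightarrow> map_pmf VertexAns (nbr_ideal S \<gamma> x)
      | Degree x \<Rightarrow> return_pmf (NumberAns (s - 1))
      | PairQuery x y \<Rightarrow> return_pmf (BoolAns (x \<noteq> y \<and> \<gamma> x = \<gamma> y))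
      | _ \<Rightarrow> return_pmf Refused))"

text \<open>Naming a new group by an endpoint of its edge keeps \<gamma> inside \<open>S\<close> and
  makes the name new. Only pairs from different groups enter \<open>F\<close>; to these
  \<open>card_collision\<close> applies.\<close>

definition group_step :: "groups \<Rightarrow> query \<Rightarrow> answer \<Rightarrow> groups" where
  "group_step = (\<lambda>(S, \<gamma>, F) q a. if \<not> query_args q \<subseteq> S then (S, \<gamma>, F) else
     (case q of
        RandEdge \<Rightarrow> (S \<union> revealed a, \<lambda>z. if z \<in> revealed a then Min (revealed a) else \<gamma> z, F)
      | RandNbr x \<Rightarrow>
          (case a of VertexAns y \<Rightarrow> if y \<in> S then (S, \<gamma>, F) else (insert y S, \<gamma>(y := \<gamma> x), F)
           | _ \<Rightarrow> (S, \<gamma>, F))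
      | PairQuery x y \<Rightarrow> if \<gamma> x = \<gamma> y then (S, \<gamma>, F) else (S, \<gamma>, insert (x, y) F)
      | _ \<Rightarrow> (S, \<gamma>, F)))"

definition labellings :: "nat \<Rightarrow> groups \<Rightarrow> (nat \<Rightarrow> nat) set" where
  "labellings k = (\<lambda>(S, \<gamma>, F). {\<sigma> \<in> consistent k S \<gamma>. \<forall>(x, y)\<in>F. \<not> same_block \<sigma> x y})"

text \<open>Serves as \<open>Z\<close>. It ignores \<open>F\<close>, so that a pair query leaves it
  unchanged and the counts by symmetry apply to it; the difference from \<open>labellings\<close> is
  paid for once, by \<open>mu\<close>.\<close>

definition label_count :: "nat \<Rightarrow> groups \<Rightarrow> real" where
  "label_count k = (\<lambda>(S, \<gamma>, F). real (card (consistent k S \<gamma>)))"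

text \<open>A query reveals at most two labels and adds at most one pair to \<open>F\<close>, which
  explains \<open>2 * b\<close> for \<open>S\<close> and \<open>b\<close> for \<open>F\<close>.
  Nonemptiness keeps \<open>label_count\<close> positive.\<close>

definition group_valid :: "nat \<Rightarrow> nat \<Rightarrow> groups \<Rightarrow> nat \<Rightarrow> bool" where
  "group_valid k m = (\<lambda>(S, \<gamma>, F) b. S \<subseteq> {..<n} \<and> \<gamma> ` S \<subseteq> S \<and> card S + 2 * b \<le> 2 * m
     \<and> F \<subseteq> {(x, y). x \<in> S \<and> y \<in> S \<and> \<gamma> x \<noteq> \<gamma> y} \<and> card F + b \<le> m \<and> consistent k S \<gamma> \<noteq> {})"

abbreviation "hg k \<equiv> \<lambda>\<sigma>. relabel \<sigma> (bg {..<k})"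

lemma nbrs_relabel:
  assumes k: "k \<le> N" and \<sigma>: "\<sigma> \<in> consistent k S \<gamma>" and x: "x \<in> S"
  shows "nbrs (hg k \<sigma>) x = {y. same_block \<sigma> x y} - {x}"
    and "card (nbrs (hg k \<sigma>) x) = s - 1" "finite (nbrs (hg k \<sigma>) x)"
proof -
  have inj: "inj \<sigma>" by (rule permutes_inj[OF consistentD(1)[OF \<sigma>]])
  have xk: "\<sigma> x div s < k" using consistentD(2)[OF \<sigma> x] by (simp add: less_k_s_iff)
  have "nbrs (bg {..<k}) (\<sigma> x) = block s (\<sigma> x div s) - {\<sigma> x}"
    using k xk s_pos by (intro nbrs_clique) (auto simp: mem_block)
  then have *: "{\<sigma> x, p} \<in> edges (bg {..<k}) \<longleftrightarrow> p div s = \<sigma> x div s \<and> p \<noteq> \<sigma> x" for p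
    using s_pos by (auto simp: nbrs_def mem_block set_eq_iff)
  show 1: "nbrs (hg k \<sigma>) x = {y. same_block \<sigma> x y} - {x}"
    using inj by (auto simp: nbrs_def relabel_def * same_block_def inj_eq)
  note pre = card_block_preimage[OF consistentD(1)[OF \<sigma>] consistentD(2)[OF \<sigma> x] k]
  have fin: "finite {y. same_block \<sigma> x y}" by (rule finite_subset[OF pre(2)]) simp
  then show "finite (nbrs (hg k \<sigma>) x)" unfolding 1 by simp
  have "x \<in> {y. same_block \<sigma> x y}" by (simp add: same_block_def)
  then have "card ({y. same_block \<sigma> x y} - {x}) = card {y. same_block \<sigma> x y} - 1"
    by (rule card_Diff_singleton)
  then show "card (nbrs (hg k \<sigma>) x) = s - 1" unfolding 1 pre(1) .
qed

lemma pair_relabel: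
  assumes k: "k \<le> N" and \<sigma>: "\<sigma> \<in> consistent k S \<gamma>" and x: "x \<in> S"
  shows "{x, y} \<in> edges (hg k \<sigma>) \<longleftrightarrow> same_block \<sigma> x y \<and> x \<noteq> y"
proof -
  have "{x, y} \<in> edges (hg k \<sigma>) \<longleftrightarrow> y \<in> nbrs (hg k \<sigma>) x" by (simp add: nbrs_def)
  then show ?thesis unfolding nbrs_relabel(1)[OF assms] by auto
qed

lemma group_in: "x \<in> S \<Longrightarrow> x \<in> group S \<gamma> x" by (simp add: group_def)

lemma finite_group: "finite S \<Longrightarrow> finite (group S \<gamma> x)" by (simp add: group_def)

lemma card_group: "finite S \<Longrightarrow> card (group S \<gamma> x) \<le> card S"
  by (auto simp: group_def intro: card_mono)

text \<open>Upper bounds suffice, since the ideal probability only has to be dominated. They are the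
  true probability \<open>1 / (s - 1)\<close> for a known member, and the remaining mass spread
  evenly over the unrevealed labels.\<close>

lemma nbr_ideal_props:
  assumes S: "finite S" "S \<subseteq> {..<n}" "x \<in> S" "card S < n" "card S < s"
  shows "set_pmf (nbr_ideal S \<gamma> x) \<subseteq> (group S \<gamma> x - {x}) \<union> ({..<n} - S)"
    and "y \<in> group S \<gamma> x - {x} \<Longrightarrow> pmf (nbr_ideal S \<gamma> x) y \<le> 1 / (real s - 1)"
    and "y \<in> {..<n} - S \<Longrightarrow> pmf (nbr_ideal S \<gamma> x) y
       \<le> (real s - card (group S \<gamma> x)) / ((real s - 1) * (real n - card S))"
proof -
  let ?g = "group S \<gamma> x"
  let ?V = "{..<n} - S"
  let ?p = "(real (card ?g) - 1) / (real s - 1)"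
  have g: "finite ?g" "x \<in> ?g" "?g \<subseteq> S" "card ?g < s"
    using S card_group[OF S(1), of \<gamma> x] finite_group[OF S(1)] group_in[OF S(3)]
    by (auto simp: group_def)
  have cV: "real (card ?V) = real n - card S"
    using S by (simp add: card_Diff_subset of_nat_diff)
  have V: "finite ?V" "?V \<noteq> {}"
  proof -
    show "?V \<noteq> {}"
    proof
      assume "?V = {}"
      then have "card ?V = 0" by (simp only: card.empty)
      then show False using cV S(4) by linarith
    qed
  qed simp
  have s1: "0 < real s - 1" using s by simp
  consider "?g = {x}" | "?g \<noteq> {x}" "?g - {x} \<noteq> {}" "1 < card ?g"
  proof (cases "?g = {x}")
    case False
    then obtain z where z: "z \<in> ?g" "z \<noteq> x" using g(2) by blast
    have "card {x, z} \<le> card ?g" using z g by (intro card_mono) auto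
    then show ?thesis using that(2) z False by auto
  qed
  note cases = this
  show "set_pmf (nbr_ideal S \<gamma> x) \<subseteq> (?g - {x}) \<union> ?V"
  proof (cases rule: cases)
    case 1
    then show ?thesis using V by (simp add: nbr_ideal_def)
  next
    case 2
    have "set_pmf (pmf_of_set (?g - {x})) = ?g - {x}" "set_pmf (pmf_of_set ?V) = ?V"
      using 2(2) g(1) V by simp_all
    then show ?thesis using 2(1) by (simp add: nbr_ideal_def set_bind_pmf UN_subset_iff)
  qed
  have pmf: "pmf (nbr_ideal S \<gamma> x) y = ?p * (indicator (?g - {x}) y / (real (card ?g) - 1))
      + (1 - ?p) * (indicator ?V y / card ?V)" if "?g \<noteq> {x}" "?g - {x} \<noteq> {}" "1 < card ?g"
  proof -
    have "0 \<le> ?p" "?p \<le> 1" using that g s1 by (simp_all add: field_simps)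
    moreover have "card (?g - {x}) = card ?g - 1" using g by simp
    ultimately show ?thesis using that V g
      by (simp add: nbr_ideal_def pmf_bind of_nat_diff algebra_simps)
  qed
  show "pmf (nbr_ideal S \<gamma> x) y \<le> 1 / (real s - 1)" if y: "y \<in> ?g - {x}"
  proof (cases rule: cases)
    case 1
    then show ?thesis using y by simp
  next
    case 2
    have "y \<notin> ?V" using y g by auto
    then have "pmf (nbr_ideal S \<gamma> x) y = ?p * (1 / (real (card ?g) - 1))"
      using pmf[OF 2] y by simp
    also have "\<dots> = 1 / (real s - 1)" using 2 s1 by simp
    finally show ?thesis by simp
  qed
  show "pmf (nbr_ideal S \<gamma> x) y
       \<le> (real s - card ?g) / ((real s - 1) * (real n - card S))" if y: "y \<in> ?V"
  proof (cases rule: cases)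
    case 1
    then have "pmf (nbr_ideal S \<gamma> x) y = 1 / card ?V" using V y by (simp add: nbr_ideal_def)
    then show ?thesis unfolding cV using 1 s1 by simp
  next
    case 2
    have "y \<notin> ?g" using y g by auto
    then have "pmf (nbr_ideal S \<gamma> x) y = (1 - ?p) / card ?V"
      using pmf[OF 2] y by simp
    also have "1 - ?p = (real s - card ?g) / (real s - 1)" using s1 by (simp add: field_simps)
    finally show ?thesis unfolding cV by simp
  qed
qed

end

section \<open>Likelihood ratios of single queries\<close>

context block_params
begin

text \<open>The step conditions of \<open>hidden_graph\<close> for one query of unit cost and one
  answer, bundled so that each kind of query has its own lemma.\<close>

definition faithful_step ::
  "nat \<Rightarrow> nat \<Rightarrow> real \<Rightarrow> groups \<Rightarrow> nat \<Rightarrow> query \<Rightarrow> answer \<Rightarrow> bool" where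
  "faithful_step k m lam x b q a \<longleftrightarrow>
     group_valid k m (group_step x q a) (b - 1) \<and>
     fst (group_step x q a) = fst x \<union> revealed a \<and>
     labellings k (group_step x q a) \<subseteq> labellings k x \<and>
     (\<forall>\<sigma>\<in>labellings k (group_step x q a).
        (1 - lam) * label_count k x * pmf (group_ideal x q) a
          \<le> label_count k (group_step x q a) * pmf (respond (hg k \<sigma>) (fst x) q) a)"

lemma labellingsD: "\<sigma> \<in> labellings k (S, \<gamma>, F) \<Longrightarrow> \<sigma> \<in> consistent k S \<gamma>"
  by (simp add: labellings_def)

lemma group_validD:
  assumes "group_valid k m (S, \<gamma>, F) b"
  shows "S \<subseteq> {..<n}" "\<gamma> ` S \<subseteq> S" "card S + 2 * b \<le> 2 * m" "card F + b \<le> m"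
    "F \<subseteq> {(x, y). x \<in> S \<and> y \<in> S \<and> \<gamma> x \<noteq> \<gamma> y}" "consistent k S \<gamma> \<noteq> {}" "finite S" "finite F"
proof -
  show S: "S \<subseteq> {..<n}" and "\<gamma> ` S \<subseteq> S" "card S + 2 * b \<le> 2 * m" "card F + b \<le> m"
    "consistent k S \<gamma> \<noteq> {}" and F: "F \<subseteq> {(x, y). x \<in> S \<and> y \<in> S \<and> \<gamma> x \<noteq> \<gamma> y}"
    using assms unfolding group_valid_def by auto
  show fS: "finite S" using S by (rule finite_subset) simp
  have "F \<subseteq> S \<times> S" using F by blast
  then show "finite F" using fS by (meson finite_SigmaI finite_subset)
qed

lemma group_validI:
  assumes "S \<subseteq> {..<n}" "\<gamma> ` S \<subseteq> S" "card S + 2 * b \<le> 2 * m" "card F + b \<le> m"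
    "F \<subseteq> {(x, y). x \<in> S \<and> y \<in> S \<and> \<gamma> x \<noteq> \<gamma> y}" "consistent k S \<gamma> \<noteq> {}"
  shows "group_valid k m (S, \<gamma>, F) b"
  using assms unfolding group_valid_def by simp

lemma group_valid_less:
  "group_valid k m (S, \<gamma>, F) b \<Longrightarrow> group_valid k m (S, \<gamma>, F) (b - 1)"
  by (rule group_validI) (use group_validD[of k m S \<gamma> F b] in auto)

lemma label_count_pos: "group_valid k m x b \<Longrightarrow> 0 < label_count k x"
proof -
  assume v: "group_valid k m x b"
  obtain S \<gamma> F where x: "x = (S, \<gamma>, F)" by (cases x)
  have "0 < card (consistent k S \<gamma>)"
    using group_validD(6)[OF v[unfolded x]] finite_consistent by (simp add: card_gt_0_iff)
  then show ?thesis by (simp add: x label_count_def)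
qed

text \<open>If the state does not change, the counts on both sides agree, and the answer merely has
  to be at least as likely as in the ideal process.\<close>

lemma faithful_same:
  assumes v: "group_valid k m (S, \<gamma>, F) b" and lam: "0 \<le> lam"
    and step: "group_step (S, \<gamma>, F) q a = (S, \<gamma>, F)" and rev: "revealed a \<subseteq> S"
    and w: "\<And>\<sigma>. \<sigma> \<in> consistent k S \<gamma> \<Longrightarrow>
      pmf (group_ideal (S, \<gamma>, F) q) a \<le> pmf (respond (hg k \<sigma>) S q) a"
  shows "faithful_step k m lam (S, \<gamma>, F) b q a"
proof -
  have "(1 - lam) * label_count k (S, \<gamma>, F) * pmf (group_ideal (S, \<gamma>, F) q) a
        \<le> label_count k (S, \<gamma>, F) * pmf (respond (hg k \<sigma>) S q) a"
    if "\<sigma> \<in> labellings k (S, \<gamma>, F)" for \<sigma>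
  proof -
    have "(1 - lam) * (label_count k (S, \<gamma>, F) * pmf (group_ideal (S, \<gamma>, F) q) a)
       \<le> 1 * (label_count k (S, \<gamma>, F) * pmf (group_ideal (S, \<gamma>, F) q) a)"
      using lam label_count_pos[OF v] by (intro mult_right_mono) auto
    also have "\<dots> \<le> label_count k (S, \<gamma>, F) * pmf (respond (hg k \<sigma>) S q) a"
      using w[OF labellingsD[OF that]] label_count_pos[OF v] by (simp add: mult_left_mono)
    finally show ?thesis by (simp only: mult.assoc)
  qed
  then show ?thesis using group_valid_less[OF v] rev
    unfolding faithful_step_def step by auto
qed

text \<open>The ideal answer is uniform over the \<open>w\<close> fresh pairs, the true one over the
  edges. By \<open>card_fresh_edge\<close> at least a fraction
  \<open>(k * C - card S * (s - 1)) / w\<close> of the consistent permutations makes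
  \<open>e\<close> a clique edge, with \<open>C = s choose 2\<close>; so \<open>w\<close> cancels
  and \<open>bound\<close> compares numbers of edges.\<close>

lemma faithful_rand_edge:
  fixes lam :: real
  assumes k: "k \<le> N" and m: "2 * m < k" and lam: "lam \<le> 1"
    and bound: "(1 - lam) * (k * (s choose 2) + n) \<le> k * (s choose 2) - 2 * real m * (real s - 1)"
    and v: "group_valid k m (S, \<gamma>, F) b" and b: "1 \<le> b"
    and e: "e \<subseteq> {..<n} - S" "card e = 2"
  shows "faithful_step k m lam (S, \<gamma>, F) b RandEdge (EdgeAns e)"
proof -
  note D = group_validD[OF v]
  obtain x y where xy: "e = {x, y}" "x \<noteq> y" using e(2) by (auto simp: card_2_iff)
  let ?c = "Min e"
  have c: "?c \<in> e" using xy by (intro Min_in) auto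
  let ?\<gamma> = "\<lambda>z. if z \<in> e then ?c else \<gamma> z"
  have step: "group_step (S, \<gamma>, F) RandEdge (EdgeAns e) = (S \<union> e, ?\<gamma>, F)"
    by (simp add: group_step_def cong: if_cong)
  have cons: "consistent k (S \<union> e) ?\<gamma> = {\<sigma> \<in> consistent k S \<gamma>. \<sigma> ` e \<in> cliques k}"
    unfolding xy(1) using c e(1) xy D(2) by (intro cliques_insert) auto
  let ?C = "real (s choose 2)"
  let ?Z = "real (card (consistent k S \<gamma>))"
  let ?Z' = "real (card (consistent k (S \<union> e) ?\<gamma>))"
  let ?w = "(n - card S) choose 2"
  have fresh: "?Z * (k * ?C - card S * (real s - 1)) \<le> ?Z' * ?w"
    unfolding cons using card_fresh_edge[OF k D(7,1) e] by simp
  have cS: "card S \<le> 2 * m" using D(3) by simp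
  have lower: "k * ?C - 2 * real m * (real s - 1) \<le> k * ?C - card S * (real s - 1)"
    using cS s of_nat_mono[OF cS, where 'a=real] by (intro diff_left_mono mult_right_mono) auto
  \<comment> \<open>Positive because \<open>2 * m < k\<close> and \<open>2 \<le> s\<close>; hence
    some permutation agrees with the new edge and the state stays valid.\<close>
  have "2 * (k * ?C - 2 * real m * (real s - 1)) = k * (2 * ?C) - 4 * real m * (real s - 1)" by simp
  also have "\<dots> = (real k * s - 4 * real m) * (real s - 1)"
    unfolding real_choose_two by (simp add: algebra_simps)
  also have "\<dots> > 0"
  proof (intro mult_pos_pos)
    have "real k * 2 \<le> real k * s" using s by (intro mult_left_mono) auto
    then show "0 < real k * s - 4 * real m" using m by linarith
  qed (use s in simp)
  finally have pos: "0 < k * ?C - 2 * real m * (real s - 1)" by simp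
  have Z: "0 < ?Z" using label_count_pos[OF v] by (simp add: label_count_def)
  have ne: "consistent k (S \<union> e) ?\<gamma> \<noteq> {}"
  proof
    assume "consistent k (S \<union> e) ?\<gamma> = {}"
    then have "?Z' = 0" by (simp only: card.empty of_nat_0)
    then have "?Z * (k * ?C - card S * (real s - 1)) \<le> 0" using fresh by simp
    moreover have "0 < ?Z * (k * ?C - card S * (real s - 1))" using Z pos lower by (intro mult_pos_pos) linarith+
    ultimately show False by linarith
  qed
  have valid: "group_valid k m (S \<union> e, ?\<gamma>, F) (b - 1)"
  proof (rule group_validI)
    show "S \<union> e \<subseteq> {..<n}" using D(1) e by blast
    show "?\<gamma> ` (S \<union> e) \<subseteq> S \<union> e" using D(2) c by auto
    have "card (S \<union> e) \<le> card S + 2" using card_Un_le[of S e] e by simp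
    then show "card (S \<union> e) + 2 * (b - 1) \<le> 2 * m" using D(3) b by linarith
    show "card F + (b - 1) \<le> m" using D(4) by linarith
    show "F \<subseteq> {(u, v). u \<in> S \<union> e \<and> v \<in> S \<union> e \<and> ?\<gamma> u \<noteq> ?\<gamma> v}"
    proof
      fix p assume "p \<in> F"
      then obtain u v where p: "p = (u, v)" "u \<in> S" "v \<in> S" "\<gamma> u \<noteq> \<gamma> v" using D(5) by blast
      moreover have "u \<notin> e" "v \<notin> e" using p e by auto
      ultimately show "p \<in> {(u, v). u \<in> S \<union> e \<and> v \<in> S \<union> e \<and> ?\<gamma> u \<noteq> ?\<gamma> v}" by simp
    qed
  qed (rule ne)
  have sub: "labellings k (S \<union> e, ?\<gamma>, F) \<subseteq> labellings k (S, \<gamma>, F)"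
    unfolding labellings_def using cons by auto
  have "(1 - lam) * label_count k (S, \<gamma>, F) * pmf (group_ideal (S, \<gamma>, F) RandEdge) (EdgeAns e)
      \<le> label_count k (S \<union> e, ?\<gamma>, F) * pmf (respond (hg k \<sigma>) S RandEdge) (EdgeAns e)"
    if \<sigma>: "\<sigma> \<in> labellings k (S \<union> e, ?\<gamma>, F)" for \<sigma>
  proof -
    have \<sigma>: "\<sigma> \<in> consistent k S \<gamma>" "\<sigma> ` e \<in> cliques k"
      using labellingsD[OF \<sigma>] unfolding cons by auto
    have bij: "bij \<sigma>" by (rule permutes_bij[OF consistentD(1)[OF \<sigma>(1)]])
    have T: "{..<k} \<subseteq> {..<N}" using k by auto
    let ?E = "edges (hg k \<sigma>)"
    have E: "?E = {e. \<sigma> ` e \<in> edges (bg {..<k})}" by (simp add: relabel_def)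
    have fE: "finite ?E" unfolding E finite_relabel_edges[OF bij] by (rule finite_edges[OF T])
    have cE: "card ?E = card (edges (bg {..<k}))" unfolding E by (rule card_relabel_edges[OF bij])
    have "e \<in> ?E" unfolding E using \<sigma>(2) by (auto simp: block_graph_def)
    then have r: "pmf (respond (hg k \<sigma>) S RandEdge) (EdgeAns e) = 1 / card ?E"
      using pmf_EdgeAns_of_set[OF fE] by (simp add: respond_def)
    have M: "0 < real (card ?E)" using \<open>e \<in> ?E\<close> fE card_gt_0_iff by auto
    let ?W = "{e. e \<subseteq> {..<n} - S \<and> card e = 2}"
    have fW: "finite ?W" by (rule finite_subset[of _ "Pow {..<n}"]) auto
    have cW: "card ?W = ?w" using n_subsets[of "{..<n} - S" 2] D(1,7) by (simp add: card_Diff_subset)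
    have i: "pmf (group_ideal (S, \<gamma>, F) RandEdge) (EdgeAns e) = 1 / ?w"
      using pmf_EdgeAns_of_set[OF fW, of e] e by (simp add: group_ideal_def cW)
    have w0: "0 < real ?w" using card_gt_0_iff[of ?W] fW e cW by auto
    have "real (card ?E) \<le> k * ?C + n"
      using of_nat_mono[OF card_edges_le[OF T], where 'a=real] cE by simp
    then have "(1 - lam) * card ?E \<le> (1 - lam) * (k * ?C + n)"
      using lam by (intro mult_left_mono) auto
    also have "\<dots> \<le> k * ?C - card S * (real s - 1)" using bound lower unfolding of_nat_add of_nat_mult by linarith
    finally have "?Z * ((1 - lam) * card ?E) \<le> ?Z * (k * ?C - card S * (real s - 1))"
      using Z by (intro mult_left_mono) auto
    also note fresh
    finally show ?thesis unfolding r i label_count_def using M w0 by (simp add: field_simps)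
  qed
  then show ?thesis unfolding faithful_step_def step using valid sub by auto
qed

text \<open>Known neighbours have their true probability; only a fresh one needs care. The group of
  \<open>x\<close>, of size \<open>g\<close>, leaves \<open>s - g\<close> places in its block, and
  by \<open>bound\<close> the fraction lost to collisions with other revealed labels is at most
  \<open>lam\<close>.\<close>

lemma faithful_rand_nbr:
  assumes k: "k \<le> N" and m: "2 * m < k" "2 * m < s" and lam: "0 \<le> lam" "lam < 1"
    and bound: "2 * real m \<le> lam * (real k - 2 * real m) * (real s - 2 * real m)"
    and v: "group_valid k m (S, \<gamma>, F) b" and b: "1 \<le> b" and x: "x \<in> S"
    and y: "y \<in> set_pmf (nbr_ideal S \<gamma> x)"
  shows "faithful_step k m lam (S, \<gamma>, F) b (RandNbr x) (VertexAns y)"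
proof -
  note D = group_validD[OF v]
  have cS: "card S \<le> 2 * m" using D(3) by simp
  have kn: "k \<le> n"
  proof -
    have "N * 1 \<le> N * s" using s by (intro mult_le_mono2) simp
    then show ?thesis using k n by linarith
  qed
  have cSn: "card S < n" "card S < s" using cS m kn by linarith+
  note props = nbr_ideal_props[OF D(7,1) x cSn]
  have s1: "0 < real s - 1" using s by simp
  let ?g = "group S \<gamma> x"
  have ideal: "pmf (group_ideal (S, \<gamma>, F) (RandNbr x)) (VertexAns y) = pmf (nbr_ideal S \<gamma> x) y"
    using x by (simp add: group_ideal_def) (subst pmf_map_inj', auto simp: inj_on_def)
  have r: "pmf (respond (hg k \<sigma>) S (RandNbr x)) (VertexAns y) = 1 / (real s - 1)"
    if "\<sigma> \<in> consistent k S \<gamma>" "y \<in> nbrs (hg k \<sigma>) x" for \<sigma>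
  proof -
    have "nbrs (hg k \<sigma>) x \<noteq> {}" using that(2) by blast
    then show ?thesis
      using pmf_VertexAns_of_set[OF nbrs_relabel(3)[OF k that(1) x], of y]
        nbrs_relabel(2)[OF k that(1) x] that(2) s x
      by (simp add: respond_def of_nat_diff)
  qed
  consider "y \<in> ?g - {x}" | "y \<in> {..<n} - S" using props(1) y by blast
  then show ?thesis
  proof cases
    case 1
    then have yS: "y \<in> S" "\<gamma> y = \<gamma> x" "y \<noteq> x" by (auto simp: group_def)
    show ?thesis
    proof (rule faithful_same[OF v lam(1)])
      show "group_step (S, \<gamma>, F) (RandNbr x) (VertexAns y) = (S, \<gamma>, F)"
        using yS by (simp add: group_step_def)
      show "revealed (VertexAns y) \<subseteq> S" using yS by simp
      fix \<sigma> assume \<sigma>: "\<sigma> \<in> consistent k S \<gamma>"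
      have "same_block \<sigma> x y" unfolding same_block_def
        using consistentD(3)[OF \<sigma> x yS(1)] yS(2) by simp
      then have "y \<in> nbrs (hg k \<sigma>) x" unfolding nbrs_relabel(1)[OF k \<sigma> x] using yS by simp
      then show "pmf (group_ideal (S, \<gamma>, F) (RandNbr x)) (VertexAns y)
          \<le> pmf (respond (hg k \<sigma>) S (RandNbr x)) (VertexAns y)"
        using r[OF \<sigma>] props(2)[OF 1] ideal by simp
    qed
  next
    case 2
    then have yn: "y < n" "y \<notin> S" by auto
    let ?\<gamma> = "\<gamma>(y := \<gamma> x)"
    have step: "group_step (S, \<gamma>, F) (RandNbr x) (VertexAns y) = (insert y S, ?\<gamma>, F)"
      using yn x by (simp add: group_step_def)
    note cons = consistent_insert[OF x yn(2), of k \<gamma>]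
    let ?Z = "real (card (consistent k S \<gamma>))"
    let ?Z' = "real (card (consistent k (insert y S) ?\<gamma>))"
    have Z: "0 < ?Z" using label_count_pos[OF v] by (simp add: label_count_def)
    have Sk: "card S < k" using cS m by linarith
    have fresh: "?Z * (real s - card ?g - card S / (real k - card S)) \<le> ?Z' * (real n - card S)"
      unfolding cons using card_fresh_nbr[OF k D(7,1) x Sk yn, of \<gamma>] by (simp add: group_def)
    have gm: "real (card ?g) \<le> 2 * real m" using card_group[OF D(7), of \<gamma> x] cS by linarith
    have rS: "real (card S) \<le> 2 * real m" using of_nat_mono[OF cS, where 'a=real] by simp
    have "card S / (real k - card S) \<le> 2 * real m / (real k - 2 * real m)"
      using rS m Sk by (intro frac_le) auto
    also have "\<dots> \<le> lam * (real s - 2 * real m)"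
    proof -
      have "0 < real k - 2 * real m" using m by linarith
      then show ?thesis using bound by (simp add: divide_le_eq mult_ac)
    qed
    also have "\<dots> \<le> lam * (real s - card ?g)" using gm lam by (intro mult_left_mono) auto
    finally have *: "card S / (real k - card S) \<le> lam * (real s - card ?g)" .
    then have ratio: "(1 - lam) * (real s - card ?g) \<le> real s - card ?g - card S / (real k - card S)"
      by (simp add: algebra_simps)
    have sg: "0 < real s - card ?g" using gm m by linarith
    have ne: "consistent k (insert y S) ?\<gamma> \<noteq> {}"
    proof
      assume "consistent k (insert y S) ?\<gamma> = {}"
      then have "?Z' = 0" by (simp only: card.empty of_nat_0)
      moreover have "0 < (1 - lam) * (real s - card ?g)" using sg lam by simp
      then have "0 < ?Z * (real s - card ?g - card S / (real k - card S))"
        using Z ratio by (intro mult_pos_pos) linarith+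
      ultimately show False using fresh by simp
    qed
    have valid: "group_valid k m (insert y S, ?\<gamma>, F) (b - 1)"
    proof (rule group_validI)
      show "insert y S \<subseteq> {..<n}" using D(1) yn by blast
      show "?\<gamma> ` insert y S \<subseteq> insert y S" using D(2) x by auto
      show "card (insert y S) + 2 * (b - 1) \<le> 2 * m" using D(3,7) b yn by simp
      show "card F + (b - 1) \<le> m" using D(4) by linarith
      show "F \<subseteq> {(u, v). u \<in> insert y S \<and> v \<in> insert y S \<and> ?\<gamma> u \<noteq> ?\<gamma> v}"
      proof
        fix p assume "p \<in> F"
        then obtain u v where p: "p = (u, v)" "u \<in> S" "v \<in> S" "\<gamma> u \<noteq> \<gamma> v" using D(5) by blast
        moreover have "u \<noteq> y" "v \<noteq> y" using p yn by auto
        ultimately show "p \<in> {(u, v). u \<in> insert y S \<and> v \<in> insert y S \<and> ?\<gamma> u \<noteq> ?\<gamma> v}" by simp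
      qed
    qed (rule ne)
    have sub: "labellings k (insert y S, ?\<gamma>, F) \<subseteq> labellings k (S, \<gamma>, F)"
      unfolding labellings_def using cons by auto
    have "(1 - lam) * label_count k (S, \<gamma>, F) * pmf (group_ideal (S, \<gamma>, F) (RandNbr x)) (VertexAns y)
        \<le> label_count k (insert y S, ?\<gamma>, F) * pmf (respond (hg k \<sigma>) S (RandNbr x)) (VertexAns y)"
      if \<sigma>: "\<sigma> \<in> labellings k (insert y S, ?\<gamma>, F)" for \<sigma>
    proof -
      have \<sigma>: "\<sigma> \<in> consistent k S \<gamma>" "same_block \<sigma> x y"
        using labellingsD[OF \<sigma>] unfolding cons by auto
      have "y \<in> nbrs (hg k \<sigma>) x" unfolding nbrs_relabel(1)[OF k \<sigma>(1) x] using \<sigma>(2) x yn by auto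
      note r = r[OF \<sigma>(1) this]
      have nS: "0 < real n - card S" using cSn by simp
      have "(1 - lam) * ?Z * pmf (nbr_ideal S \<gamma> x) y
          \<le> (1 - lam) * ?Z * ((real s - card ?g) / ((real s - 1) * (real n - card S)))"
        using props(3)[OF 2] lam Z by (intro mult_left_mono) auto
      also have "\<dots> = ?Z * ((1 - lam) * (real s - card ?g)) / ((real s - 1) * (real n - card S))"
        by simp
      also have "\<dots> \<le> ?Z * (real s - card ?g - card S / (real k - card S)) / ((real s - 1) * (real n - card S))"
        using ratio Z s1 nS by (intro divide_right_mono mult_left_mono) auto
      also have "\<dots> \<le> ?Z' * (real n - card S) / ((real s - 1) * (real n - card S))"
        using fresh s1 nS by (intro divide_right_mono) auto
      also have "\<dots> = ?Z' * (1 / (real s - 1))" using nS by simp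
      finally show ?thesis unfolding r ideal by (simp add: label_count_def)
    qed
    then show ?thesis unfolding faithful_step_def step using valid sub by auto
  qed
qed

text \<open>The ideal answer is deterministic. Within a group it is always right. Between groups the
  new state drops the labellings for which it is wrong, while \<open>label_count\<close> does not
  change, so the loss appears not here but in \<open>mu\<close>.\<close>

lemma faithful_pair:
  assumes k: "k \<le> N" and lam: "0 \<le> lam"
    and v: "group_valid k m (S, \<gamma>, F) b" and b: "1 \<le> b" and xy: "x \<in> S" "y \<in> S"
  shows "faithful_step k m lam (S, \<gamma>, F) b (PairQuery x y) (BoolAns (x \<noteq> y \<and> \<gamma> x = \<gamma> y))"
proof (cases "\<gamma> x = \<gamma> y")
  case True
  show ?thesis
  proof (rule faithful_same[OF v lam])
    show "group_step (S, \<gamma>, F) (PairQuery x y) (BoolAns (x \<noteq> y \<and> \<gamma> x = \<gamma> y)) = (S, \<gamma>, F)"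
      using True by (simp add: group_step_def)
    fix \<sigma> assume \<sigma>: "\<sigma> \<in> consistent k S \<gamma>"
    have "same_block \<sigma> x y" unfolding same_block_def
      by (rule consistentD(3)[OF \<sigma> xy True])
    then show "pmf (group_ideal (S, \<gamma>, F) (PairQuery x y)) (BoolAns (x \<noteq> y \<and> \<gamma> x = \<gamma> y))
       \<le> pmf (respond (hg k \<sigma>) S (PairQuery x y)) (BoolAns (x \<noteq> y \<and> \<gamma> x = \<gamma> y))"
      using xy True by (simp add: group_ideal_def respond_def pair_relabel[OF k \<sigma> xy(1)])
  qed simp
next
  case False
  note D = group_validD[OF v]
  have step: "group_step (S, \<gamma>, F) (PairQuery x y) (BoolAns (x \<noteq> y \<and> \<gamma> x = \<gamma> y)) = (S, \<gamma>, insert (x, y) F)"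
    using False xy by (simp add: group_step_def)
  have valid: "group_valid k m (S, \<gamma>, insert (x, y) F) (b - 1)"
  proof (rule group_validI)
    have "card (insert (x, y) F) \<le> Suc (card F)" by (rule card_insert_le_m1) auto
    then show "card (insert (x, y) F) + (b - 1) \<le> m" using D(4) b by linarith
    show "card S + 2 * (b - 1) \<le> 2 * m" using D(3) by linarith
    show "insert (x, y) F \<subseteq> {(u, v). u \<in> S \<and> v \<in> S \<and> \<gamma> u \<noteq> \<gamma> v}" using D(5) xy False by blast
  qed (rule D)+
  have "pmf (respond (hg k \<sigma>) S (PairQuery x y)) (BoolAns (x \<noteq> y \<and> \<gamma> x = \<gamma> y)) = 1"
    if "\<sigma> \<in> labellings k (S, \<gamma>, insert (x, y) F)" for \<sigma>
  proof -
    have "\<not> same_block \<sigma> x y" using that by (simp add: labellings_def)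
    then show ?thesis using xy False
      by (simp add: respond_def pair_relabel[OF k labellingsD[OF that] xy(1)])
  qed
  moreover have "(1 - lam) * label_count k (S, \<gamma>, F) * pmf p a \<le> label_count k (S, \<gamma>, F)" for p :: "answer pmf" and a
  proof -
    have "(1 - lam) * (label_count k (S, \<gamma>, F) * pmf p a) \<le> 1 * (label_count k (S, \<gamma>, F) * pmf p a)"
      using lam label_count_pos[OF v] by (intro mult_right_mono) auto
    also have "\<dots> \<le> label_count k (S, \<gamma>, F) * 1"
      using label_count_pos[OF v] by (simp add: pmf_le_1)
    finally show ?thesis by (simp add: mult.assoc)
  qed
  ultimately show ?thesis unfolding faithful_step_def step using valid
    by (auto simp: labellings_def label_count_def)
qed

text \<open>\<open>mu\<close> pays for \<open>F\<close>: by \<open>card_collision\<close> each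
  recorded pair excludes at most a fraction \<open>1 / (k - 2 * m)\<close> of the consistent
  permutations, and there are at most \<open>m\<close> pairs.\<close>

lemma hidden_labels:
  fixes lam mu :: real
  assumes k: "k \<le> N" and m: "2 * m < k" "2 * m < s" and lam: "0 \<le> lam" "lam < 1"
    and mu: "0 \<le> mu" "m \<le> mu * (real k - 2 * real m)"
    and edge: "(1 - lam) * (k * (s choose 2) + n) \<le> k * (s choose 2) - 2 * real m * (real s - 1)"
    and nbr: "2 * real m \<le> lam * (real k - 2 * real m) * (real s - 2 * real m)"
  shows "hidden_graph (hg k) group_ideal group_step fst (labellings k) (label_count k)
           (group_valid k m) pair_queries lam mu"
proof
  show "finite (labellings k x)" for x
    using finite_consistent by (cases x) (simp add: labellings_def)
  show "0 \<le> lam" "0 \<le> mu" by fact+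
  show "0 < label_count k x" if "group_valid k m x b" for x b using that by (rule label_count_pos)
  show "(1 - mu) * label_count k x \<le> real (card (labellings k x))" if "group_valid k m x b" for x b
  proof -
    obtain S \<gamma> F where x: "x = (S, \<gamma>, F)" by (cases x)
    note v = that[unfolded x]
    note D = group_validD[OF v]
    let ?C = "consistent k S \<gamma>"
    let ?hit = "\<lambda>p. {\<sigma> \<in> ?C. same_block \<sigma> (fst p) (snd p)}"
    have kS: "0 < real k - 2 * real m" using m by linarith
    have hit: "real (card (?hit p)) \<le> card ?C / (real k - 2 * real m)" if "p \<in> F" for p
    proof -
      have p: "fst p \<in> S" "snd p \<in> S" "\<gamma> (fst p) \<noteq> \<gamma> (snd p)" using D(5) that by auto
      have "card (?hit p) * (k - card S) \<le> card ?C"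
        by (rule card_collision[where \<gamma>=\<gamma>, OF k D(7) p])
      moreover have "k - 2 * m \<le> k - card S" using D(3) by linarith
      ultimately have "card (?hit p) * (k - 2 * m) \<le> card ?C"
        by (meson le_trans mult_le_mono2)
      from of_nat_mono[OF this, where 'a=real]
      show ?thesis using kS m by (simp add: of_nat_diff field_simps)
    qed
    have "?C \<subseteq> labellings k x \<union> (\<Union>p\<in>F. ?hit p)"
      by (auto simp: labellings_def x)
    then have "card ?C \<le> card (labellings k x \<union> (\<Union>p\<in>F. ?hit p))"
      using D(8) finite_consistent by (intro card_mono) (auto simp: labellings_def x)
    also have "\<dots> \<le> card (labellings k x) + card (\<Union>p\<in>F. ?hit p)" by (rule card_Un_le)
    also have "\<dots> \<le> card (labellings k x) + (\<Sum>p\<in>F. card (?hit p))"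
      by (intro add_left_mono card_UN_le D(8))
    finally have "real (card ?C) \<le> card (labellings k x) + (\<Sum>p\<in>F. real (card (?hit p)))"
      using of_nat_mono[where 'a=real] by fastforce
    moreover have "(\<Sum>p\<in>F. real (card (?hit p))) \<le> (\<Sum>p\<in>F. card ?C / (real k - 2 * real m))"
      by (rule sum_mono[OF hit])
    moreover have "(\<Sum>p\<in>F. card ?C / (real k - 2 * real m)) = card F * (card ?C / (real k - 2 * real m))" by simp
    moreover have "card F * (card ?C / (real k - 2 * real m)) \<le> mu * card ?C"
    proof -
      have "real (card F) \<le> mu * (real k - 2 * real m)" using D(4) mu(2) by linarith
      then have "card F * real (card ?C) \<le> mu * (real k - 2 * real m) * card ?C"
        by (intro mult_right_mono) auto
      then show ?thesis using kS by (simp add: field_simps)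
    qed
    ultimately have "real (card ?C) \<le> card (labellings k x) + mu * card ?C" by linarith
    then show ?thesis by (simp add: x label_count_def algebra_simps)
  qed
  fix x b q
  assume v: "group_valid k m x b" and q: "q \<in> pair_queries" and c: "query_cost q \<le> b"
  obtain S \<gamma> F where x: "x = (S, \<gamma>, F)" by (cases x)
  note v = v[unfolded x]
  note D = group_validD[OF v]
  have cost: "query_cost q = 1" using q by (auto simp: pair_queries_def basic_queries_def)
  then have b: "1 \<le> b" using c by simp
  have cS: "card S \<le> 2 * m" using D(3) by linarith
  have "N * 1 \<le> N * s" using s by (intro mult_le_mono2) simp
  then have kn: "k + 2 \<le> n" using k n by linarith
  have cSn: "card S < n" "card S < s" using cS m kn by linarith+
  let ?W = "{e. e \<subseteq> {..<n} - S \<and> card e = 2}"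
  have fW: "finite ?W" by (rule finite_subset[of _ "Pow {..<n}"]) auto
  have neW: "?W \<noteq> {}"
  proof -
    have "2 \<le> card ({..<n} - S)" using cS m kn D(1,7) by (simp add: card_Diff_subset)
    then obtain e where "e \<subseteq> {..<n} - S" "card e = 2" by (meson obtain_subset_with_card_n)
    then show ?thesis by blast
  qed
  have "finite (set_pmf (group_ideal x q)) \<and>
      (\<forall>a\<in>set_pmf (group_ideal x q). faithful_step k m lam x b q a)"
  proof (cases "query_args q \<subseteq> S")
    case False
    then have 1: "group_ideal x q = return_pmf Refused" by (simp add: group_ideal_def x)
    have "faithful_step k m lam (S, \<gamma>, F) b q Refused"
      by (rule faithful_same[OF v lam(1)])
        (use False in \<open>simp_all add: group_step_def group_ideal_def respond_def\<close>)
    then show ?thesis unfolding 1 by (simp add: x)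
  next
    case True
    from q consider "q = RandEdge" | u where "q = RandNbr u" | u where "q = Degree u"
      | u w where "q = PairQuery u w"
      by (auto simp: pair_queries_def basic_queries_def)
    then show ?thesis
    proof cases
      case 1
      then have "set_pmf (group_ideal x q) = EdgeAns ` ?W"
        using fW neW by (simp add: group_ideal_def x)
      then show ?thesis using fW faithful_rand_edge[OF k m(1) less_imp_le[OF lam(2)] edge v b] 1
        by (auto simp: x)
    next
      case 2
      then have u: "u \<in> S" using True by simp
      have "set_pmf (nbr_ideal S \<gamma> u) \<subseteq> {..<n}"
        using nbr_ideal_props(1)[OF D(7,1) u cSn, of \<gamma>] D(1) by (auto simp: group_def)
      then have "finite (set_pmf (nbr_ideal S \<gamma> u))" by (rule finite_subset) simp
      moreover have "set_pmf (group_ideal x q) = VertexAns ` set_pmf (nbr_ideal S \<gamma> u)"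
        using 2 u by (simp add: group_ideal_def x)
      ultimately show ?thesis using faithful_rand_nbr[OF k m lam nbr v b u] 2
        by (auto simp: x)
    next
      case 3
      then have u: "u \<in> S" using True by simp
      have 1: "group_ideal x q = return_pmf (NumberAns (s - 1))" using 3 u by (simp add: group_ideal_def x)
      have "faithful_step k m lam (S, \<gamma>, F) b q (NumberAns (s - 1))"
        by (rule faithful_same[OF v lam(1)])
          (use u 3 in \<open>simp_all add: group_step_def group_ideal_def respond_def nbrs_relabel(2)[OF k _ u]\<close>)
      then show ?thesis unfolding 1 by (simp add: x)
    next
      case 4
      then have u: "u \<in> S" "w \<in> S" using True by auto
      have 1: "group_ideal x q = return_pmf (BoolAns (u \<noteq> w \<and> \<gamma> u = \<gamma> w))"
        using 4 u by (simp add: group_ideal_def x)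
      show ?thesis unfolding 1 using faithful_pair[OF k lam(1) v b u] 4 by (simp add: x)
    qed
  qed
  then have fin: "finite (set_pmf (group_ideal x q))"
    and ok: "\<And>a. a \<in> set_pmf (group_ideal x q) \<Longrightarrow> faithful_step k m lam x b q a" by auto
  show "finite (set_pmf (group_ideal x q))" by (rule fin)
  fix a assume "a \<in> set_pmf (group_ideal x q)"
  note ok = ok[OF this, unfolded faithful_step_def]
  show "group_valid k m (group_step x q a) (b - query_cost q)"
    "fst (group_step x q a) = fst x \<union> revealed a"
    "labellings k (group_step x q a) \<subseteq> labellings k x"
    using ok cost by auto
  fix \<sigma> assume "\<sigma> \<in> labellings k (group_step x q a)"
  then show "(1 - lam * query_cost q) * label_count k x * pmf (group_ideal x q) a
     \<le> label_count k (group_step x q a) * pmf (respond (hg k \<sigma>) (fst x) q) a"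
    using ok cost by simp
qed

end

context block_params
begin

abbreviation start :: groups where "start \<equiv> ({}, id, {})"

lemma start_labellings: "labellings k start = {\<sigma>. \<sigma> permutes {..<n}}"
  by (simp add: labellings_def consistent_def)

lemma label_count_start: "real (card (labellings k start)) = label_count k start"
  by (simp add: labellings_def label_count_def)

lemma start_valid: "group_valid k m start m"
proof (rule group_validI)
  have "id \<in> consistent k {} id" by (simp add: consistent_def permutes_id)
  then show "consistent k {} id \<noteq> {}" by blast
qed auto

lemma hg_in_graphs:
  assumes "k \<le> N" "\<sigma> permutes {..<n}"
  shows "hg k \<sigma> \<in> graphs n" "avg_degree (hg k \<sigma>) = avg_degree (bg {..<k})"
proof -
  have "{..<k} \<subseteq> {..<N}" using assms(1) by auto
  then show "hg k \<sigma> \<in> graphs n"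
    using assms(2) by (intro relabel_in_graphs bg_in_graphs) (simp_all add: block_graph_def)
  show "avg_degree (hg k \<sigma>) = avg_degree (bg {..<k})"
    by (rule avg_degree_relabel[OF permutes_bij[OF assms(2)]])
qed

end

text \<open>Blocks of size about \<open>max D (sqrt n)\<close>, up to a constant, make
  \<open>n / s\<close> at most of the order of \<open>s\<close>, so a budget \<open>m\<close> of
  order \<open>n / s\<close> is small against both \<open>s\<close> and the number \<open>k\<close>
  of cliques. Over the run star edges then cost about \<open>m / s\<close> and pair tests about
  \<open>m / k\<close>.\<close>

theorem pair_query_lower_bound:
  fixes \<gamma> :: real
  assumes \<gamma>: "1 \<le> \<gamma>"
  shows "\<exists>\<kappa>>0. \<exists>K\<ge>1. \<exists>n\<^sub>0. \<forall>n\<ge>n\<^sub>0. \<forall>A. estimator pair_queries \<gamma> n A \<longrightarrow>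
        (\<forall>D. 1 \<le> D \<and> D \<le> real n - 1 \<longrightarrow>
          (\<exists>G\<in>graphs n.
             max D (sqrt (real n)) / K \<le> avg_degree G \<and>
             avg_degree G \<le> K * max D (sqrt (real n)) \<and>
             needs_cost A G (\<kappa> * min (sqrt (real n)) (real n / avg_degree G))))"
proof -
  define K where "K = nat \<lceil>4 * \<gamma>\<^sup>2\<rceil> + 2"
  define c where "c = real K"
  \<comment> \<open>Makes \<open>2048 * \<kappa> * c ^ 3\<close> equal to
    \<open>1 / (128 * c)\<close>, which is \<theta> below.\<close>
  define \<kappa> where "\<kappa> = 1 / (262144 * c ^ 4)"
  \<comment> \<open>\<open>L \<le> d\<close> gives
    \<open>s > 8 * \<gamma>\<^sup>2 + 3 + 64 * c\<close>: the first part serves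
    \<open>degree_gap\<close>, the last one \<open>lam < 1\<close>.\<close>
  define L where "L = 8 * c * (8 * \<gamma>\<^sup>2 + 4 + 64 * c)"
  have K2: "2 \<le> K" and K\<gamma>: "4 * \<gamma>\<^sup>2 \<le> c" unfolding c_def K_def by linarith+
  have c2: "2 \<le> c" using K2 by (simp add: c_def)
  have \<kappa>: "0 < \<kappa>" using c2 by (simp add: \<kappa>_def)
  have main: "\<exists>G\<in>graphs n.
             max D (sqrt (real n)) / (96 * c\<^sup>2) \<le> avg_degree G \<and>
             avg_degree G \<le> 96 * c\<^sup>2 * max D (sqrt (real n)) \<and>
             needs_cost A G (\<kappa> * min (sqrt (real n)) (real n / avg_degree G))"
    if n: "nat \<lceil>L ^ 2\<rceil> \<le> n" and A: "estimator pair_queries \<gamma> n A" and D: "1 \<le> D" "D \<le> real n - 1"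
    for n A D
  proof (rule ccontr)
    assume neg: "\<not> ?thesis"
    define d where "d = max D (sqrt (real n))"
    have n1: "1 \<le> n" using D by linarith
    have "L\<^sup>2 \<le> n" using n by linarith
    moreover have "0 \<le> L" using c2 by (simp add: L_def)
    ultimately have "L \<le> sqrt n" using real_le_rsqrt by simp
    then have dL: "L \<le> d" by (simp add: d_def)
    have dn: "sqrt n \<le> d" "d \<le> n"
    proof -
      have "sqrt n * 1 \<le> sqrt n * sqrt n" using n1 by (intro mult_left_mono) auto
      then show "d \<le> n" using D by (simp add: d_def)
    qed (simp add: d_def)
    define s where "s = nat \<lfloor>d / (8 * c)\<rfloor>"
    have "0 \<le> d / (8 * c)" using dL \<open>0 \<le> L\<close> c2 by simp
    then have s': "real s \<le> d / (8 * c)" "d / (8 * c) < real s + 1" unfolding s_def by linarith+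
    have "8 * \<gamma>\<^sup>2 + 4 + 64 * c \<le> d / (8 * c)" using dL c2 by (simp add: L_def field_simps)
    then have s_large: "8 * \<gamma>\<^sup>2 + 3 + 64 * c < real s" using s' by linarith
    have sd: "8 * c * real s \<le> d" "d < 8 * c * (real s + 1)" using s' c2 by (simp_all add: field_simps)
    have \<gamma>2: "0 \<le> \<gamma>\<^sup>2" by simp
    have s3: "3 \<le> real s" "64 * c < real s" using s_large \<gamma>2 c2 by linarith+
    have "4 * c * real s \<le> real n"
    proof -
      have "0 \<le> c * real s" using c2 by simp
      then show ?thesis using sd dn by linarith
    qed
    then have sK: "4 * K * s \<le> n" unfolding c_def by (metis of_nat_le_iff of_nat_mult of_nat_numeral)
    define N where "N = n div s - 1"
    define k where "k = N div K"
    interpret two_scales n s N K k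
      by unfold_locales (use K2 sK s3 N_def k_def in linarith)+
    have s0: "0 < real s" using s3 by simp
    have k0: "1 \<le> real k" using k_pos by simp
    have kn: "real n \<le> 4 * c * (real k * s)"
      using of_nat_mono[OF n_le_k, where 'a=real] by (simp add: c_def)
    have n_s: "real n \<le> 256 * c\<^sup>2 * (real s)\<^sup>2"
    proof -
      have "8 * c * (real s + 1) \<le> 8 * c * (2 * real s)" using s3 c2 by (intro mult_left_mono) auto
      then have "sqrt n \<le> 16 * c * real s" using dn(1) sd(2) by (simp add: algebra_simps)
      then have "(sqrt n)\<^sup>2 \<le> (16 * c * real s)\<^sup>2" by (intro power_mono) auto
      then show ?thesis by (simp add: power_mult_distrib)
    qed
    \<comment> \<open>Every graph of both families has average degree at least
      \<open>(s - 1) / (4 * c)\<close>, so \<beta> bounds the claimed cost for all of them and a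
      single budget \<open>m\<close> serves both.\<close>
    define \<beta> where "\<beta> = \<kappa> * (n * (4 * c / (real s - 1)))"
    define m where "m = nat \<lfloor>\<beta>\<rfloor>"
    have "0 \<le> \<beta>" using \<kappa> c2 s3 by (simp add: \<beta>_def)
    then have m: "real m \<le> \<beta>" "\<beta> \<le> real m + 1" unfolding m_def by linarith+
    define \<theta> where "\<theta> = 1 / (128 * c)"
    have \<theta>: "0 < \<theta>" "\<theta> \<le> 1/256" "c * \<theta> = 1/128" using c2 by (simp_all add: \<theta>_def field_simps)
    have \<beta>_le: "\<beta> * s \<le> 8 * \<kappa> * c * n"
    proof -
      have "s / (real s - 1) \<le> 2" using s3 by (simp add: field_simps)
      then have "4 * \<kappa> * c * n * (s / (real s - 1)) \<le> 4 * \<kappa> * c * n * 2"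
        using \<kappa> c2 by (intro mult_left_mono) auto
      then show ?thesis by (simp add: \<beta>_def algebra_simps)
    qed
    have mk: "real m \<le> \<theta> * k"
    proof -
      have "\<beta> * s \<le> 8 * \<kappa> * c * (4 * c * (real k * s))"
        using \<beta>_le kn \<kappa> c2 by (meson mult_left_mono mult_nonneg_nonneg less_imp_le order_trans zero_le_numeral of_nat_0_le_iff c_def)
      then have "\<beta> * s \<le> (32 * \<kappa> * c\<^sup>2 * k) * s" by (simp add: power2_eq_square algebra_simps)
      then have "\<beta> \<le> 32 * \<kappa> * c\<^sup>2 * k" using s0 by simp
      also have "\<dots> \<le> \<theta> * k"
      proof (intro mult_right_mono)
        have "32 * \<kappa> * c\<^sup>2 = 1 / (8192 * c\<^sup>2)" using c2 by (simp add: \<kappa>_def power2_eq_square power4_eq_xxxx)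
        also have "\<dots> \<le> \<theta>" unfolding \<theta>_def
        proof (intro divide_left_mono)
          have "c * 1 \<le> c * c" using c2 by (intro mult_left_mono) auto
          then show "128 * c \<le> 8192 * c\<^sup>2" using c2 by (simp add: power2_eq_square)
        qed (use c2 in auto)
        finally show "32 * \<kappa> * c\<^sup>2 \<le> \<theta>" .
      qed simp
      finally show ?thesis using m(1) by linarith
    qed
    have ms: "real m \<le> \<theta> * s"
    proof -
      have "8 * \<kappa> * c * n \<le> 8 * \<kappa> * c * (256 * c\<^sup>2 * (real s)\<^sup>2)"
        using n_s \<kappa> c2 by (intro mult_left_mono) auto
      also have "\<dots> = (2048 * \<kappa> * c ^ 3) * (real s)\<^sup>2" by (simp add: power2_eq_square power3_eq_cube)
      also have "2048 * \<kappa> * c ^ 3 = \<theta>"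
        using c2 by (simp add: \<kappa>_def \<theta>_def power3_eq_cube power4_eq_xxxx)
      finally have "\<beta> * s \<le> (\<theta> * s) * s" using \<beta>_le by (simp add: power2_eq_square)
      then have "\<beta> \<le> \<theta> * s" using s0 by simp
      then show ?thesis using m(1) by linarith
    qed
    have quarter: "real m \<le> k / 256" "real m \<le> real s / 256"
      using mk ms \<theta>(2) k0 s0 mult_right_mono[OF \<theta>(2), of "real k"] mult_right_mono[OF \<theta>(2), of "real s"]
      by linarith+
    have mk2: "2 * m < k" using quarter k0 by linarith
    have ms2: "2 * m < s" using quarter s3 by linarith
    let ?C = "real (s choose 2)"
    have C: "(real s)\<^sup>2 / 4 \<le> ?C"
    proof -
      have "real s * (real s / 2) \<le> real s * (real s - 1)" using s3 by (intro mult_left_mono) auto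
      then show ?thesis using real_choose_two[of s] by (simp add: power2_eq_square)
    qed
    have C0: "0 < ?C" using C s0 by (smt (verit) divide_pos_pos zero_less_power)
    \<comment> \<open>The first term is the share of star edges. The second covers edges that meet
      revealed labels and neighbours lost to collisions; the latter require the 8, since
      \<open>k - 2 * m\<close> and \<open>s - 2 * m\<close> are bounded below by
      \<open>k / 2\<close> and \<open>s / 2\<close> only.\<close>
    define lam where "lam = n / (k * ?C) + 8 * m / (real k * s)"
    define mu where "mu = 2 * real m / k"
    have lam0: "0 \<le> lam" by (simp add: lam_def)
    have nkC: "n / (k * ?C) \<le> 16 * c / s"
    proof -
      have "n * real s \<le> 4 * c * (real k * s) * s" using kn by (intro mult_right_mono) auto
      also have "\<dots> = 16 * c * (k * ((real s)\<^sup>2 / 4))" by (simp add: power2_eq_square)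
      also have "\<dots> \<le> 16 * c * (k * ?C)" using C c2 by (intro mult_left_mono) auto
      finally show ?thesis using s0 k0 C0 by (simp add: field_simps)
    qed
    have lam1: "lam < 1" and lam_m: "lam * m \<le> 3/16"
    proof -
      have "8 * m / (real k * s) \<le> 8 * (\<theta> * s) / (real k * s)"
        using ms k0 s0 by (intro divide_right_mono) auto
      also have "\<dots> = 8 * \<theta> / k" using s0 by simp
      also have "\<dots> \<le> 8 * \<theta>" using k0 \<theta>(1) by (simp add: field_simps)
      finally have *: "8 * m / (real k * s) \<le> 8 * \<theta>" .
      have "16 * c / s < 1/2" using s3 c2 by (simp add: field_simps)
      then show "lam < 1" using nkC * \<theta>(2) unfolding lam_def by linarith
      have "16 * c / s * m \<le> 16 * c / s * (\<theta> * s)" using ms c2 by (intro mult_left_mono) auto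
      also have "\<dots> = 16 * (c * \<theta>)" using s0 by simp
      finally have 1: "16 * c / s * m \<le> 1/8" unfolding \<theta>(3) by simp
      have "n / (k * ?C) * m \<le> 16 * c / s * m" using nkC by (intro mult_right_mono) auto
      moreover have "8 * m / (real k * s) * m \<le> 1/16"
      proof -
        have "real m * m \<le> (k / 256) * (s / 256)" using quarter by (intro mult_mono) auto
        then have "8 * (real m * m) / (real k * s) \<le> 8 * ((k / 256) * (s / 256)) / (real k * s)"
          by (intro divide_right_mono mult_left_mono) auto
        also have "\<dots> \<le> 1/16" using k0 s0 by simp
        finally show ?thesis by simp
      qed
      ultimately show "lam * m \<le> 3/16" using 1 unfolding lam_def distrib_right by linarith
    qed
    have mu0: "0 \<le> mu" and mu1: "mu \<le> 1/16"
      using quarter k0 by (simp_all add: mu_def field_simps)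
    have params: "(1 - lam) * (j * (s choose 2) + n) \<le> j * (s choose 2) - 2 * real m * (real s - 1)"
      "2 * real m \<le> lam * (real j - 2 * real m) * (real s - 2 * real m)"
      "real m \<le> mu * (real j - 2 * real m)" "2 * m < j"
      if "k \<le> j" for j
    proof -
      have j: "real k \<le> real j" using that by simp
      have "2 * real m * (real s - 1) \<le> 8 * m / (real k * s) * (k * ?C)"
      proof -
        have "8 * m / (real k * s) * (k * ?C) = 4 * m / s * (2 * ?C)" using k0 s0 by simp
        also have "\<dots> = 4 * m * (real s - 1)" unfolding real_choose_two using s0 by simp
        finally show ?thesis using s3 by simp
      qed
      moreover have "real n = n / (k * ?C) * (k * ?C)" using k0 C0 by simp
      ultimately have "n + 2 * real m * (real s - 1) \<le> lam * (k * ?C)"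
        unfolding lam_def distrib_right by linarith
      also have "\<dots> \<le> lam * (j * ?C + n)"
      proof -
        have "k * ?C \<le> j * ?C" using j by (intro mult_right_mono) auto
        then have "k * ?C \<le> j * ?C + n" by linarith
        then show ?thesis using lam0 by (rule mult_left_mono)
      qed
      finally show "(1 - lam) * (j * (s choose 2) + n) \<le> j * (s choose 2) - 2 * real m * (real s - 1)"
        by (simp add: algebra_simps)
      have half: "real k / 2 \<le> real j - 2 * real m" "real s / 2 \<le> real s - 2 * real m"
        using quarter j k0 s0 by linarith+
      have "2 * real m = 8 * m / (real k * s) * (real k / 2 * (real s / 2))" using k0 s0 by simp
      also have "\<dots> \<le> lam * ((real j - 2 * real m) * (real s - 2 * real m))"
        using half k0 s0 by (intro mult_mono) (auto simp: lam_def)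
      finally show "2 * real m \<le> lam * (real j - 2 * real m) * (real s - 2 * real m)"
        by (simp add: mult.assoc)
      have "real m = mu * (real k / 2)" using k0 by (simp add: mu_def)
      also have "\<dots> \<le> mu * (real j - 2 * real m)" using half mu0 by (intro mult_left_mono) auto
      finally show "real m \<le> mu * (real j - 2 * real m)" .
      show "2 * m < j" using mk2 that by linarith
    qed
    note pN = params[OF k_le_N] and pk = params[OF order_refl]
    note 1 = hidden_labels[OF order_refl pN(4) ms2 lam0 lam1 mu0 pN(3) pN(1) pN(2)]
    note 2 = hidden_labels[OF k_le_N pk(4) ms2 lam0 lam1 mu0 pk(3) pk(1) pk(2)]
    have approx: "98/100 \<le> measure_pmf.prob (run (hg j \<sigma>) A)
        {(r, x). r \<in> {avg_degree (bg {..<j}) / \<gamma> .. \<gamma> * avg_degree (bg {..<j})} \<and> x \<le> m}"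
      if \<sigma>: "\<sigma> permutes {..<n}" and j: "j \<le> N"
        and avg: "(real s - 1) / (4 * c) \<le> avg_degree (bg {..<j})" "avg_degree (bg {..<j}) \<le> real s + 1"
      for \<sigma> j
    proof -
      let ?a = "avg_degree (bg {..<j})"
      note G = hg_in_graphs[OF j \<sigma>]
      have a0: "0 < ?a"
      proof -
        have "0 < (real s - 1) / (4 * c)" using s3 c2 by simp
        then show ?thesis using avg by linarith
      qed
      have up: "?a \<le> 96 * c\<^sup>2 * d"
      proof -
        have "1 * d \<le> 96 * c\<^sup>2 * d"
        proof (intro mult_right_mono)
          have "1 \<le> c\<^sup>2" using c2 by (simp add: one_le_power)
          then show "1 \<le> 96 * c\<^sup>2" by linarith
        qed (use dL \<open>0 \<le> L\<close> in linarith)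
        moreover have "2 * real s \<le> 8 * c * real s" using c2 by (intro mult_right_mono) auto
        ultimately show ?thesis using avg(2) sd(1) s3 by linarith
      qed
      \<comment> \<open>The 96 is \<open>8 * 3 * 4\<close>: from \<open>d\<close> to
        \<open>s + 1\<close>, from there to \<open>s - 1\<close>, and from there to the lower bound
        on the average degree.\<close>
      have low: "d / (96 * c\<^sup>2) \<le> ?a"
      proof -
        have "8 * c * (real s + 1) \<le> 8 * c * (3 * (real s - 1))"
          using s3 c2 by (intro mult_left_mono) auto
        then have "d \<le> 8 * c * (3 * (real s - 1))" using sd(2) by linarith
        then have "d / (96 * c\<^sup>2) \<le> 8 * c * (3 * (real s - 1)) / (96 * c\<^sup>2)"
          by (intro divide_right_mono) auto
        also have "\<dots> = (real s - 1) / (4 * c)" using c2 by (simp add: power2_eq_square field_simps)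
        finally show ?thesis using avg by linarith
      qed
      have "\<not> needs_cost A (hg j \<sigma>) (\<kappa> * min (sqrt n) (n / ?a))"
        using neg G up low unfolding d_def by metis
      moreover have "\<kappa> * min (sqrt n) (n / ?a) \<le> real m + 1"
      proof -
        have "n / ?a \<le> n / ((real s - 1) / (4 * c))"
          using avg(1) a0 s3 c2 by (intro divide_left_mono mult_pos_pos) auto
        then have "\<kappa> * min (sqrt n) (n / ?a) \<le> \<kappa> * (n / ((real s - 1) / (4 * c)))"
          using \<kappa> by (intro mult_left_mono) auto
        also have "\<dots> = \<beta>" by (simp add: \<beta>_def)
        finally show ?thesis using m by linarith
      qed
      ultimately have "98/100 \<le> measure_pmf.prob (run (hg j \<sigma>) A)
         {(r, x). r \<in> {avg_degree (hg j \<sigma>) / \<gamma> .. \<gamma> * avg_degree (hg j \<sigma>)} \<and> x \<le> m}"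
        using A G(1) unfolding estimator_def by (intro approximates_and_cheap) auto
      then show ?thesis unfolding G(2) .
    qed
    have "{..<k} \<subseteq> {..<N}" using k_le_N by auto
    note sparse = avg_degree_sparse[OF this card_lessThan]
    note dense = avg_degree_dense[OF order_refl card_lessThan]
    show False
    proof (rule indistinguishable_families[OF 1 2, of start m A
          "{(real s - 1) / 2 / \<gamma>..}" "{..\<gamma> * ((real s - 1) / K + 2)}"])
      show "group_valid N m start m" "group_valid k m start m" by (rule start_valid)+
      show "real (card (labellings N start)) = label_count N start"
        "real (card (labellings k start)) = label_count k start" by (rule label_count_start)+
      fix \<sigma> assume "\<sigma> \<in> labellings N start"
      then have \<sigma>: "\<sigma> permutes {..<n}" by (simp add: start_labellings)
      have "(real s - 1) / (4 * c) \<le> (real s - 1) / 2" using s3 c2 by (intro divide_left_mono) auto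
      then have "98/100 \<le> measure_pmf.prob (run (hg N \<sigma>) A)
        {(r, x). r \<in> {avg_degree (bg {..<N}) / \<gamma> .. \<gamma> * avg_degree (bg {..<N})} \<and> x \<le> m}"
        using dense by (intro approx[OF \<sigma> order_refl]) linarith+
      moreover have "(real s - 1) / 2 / \<gamma> \<le> avg_degree (bg {..<N}) / \<gamma>"
        using dense(1) \<gamma> by (intro divide_right_mono) auto
      ultimately show "98/100 \<le> measure_pmf.prob (run (hg N \<sigma>) A) {(r, x). r \<in> {(real s - 1) / 2 / \<gamma>..} \<and> x \<le> m}"
        by (elim order_trans) (intro measure_pmf.finite_measure_mono, auto)
    next
      fix \<sigma> assume "\<sigma> \<in> labellings k start"
      then have \<sigma>: "\<sigma> permutes {..<n}" by (simp add: start_labellings)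
      have "(real s - 1) / K \<le> (real s - 1) / 1" using s3 K2 by (intro divide_left_mono) auto
      then have "98/100 \<le> measure_pmf.prob (run (hg k \<sigma>) A)
        {(r, x). r \<in> {avg_degree (bg {..<k}) / \<gamma> .. \<gamma> * avg_degree (bg {..<k})} \<and> x \<le> m}"
        using sparse by (intro approx[OF \<sigma> k_le_N]) (simp_all add: c_def)
      moreover have "\<gamma> * avg_degree (bg {..<k}) \<le> \<gamma> * ((real s - 1) / K + 2)"
        using sparse(2) \<gamma> by (intro mult_left_mono) auto
      ultimately show "98/100 \<le> measure_pmf.prob (run (hg k \<sigma>) A)
          {(r, x). r \<in> {..\<gamma> * ((real s - 1) / K + 2)} \<and> x \<le> m}"
        by (elim order_trans) (intro measure_pmf.finite_measure_mono, auto)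
    next
      have "8 * \<gamma>\<^sup>2 < real s - 1" using s_large c2 by linarith
      from degree_gap[OF \<gamma> K\<gamma>[unfolded c_def] this]
      show "{(real s - 1) / 2 / \<gamma>..} \<inter> {..\<gamma> * ((real s - 1) / K + 2)} = {}" by force
      show "mu + lam * m \<le> 1/4" using lam_m mu1 by linarith
      show "uses_only pair_queries A" using A by (simp add: estimator_def)
    qed simp
  qed
  have "1 \<le> 96 * c\<^sup>2"
  proof -
    have "1 \<le> c\<^sup>2" using c2 by (simp add: one_le_power)
    then show ?thesis by linarith
  qed
  then show ?thesis using \<kappa> main by blast
qed

section \<open>Sampling edges and counting between samples\<close>

definition add_cost :: "nat \<Rightarrow> (real \<times> nat) pmf \<Rightarrow> (real \<times> nat) pmf" where
  "add_cost c = map_pmf (\<lambda>(r, k). (r, c + k))"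

lemma add_cost_0 [simp]: "add_cost 0 p = p"
  by (simp add: add_cost_def case_prod_unfold)

lemma add_cost_add_cost [simp]: "add_cost a (add_cost b p) = add_cost (a + b) p"
  by (simp add: add_cost_def pmf.map_comp o_def case_prod_unfold add.assoc)

lemma add_cost_bind: "add_cost a (bind_pmf p f) = bind_pmf p (\<lambda>x. add_cost a (f x))"
  by (simp add: add_cost_def map_bind_pmf)

lemma run_from_Ask: "run_from G (Ask q f) seen =
    bind_pmf (respond G seen q) (\<lambda>a. add_cost (query_cost q) (run_from G (f a) (seen \<union> revealed a)))"
  by (simp add: add_cost_def)

lemma prob_add_cost: "measure_pmf.prob (add_cost a p) {(r, c). P r \<and> c \<le> b}
   = measure_pmf.prob p {(r, c). P r \<and> a + c \<le> b}"
proof -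
  have "(\<lambda>(r, k). (r, a + k)) -` {(r, c). P r \<and> c \<le> b} = {(r, c). P r \<and> a + c \<le> b}" by auto
  then show ?thesis by (simp add: add_cost_def prob_map_pmf)
qed

fun counted :: "graph \<Rightarrow> query \<Rightarrow> nat" where
  "counted G (Degree x) = card (nbrs G x)"
| "counted G (Additive S) = card {e \<in> edges G. e \<subseteq> S}"
| "counted G _ = 0"

text \<open>For a nonadaptive list of deterministic queries. The answers are handed on as a function
  of the query, so that later definitions look them up by content; 0 stands for a query that was not
  asked.\<close>

primrec ask_all :: "query list \<Rightarrow> ((query \<Rightarrow> nat) \<Rightarrow> algorithm) \<Rightarrow> algorithm" where
  "ask_all [] K = K (\<lambda>_. 0)"
| "ask_all (q # qs) K =
     Ask q (\<lambda>a. ask_all qs (\<lambda>\<phi>. K (\<phi>(q := (case a of NumberAns k \<Rightarrow> k | _ \<Rightarrow> 0)))))"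

lemma run_ask_all:
  assumes "set qs \<subseteq> range Degree \<union> range Additive" "\<And>q. q \<in> set qs \<Longrightarrow> query_args q \<subseteq> seen"
  shows "run_from G (ask_all qs K) seen = add_cost (sum_list (map query_cost qs))
     (run_from G (K (\<lambda>q. if q \<in> set qs then counted G q else 0)) seen)"
  using assms
proof (induction qs arbitrary: K)
  case (Cons q qs)
  have "respond G seen q = return_pmf (NumberAns (counted G q))"
    using Cons.prems by (auto simp: respond_def)
  then have "run_from G (ask_all (q # qs) K) seen = add_cost (query_cost q)
      (run_from G (ask_all qs (\<lambda>\<phi>. K (\<phi>(q := counted G q)))) seen)"
    by (simp add: run_from_Ask bind_return_pmf del: run_from.simps(3))
  also have "\<dots> = add_cost (query_cost q) (add_cost (sum_list (map query_cost qs))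
      (run_from G (K ((\<lambda>p. if p \<in> set qs then counted G p else 0)(q := counted G q))) seen))"
    using Cons.prems by (subst Cons.IH) auto
  also have "(\<lambda>p. if p \<in> set qs then counted G p else 0)(q := counted G q)
      = (\<lambda>p. if p \<in> set (q # qs) then counted G p else 0)" by auto
  finally show ?case by simp
qed simp

lemma uses_only_ask_all:
  assumes "set qs \<subseteq> Q" "\<And>\<phi>. uses_only Q (K \<phi>)"
  shows "uses_only Q (ask_all qs K)"
  using assms by (induction qs arbitrary: K) auto

text \<open>Written with a continuation because an \<open>algorithm\<close> returns nothing but a
  number, so the sample has to be passed on to the rest of the tree.\<close>

primrec sample_edges :: "nat \<Rightarrow> (nat set list \<Rightarrow> algorithm) \<Rightarrow> algorithm" where
  "sample_edges 0 K = K []"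
| "sample_edges (Suc b) K = Ask RandEdge (\<lambda>a. sample_edges b (\<lambda>es. K (revealed a # es)))"

lemma run_sample_edges:
  assumes "finite (edges G)" "edges G \<noteq> {}"
  shows "run_from G (sample_edges b K) seen = bind_pmf (replicate_pmf b (pmf_of_set (edges G)))
     (\<lambda>es. add_cost b (run_from G (K es) (seen \<union> \<Union>(set es))))"
proof (induction b arbitrary: K seen)
  case (Suc b)
  have "run_from G (sample_edges (Suc b) K) seen = bind_pmf (pmf_of_set (edges G)) (\<lambda>e.
     add_cost 1 (bind_pmf (replicate_pmf b (pmf_of_set (edges G))) (\<lambda>es.
       add_cost b (run_from G (K (e # es)) (seen \<union> e \<union> \<Union>(set es))))))"
    by (simp add: run_from_Ask respond_def bind_map_pmf Suc.IH del: run_from.simps(3))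
  then show ?case
    by (simp add: add_cost_bind bind_assoc_pmf bind_return_pmf Un_assoc)
qed (simp add: bind_return_pmf)

lemma uses_only_sample_edges:
  assumes "RandEdge \<in> Q" "\<And>es. uses_only Q (K es)"
  shows "uses_only Q (sample_edges b K)"
  using assms by (induction b arbitrary: K) auto

type_synonym batch = "nat set list \<times> nat set list"

primrec sample_batches :: "nat \<Rightarrow> nat \<Rightarrow> (batch list \<Rightarrow> algorithm) \<Rightarrow> algorithm" where
  "sample_batches 0 b K = K []"
| "sample_batches (Suc m) b K = sample_edges b (\<lambda>xs. sample_edges b (\<lambda>ys.
     sample_batches m b (\<lambda>bs. K ((xs, ys) # bs))))"

definition batch_verts :: "batch \<Rightarrow> nat set" where
  "batch_verts = (\<lambda>(xs, ys). \<Union>(set xs) \<union> \<Union>(set ys))"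

definition batch_pmf :: "graph \<Rightarrow> nat \<Rightarrow> batch pmf" where
  "batch_pmf G b = pair_pmf (replicate_pmf b (pmf_of_set (edges G))) (replicate_pmf b (pmf_of_set (edges G)))"

lemma run_sample_batches:
  assumes "finite (edges G)" "edges G \<noteq> {}"
  shows "run_from G (sample_batches m b K) seen = bind_pmf (replicate_pmf m (batch_pmf G b))
     (\<lambda>bs. add_cost (2 * m * b) (run_from G (K bs) (seen \<union> \<Union>(batch_verts ` set bs))))"
proof (induction m arbitrary: K seen)
  case (Suc m)
  have "run_from G (sample_batches (Suc m) b K) seen =
    bind_pmf (replicate_pmf b (pmf_of_set (edges G))) (\<lambda>xs.
    bind_pmf (replicate_pmf b (pmf_of_set (edges G))) (\<lambda>ys.
    bind_pmf (replicate_pmf m (batch_pmf G b)) (\<lambda>bs.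
      add_cost (2 * Suc m * b) (run_from G (K ((xs, ys) # bs))
        (seen \<union> \<Union>(set xs) \<union> \<Union>(set ys) \<union> \<Union>(batch_verts ` set bs))))))"
    by (simp add: run_sample_edges[OF assms] Suc.IH add_cost_bind algebra_simps)
  also have "\<dots> = bind_pmf (replicate_pmf (Suc m) (batch_pmf G b))
     (\<lambda>bs. add_cost (2 * Suc m * b) (run_from G (K bs) (seen \<union> \<Union>(batch_verts ` set bs))))"
    by (simp add: batch_pmf_def[of G b] pair_pmf_def bind_assoc_pmf bind_return_pmf batch_verts_def Un_assoc)
  finally show ?case .
qed (simp add: bind_return_pmf)

lemma uses_only_sample_batches:
  assumes "RandEdge \<in> Q" "\<And>bs. uses_only Q (K bs)"
  shows "uses_only Q (sample_batches m b K)"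
  using assms by (induction m arbitrary: K) (auto intro!: uses_only_sample_edges)

section \<open>Degree sums and edge counts of a fixed graph\<close>

locale simple_graph_without_isolated =
  fixes G :: graph and n :: nat
  assumes G: "G \<in> graphs n" and n: "2 \<le> n"
begin

abbreviation "V \<equiv> verts G"
abbreviation "E \<equiv> edges G"
abbreviation "deg v \<equiv> card (nbrs G v)"
abbreviation "m \<equiv> card E"
abbreviation "d \<equiv> avg_degree G"

definition adj :: "nat \<Rightarrow> nat \<Rightarrow> real" where
  "adj u v = (if {u, v} \<in> E then 1 else 0)"

lemma finite_V: "finite V" and card_V: "card V = n"
  and edge: "e \<in> E \<Longrightarrow> e \<subseteq> V \<and> card e = 2" and no_iso: "v \<in> V \<Longrightarrow> \<exists>e\<in>E. v \<in> e"
  using G by (auto simp: graphs_def simple_graph_def no_isolated_def)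

lemma finite_E: "finite E"
  by (rule finite_subset[of _ "Pow V"]) (use edge finite_V in auto)

lemma V_nonempty: "V \<noteq> {}"
  using card_V n by auto

lemma E_nonempty: "E \<noteq> {}"
  using V_nonempty no_iso by auto

lemma m_pos: "0 < m"
  using finite_E E_nonempty by (simp add: card_gt_0_iff)

lemma adj_sym: "adj u v = adj v u"
  by (simp add: adj_def insert_commute)

lemma nbrs_subset: "nbrs G v \<subseteq> V - {v}"
proof
  fix y assume y: "y \<in> nbrs G v"
  then have e: "{v, y} \<subseteq> V" "card {v, y} = 2" using edge[of "{v, y}"] by (auto simp: nbrs_def)
  then have "v \<noteq> y" by auto
  then show "y \<in> V - {v}" using e by auto
qed

lemma deg_less: "v \<in> V \<Longrightarrow> deg v < n"
  using card_mono[OF _ nbrs_subset[of v]] finite_V card_V n by (simp add: card_Diff_singleton)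

lemma bij_incident: "bij_betw (\<lambda>y. {u, y}) (nbrs G u) {e \<in> E. u \<in> e}"
proof (rule bij_betw_imageI)
  show "inj_on (\<lambda>y. {u, y}) (nbrs G u)" by (auto simp: inj_on_def doubleton_eq_iff)
  show "(\<lambda>y. {u, y}) ` nbrs G u = {e \<in> E. u \<in> e}"
  proof (intro set_eqI iffI)
    fix e assume e: "e \<in> {e \<in> E. u \<in> e}"
    then obtain y where "e = {u, y}" using edge[of e] by (auto simp: card_2_iff)
    then show "e \<in> (\<lambda>y. {u, y}) ` nbrs G u" using e by (auto simp: nbrs_def)
  qed (auto simp: nbrs_def)
qed

lemma sum_incident: "(\<Sum>e\<in>{e \<in> E. u \<in> e}. \<psi> e) = (\<Sum>y\<in>nbrs G u. \<psi> {u, y})"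
  using sum.reindex_bij_betw[OF bij_incident[of u], of \<psi>] by simp

lemma card_incident: "card {e \<in> E. u \<in> e} = deg u"
  using bij_betw_same_card[OF bij_incident[of u]] by simp

lemma deg_pos: "v \<in> V \<Longrightarrow> 1 \<le> deg v"
proof -
  assume "v \<in> V"
  then have "{e \<in> E. v \<in> e} \<noteq> {}" using no_iso by auto
  then have "0 < card {e \<in> E. v \<in> e}" using finite_E by (simp add: card_gt_0_iff)
  then show ?thesis using card_incident by simp
qed

text \<open>Exchanges edges and endpoints. If \<phi> depends on the vertex only, this expresses that
  an endpoint of a random edge is biased in proportion to its degree.\<close>

lemma sum_over_edges:
  fixes \<phi> :: "nat set \<Rightarrow> nat \<Rightarrow> real"
  shows "(\<Sum>e\<in>E. \<Sum>v\<in>e. \<phi> e v) = (\<Sum>v\<in>V. \<Sum>e\<in>{e \<in> E. v \<in> e}. \<phi> e v)"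
proof -
  have "(\<Sum>e\<in>E. \<Sum>v\<in>e. \<phi> e v) = (\<Sum>e\<in>E. \<Sum>v\<in>{v \<in> V. v \<in> e}. \<phi> e v)"
  proof (rule sum.cong[OF refl])
    fix e assume "e \<in> E"
    then have "{v \<in> V. v \<in> e} = e" using edge by blast
    then show "(\<Sum>v\<in>e. \<phi> e v) = (\<Sum>v\<in>{v \<in> V. v \<in> e}. \<phi> e v)" by simp
  qed
  then show ?thesis using sum.swap_restrict[OF finite_E finite_V, of \<phi> "\<lambda>e v. v \<in> e"] by simp
qed

lemma sum_over_edges_deg:
  fixes \<phi> :: "nat \<Rightarrow> real"
  shows "(\<Sum>e\<in>E. \<Sum>v\<in>e. \<phi> v) = (\<Sum>v\<in>V. deg v * \<phi> v)"
  by (simp add: sum_over_edges card_incident)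

lemma sum_adj:
  fixes \<psi> :: "nat \<Rightarrow> real"
  assumes "finite X" "nbrs G u \<subseteq> X"
  shows "(\<Sum>v\<in>X. adj u v * \<psi> v) = (\<Sum>v\<in>nbrs G u. \<psi> v)"
proof -
  have "(\<Sum>v\<in>X. adj u v * \<psi> v) = (\<Sum>v\<in>X \<inter> {v. {u, v} \<in> E}. \<psi> v)"
    using assms(1) by (simp add: adj_def sum.If_cases if_distrib[of "\<lambda>x. x * _"] cong: if_cong)
  moreover have "X \<inter> {v. {u, v} \<in> E} = nbrs G u" using assms(2) by (auto simp: nbrs_def)
  ultimately show ?thesis by simp
qed

lemma sum_adj_V: "(\<Sum>v\<in>V. adj u v * \<psi> v) = (\<Sum>v\<in>nbrs G u. \<psi> v)"
  using nbrs_subset by (intro sum_adj finite_V) auto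

lemma sum_deg: "(\<Sum>v\<in>V. real (deg v)) = 2 * m"
proof -
  have "(\<Sum>v\<in>V. real (deg v)) = (\<Sum>e\<in>E. \<Sum>v\<in>e. 1)" using sum_over_edges_deg[of "\<lambda>_. 1"] by simp
  also have "\<dots> = (\<Sum>e\<in>E. 2)" using edge by (intro sum.cong) auto
  finally show ?thesis by simp
qed

lemma d_eq: "d = 2 * m / n"
  using card_V by (simp add: avg_degree_def)

lemma d_ge_1: "1 \<le> d"
proof -
  have "(\<Sum>v\<in>V. 1) \<le> (\<Sum>v\<in>V. real (deg v))" using deg_pos by (intro sum_mono) fastforce
  then show ?thesis unfolding sum_deg d_eq using card_V n by simp
qed

lemma d_less: "d \<le> n"
proof -
  have "(\<Sum>v\<in>V. real (deg v)) \<le> (\<Sum>v\<in>V. real n)" using deg_less by (intro sum_mono) fastforce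
  then have "2 * real m \<le> n * n" unfolding sum_deg using card_V by simp
  then show ?thesis unfolding d_eq using n by (simp add: field_simps)
qed

lemma two_m: "2 * real m = n * d"
  unfolding d_eq using n by simp

abbreviation "induced S \<equiv> real (counted G (Additive S))"

definition cross :: "nat set \<Rightarrow> nat set \<Rightarrow> real" where
  "cross S T = (\<Sum>u\<in>S. \<Sum>v\<in>T. adj u v)"

lemma cross_sym: "cross S T = cross T S"
  unfolding cross_def by (subst sum.swap) (simp add: adj_sym)

lemma cross_union:
  assumes "finite S" "finite S'" "S \<inter> S' = {}"
  shows "cross (S \<union> S') T = cross S T + cross S' T"
  unfolding cross_def using assms by (rule sum.union_disjoint)

lemma cross_union_right:
  assumes "finite S" "finite S'" "S \<inter> S' = {}"
  shows "cross T (S \<union> S') = cross T S + cross T S'"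
  using cross_union[OF assms] cross_sym by metis

lemma cross_self:
  assumes "finite S"
  shows "cross S S = 2 * induced S"
proof -
  let ?F = "{e \<in> E. e \<subseteq> S}"
  have "cross S S = (\<Sum>u\<in>S. \<Sum>e\<in>{e \<in> ?F. u \<in> e}. 1)" unfolding cross_def
  proof (rule sum.cong[OF refl])
    fix u assume u: "u \<in> S"
    have "(\<Sum>v\<in>S. adj u v) = real (card (nbrs G u \<inter> S))"
      using assms by (simp add: adj_def sum.If_cases nbrs_def Int_commute)
    also have "bij_betw (\<lambda>y. {u, y}) (nbrs G u \<inter> S) {e \<in> ?F. u \<in> e}"
    proof (rule bij_betw_subset[OF bij_incident])
      show "(\<lambda>y. {u, y}) ` (nbrs G u \<inter> S) = {e \<in> ?F. u \<in> e}"
      proof (intro set_eqI iffI)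
        fix e assume e: "e \<in> {e \<in> ?F. u \<in> e}"
        then obtain y where "e = {u, y}" using edge[of e] by (auto simp: card_2_iff)
        then show "e \<in> (\<lambda>y. {u, y}) ` (nbrs G u \<inter> S)" using e by (auto simp: nbrs_def)
      qed (use u in \<open>auto simp: nbrs_def\<close>)
    qed simp
    then have "card (nbrs G u \<inter> S) = card {e \<in> ?F. u \<in> e}" by (rule bij_betw_same_card)
    finally show "(\<Sum>v\<in>S. adj u v) = (\<Sum>e\<in>{e \<in> ?F. u \<in> e}. 1)" by simp
  qed
  also have "\<dots> = (\<Sum>e\<in>?F. \<Sum>u\<in>{u \<in> S. u \<in> e}. 1)"
    using finite_E assms by (intro sum.swap_restrict) auto
  also have "\<dots> = (\<Sum>e\<in>?F. 2)"
  proof (rule sum.cong[OF refl])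
    fix e assume e: "e \<in> ?F"
    then have "{u \<in> S. u \<in> e} = e" by auto
    then show "(\<Sum>u\<in>{u \<in> S. u \<in> e}. 1) = (2 :: real)" using edge[of e] e by simp
  qed
  finally show ?thesis by simp
qed

text \<open>Polarisation. An edge inside \<open>S \<inter> T\<close> is met twice by
  \<open>cross S T\<close> and counted in both \<open>S \<union> T\<close> and
  \<open>S \<inter> T\<close>; edges inside \<open>S - T\<close> or \<open>T - S\<close> are not met
  at all and have to be subtracted. So four additive queries yield the cross count even if the sets
  overlap.\<close>

lemma cross_eq_induced:
  assumes S: "finite S" and T: "finite T"
  shows "cross S T = induced (S \<union> T) + induced (S \<inter> T) - induced (S - T) - induced (T - S)"
proof -
  let ?P = "S - T" let ?Q = "T - S" let ?I = "S \<inter> T"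
  have fin: "finite ?P" "finite ?Q" "finite ?I" using S T by auto
  have S': "S = ?P \<union> ?I" and T': "T = ?Q \<union> ?I" and U: "S \<union> T = ?P \<union> (?Q \<union> ?I)" by auto
  have "cross S T = cross (?P \<union> ?I) (?Q \<union> ?I)" using S' T' by simp
  also have "\<dots> = cross ?P ?Q + cross ?P ?I + (cross ?I ?Q + cross ?I ?I)"
    using fin by (subst cross_union cross_union_right; auto)+
  finally have 1: "cross S T = cross ?P ?Q + cross ?P ?I + (cross ?I ?Q + cross ?I ?I)" .
  have "cross (S \<union> T) (S \<union> T) = cross (?P \<union> (?Q \<union> ?I)) (?P \<union> (?Q \<union> ?I))" using U by simp
  also have "\<dots> = cross ?P ?P + (cross ?P ?Q + cross ?P ?I)
     + (cross ?Q ?P + (cross ?Q ?Q + cross ?Q ?I) + (cross ?I ?P + (cross ?I ?Q + cross ?I ?I)))"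
  proof -
    have r: "cross X (?P \<union> (?Q \<union> ?I)) = cross X ?P + (cross X ?Q + cross X ?I)" for X
    proof -
      have "cross X (?P \<union> (?Q \<union> ?I)) = cross X ?P + cross X (?Q \<union> ?I)"
        by (rule cross_union_right) (use fin in auto)
      also have "cross X (?Q \<union> ?I) = cross X ?Q + cross X ?I"
        by (rule cross_union_right) (use fin in auto)
      finally show ?thesis .
    qed
    have l: "cross (?P \<union> (?Q \<union> ?I)) X = cross ?P X + (cross ?Q X + cross ?I X)" for X
      using r[of X] by (simp only: cross_sym[of ?P X] cross_sym[of ?Q X] cross_sym[of ?I X]
        cross_sym[of "?P \<union> (?Q \<union> ?I)" X])
    show ?thesis by (simp only: l r add.assoc)
  qed
  finally have "2 * induced (S \<union> T) = 2 * induced ?P + 2 * induced ?Q + 2 * induced ?I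
     + 2 * (cross ?P ?Q + cross ?P ?I + cross ?I ?Q)"
    using cross_self[OF fin(1)] cross_self[OF fin(2)] cross_self[OF fin(3)]
      cross_self[of "S \<union> T"] S T cross_sym[of ?Q ?P] cross_sym[of ?I ?P] cross_sym[of ?Q ?I]
    by simp
  then show ?thesis using 1 cross_self[OF fin(3)] by simp
qed

end

lemma binary_digits: "(x :: nat) mod 2 ^ L = (\<Sum>b<L. 2 ^ b * (x div 2 ^ b mod 2))"
proof (induction L)
  case (Suc L)
  have "x mod 2 ^ Suc L = 2 ^ L * (x div 2 ^ L mod 2) + x mod 2 ^ L"
    by (simp add: mod_mult2_eq mult.commute[of 2])
  then show ?case using Suc by simp
qed simp

definition digit :: "(nat \<Rightarrow> nat) \<Rightarrow> nat set \<Rightarrow> nat \<Rightarrow> nat set" where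
  "digit w X b = {v \<in> X. odd (w v div 2 ^ b)}"

text \<open>Additive queries count without weights; the binary digits of an integer weight turn a
  weighted count into \<open>L\<close> unweighted ones.\<close>

lemma sum_digit:
  fixes \<psi> :: "nat \<Rightarrow> real"
  assumes "finite X" "\<And>v. v \<in> X \<Longrightarrow> w v < 2 ^ L"
  shows "(\<Sum>v\<in>X. w v * \<psi> v) = (\<Sum>b<L. 2 ^ b * (\<Sum>v\<in>digit w X b. \<psi> v))"
proof -
  have "(\<Sum>v\<in>X. w v * \<psi> v) = (\<Sum>v\<in>X. \<Sum>b<L. 2 ^ b * (if odd (w v div 2 ^ b) then \<psi> v else 0))"
  proof (rule sum.cong[OF refl])
    fix v assume "v \<in> X"
    then have "w v = (\<Sum>b<L. 2 ^ b * (w v div 2 ^ b mod 2))" using assms binary_digits[of "w v" L] by simp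
    then have "real (w v) = real (\<Sum>b<L. 2 ^ b * (w v div 2 ^ b mod 2))" by (rule arg_cong)
    also have "\<dots> = (\<Sum>b<L. 2 ^ b * real (w v div 2 ^ b mod 2))"
      by (simp only: of_nat_sum of_nat_mult of_nat_power of_nat_numeral)
    finally have "real (w v) = (\<Sum>b<L. 2 ^ b * real (w v div 2 ^ b mod 2))" .
    then have "w v * \<psi> v = (\<Sum>b<L. 2 ^ b * (real (w v div 2 ^ b mod 2) * \<psi> v))"
      by (simp add: sum_distrib_right mult.assoc)
    also have "\<dots> = (\<Sum>b<L. 2 ^ b * (if odd (w v div 2 ^ b) then \<psi> v else 0))"
      by (intro sum.cong) (auto simp: odd_iff_mod_2_eq_one even_iff_mod_2_eq_zero)
    finally show "w v * \<psi> v = (\<Sum>b<L. 2 ^ b * (if odd (w v div 2 ^ b) then \<psi> v else 0))" .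
  qed
  also have "\<dots> = (\<Sum>b<L. \<Sum>v\<in>X. 2 ^ b * (if odd (w v div 2 ^ b) then \<psi> v else 0))" by (rule sum.swap)
  also have "\<dots> = (\<Sum>b<L. 2 ^ b * (\<Sum>v\<in>digit w X b. \<psi> v))"
    using assms(1) by (simp add: sum_distrib_left[symmetric] digit_def sum.If_cases Int_def)
  finally show ?thesis .
qed

section \<open>Moments of the estimators\<close>

lemma finite_set_replicate_pmf: "finite (set_pmf p) \<Longrightarrow> finite (set_pmf (replicate_pmf k p))"
  by (induction k) auto

lemma expectation_replicate_Suc:
  fixes h :: "'a list \<Rightarrow> real"
  assumes "finite (set_pmf p)"
  shows "measure_pmf.expectation (replicate_pmf (Suc k) p) h
    = measure_pmf.expectation p (\<lambda>x. measure_pmf.expectation (replicate_pmf k p) (\<lambda>xs. h (x # xs)))"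
  using assms finite_set_replicate_pmf[OF assms, of k]
  by (simp add: expectation_bind_pmf_finite)

lemma expectation_pair_pmf:
  fixes h :: "'a \<times> 'b \<Rightarrow> real"
  assumes "finite (set_pmf p)" "finite (set_pmf q)"
  shows "measure_pmf.expectation (pair_pmf p q) h
    = measure_pmf.expectation p (\<lambda>x. measure_pmf.expectation q (\<lambda>y. h (x, y)))"
  unfolding pair_pmf_def using assms by (simp add: expectation_bind_pmf_finite)

lemma expectation_swap:
  fixes h :: "'a \<Rightarrow> 'b \<Rightarrow> real"
  assumes "finite (set_pmf p)" "finite (set_pmf q)"
  shows "measure_pmf.expectation p (\<lambda>x. measure_pmf.expectation q (\<lambda>y. h x y))
    = measure_pmf.expectation q (\<lambda>y. measure_pmf.expectation p (\<lambda>x. h x y))"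
  using assms
  by (simp add: integral_measure_pmf_real[where A="set_pmf p"] integral_measure_pmf_real[where A="set_pmf q"]
      sum_distrib_left sum_distrib_right mult_ac) (subst sum.swap, simp)

lemma expectation_sum_list:
  fixes g :: "'a \<Rightarrow> real"
  assumes fin: "finite (set_pmf p)"
  shows "measure_pmf.expectation (replicate_pmf k p) (\<lambda>xs. \<Sum>x\<leftarrow>xs. g x)
       = k * measure_pmf.expectation p g"
proof (induction k)
  case (Suc k)
  have int: "integrable (measure_pmf p) f" "integrable (measure_pmf (replicate_pmf k p)) f'"
    for f :: "'a \<Rightarrow> real" and f' :: "'a list \<Rightarrow> real"
    using fin finite_set_replicate_pmf[OF fin] by (auto intro: integrable_measure_pmf_finite)
  show ?case
    by (simp add: expectation_replicate_Suc[OF fin] int Suc algebra_simps del: replicate_pmf.simps)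
qed simp

text \<open>Of the \<open>k * k\<close> products, the \<open>k\<close> diagonal ones give the second
  moment and the others factor by independence.\<close>

lemma expectation_sum_list_sq:
  fixes g :: "'a \<Rightarrow> real"
  assumes fin: "finite (set_pmf p)"
  shows "measure_pmf.expectation (replicate_pmf k p) (\<lambda>xs. (\<Sum>x\<leftarrow>xs. g x)\<^sup>2)
       = k * measure_pmf.expectation p (\<lambda>x. (g x)\<^sup>2)
         + k * (real k - 1) * (measure_pmf.expectation p g)\<^sup>2"
proof (induction k)
  case (Suc k)
  have int: "integrable (measure_pmf p) f" "integrable (measure_pmf (replicate_pmf k p)) f'"
    for f :: "'a \<Rightarrow> real" and f' :: "'a list \<Rightarrow> real"
    using fin finite_set_replicate_pmf[OF fin] by (auto intro: integrable_measure_pmf_finite)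
  have "measure_pmf.expectation (replicate_pmf (Suc k) p) (\<lambda>xs. (\<Sum>x\<leftarrow>xs. g x)\<^sup>2)
      = measure_pmf.expectation p (\<lambda>x. (g x)\<^sup>2 + 2 * g x * (k * measure_pmf.expectation p g)
         + (k * measure_pmf.expectation p (\<lambda>x. (g x)\<^sup>2) + k * (real k - 1) * (measure_pmf.expectation p g)\<^sup>2))"
    by (simp add: expectation_replicate_Suc[OF fin] int Suc expectation_sum_list[OF fin] power2_sum
        del: replicate_pmf.simps)
  also have "\<dots> = measure_pmf.expectation p (\<lambda>x. (g x)\<^sup>2)
      + 2 * measure_pmf.expectation p g * (k * measure_pmf.expectation p g)
         + (k * measure_pmf.expectation p (\<lambda>x. (g x)\<^sup>2) + k * (real k - 1) * (measure_pmf.expectation p g)\<^sup>2)"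
    by (simp add: int)
  finally show ?case by (simp add: algebra_simps power2_eq_square)
qed simp

lemma chebyshev_sum_list:
  fixes \<phi> :: "'a \<Rightarrow> real"
  assumes fin: "finite (set_pmf p)" and k: "0 < k" and \<eta>: "0 < \<eta>"
  shows "measure_pmf.prob (replicate_pmf k p)
      {xs. \<eta> \<le> \<bar>(\<Sum>x\<leftarrow>xs. \<phi> x) / k - measure_pmf.expectation p \<phi>\<bar>}
    \<le> (measure_pmf.expectation p (\<lambda>x. (\<phi> x)\<^sup>2) - (measure_pmf.expectation p \<phi>)\<^sup>2) / (k * \<eta>\<^sup>2)"
proof -
  let ?P = "replicate_pmf k p"
  let ?S = "\<lambda>xs. \<Sum>x\<leftarrow>xs. \<phi> x"
  let ?e = "measure_pmf.expectation p \<phi>"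
  let ?v = "measure_pmf.expectation p (\<lambda>x. (\<phi> x)\<^sup>2)"
  have int: "integrable (measure_pmf ?P) f" for f :: "'a list \<Rightarrow> real"
    using finite_set_replicate_pmf[OF fin] by (rule integrable_measure_pmf_finite)
  have "measure_pmf.prob ?P {xs. \<eta> \<le> \<bar>?S xs / k - ?e\<bar>} = measure_pmf.prob ?P {xs. k * \<eta> \<le> \<bar>?S xs - k * ?e\<bar>}"
  proof -
    have "\<eta> \<le> \<bar>y / k - ?e\<bar> \<longleftrightarrow> k * \<eta> \<le> \<bar>y - k * ?e\<bar>" for y :: real
    proof -
      have "\<bar>y - k * ?e\<bar> = k * \<bar>y / k - ?e\<bar>"
        using k abs_mult[of "real k" "y / k - ?e"] by (simp add: right_diff_distrib)
      then show ?thesis using k by simp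
    qed
    then show ?thesis by simp
  qed
  also have "\<dots> \<le> measure_pmf.variance ?P ?S / (k * \<eta>)\<^sup>2"
    using measure_pmf.Chebyshev_inequality[of ?S ?P "k * \<eta>"] k \<eta> int
    by (simp add: expectation_sum_list[OF fin])
  also have "measure_pmf.variance ?P ?S = k * (?v - ?e\<^sup>2)"
  proof -
    have "measure_pmf.variance ?P ?S
        = measure_pmf.expectation ?P (\<lambda>xs. (?S xs)\<^sup>2) - (measure_pmf.expectation ?P ?S)\<^sup>2"
      using int by (intro measure_pmf.variance_eq) auto
    also have "\<dots> = k * ?v + k * (real k - 1) * ?e\<^sup>2 - (k * ?e)\<^sup>2"
      by (simp only: expectation_sum_list[OF fin] expectation_sum_list_sq[OF fin])
    finally show ?thesis by (simp add: algebra_simps power2_eq_square)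
  qed
  also have "\<dots> / (k * \<eta>)\<^sup>2 = (?v - ?e\<^sup>2) / (k * \<eta>\<^sup>2)"
    using k by (simp add: power2_eq_square)
  finally show ?thesis .
qed

text \<open>An integer approximation to \<open>n / \<delta> v\<close>: its bias does not matter because \<open>heavy\<close> estimates
  the resulting total weight of the edges as well.\<close>

definition trunc_weight :: "nat \<Rightarrow> real \<Rightarrow> (nat \<Rightarrow> nat) \<Rightarrow> nat \<Rightarrow> nat" where
  "trunc_weight n t \<delta> v = (if t \<le> real (\<delta> v) then n div \<delta> v else 0)"

definition inv_deg :: "(nat \<Rightarrow> nat) \<Rightarrow> nat set \<Rightarrow> real" where
  "inv_deg \<delta> e = (\<Sum>v\<in>e. 1 / (2 * real (\<delta> v)))"

text \<open>The part of an edge that survives rounding and truncation: with exact weights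
  \<open>n / \<delta> v\<close> each factor would be 1, while an endpoint of degree below
  \<open>t\<close> makes the product 0.\<close>

definition heavy :: "nat \<Rightarrow> real \<Rightarrow> (nat \<Rightarrow> nat) \<Rightarrow> nat set \<Rightarrow> real" where
  "heavy n t \<delta> e = (\<Prod>v\<in>e. real (\<delta> v * trunc_weight n t \<delta> v) / n)"

context simple_graph_without_isolated
begin

abbreviation "P \<equiv> pmf_of_set E"
abbreviation "ave \<phi> \<equiv> measure_pmf.expectation P \<phi>"

lemma set_P: "set_pmf P = E"
  using finite_E E_nonempty by simp

lemma finite_P: "finite (set_pmf P)"
  using finite_E by (simp add: set_P)

lemma ave_eq: "ave \<phi> = (\<Sum>e\<in>E. \<phi> e) / m" for \<phi> :: "nat set \<Rightarrow> real"
  by (rule integral_pmf_of_set[OF E_nonempty finite_E])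

lemma ave_mono: "(\<And>e. e \<in> E \<Longrightarrow> \<phi> e \<le> \<psi> e) \<Longrightarrow> ave \<phi> \<le> ave \<psi>" for \<phi> \<psi> :: "nat set \<Rightarrow> real"
  unfolding ave_eq by (intro divide_right_mono sum_mono) auto

text \<open>A vertex \<open>v\<close> lies on \<open>deg v\<close> edges and contributes
  \<open>1 / (2 * deg v)\<close> to each, hence 1/2 in total; the average over the edges is
  \<open>n / (2 * m)\<close>.\<close>

lemma ave_inv_deg: "ave (inv_deg (\<lambda>v. deg v)) = 1 / d"
proof -
  have "(\<Sum>e\<in>E. inv_deg (\<lambda>v. deg v) e) = (\<Sum>v\<in>V. deg v * (1 / (2 * real (deg v))))"
    unfolding inv_deg_def by (rule sum_over_edges_deg)
  also have "\<dots> = (\<Sum>v\<in>V. 1/2)" using deg_pos by (intro sum.cong) force+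
  also have "\<dots> = n / 2" using card_V by simp
  finally have "(\<Sum>e\<in>E. inv_deg (\<lambda>v. deg v) e) = n / 2" .
  then show ?thesis unfolding ave_eq d_eq by (simp only:) simp
qed

lemma inv_deg_bounds:
  assumes "e \<in> E" shows "0 \<le> inv_deg (\<lambda>v. deg v) e" "inv_deg (\<lambda>v. deg v) e \<le> 1"
proof -
  show "0 \<le> inv_deg (\<lambda>v. deg v) e" unfolding inv_deg_def by (intro sum_nonneg) simp
  have "inv_deg (\<lambda>v. deg v) e \<le> (\<Sum>v\<in>e. 1/2)" unfolding inv_deg_def
  proof (rule sum_mono)
    fix v assume "v \<in> e"
    then have "1 \<le> deg v" using assms edge deg_pos by blast
    then show "1 / (2 * real (deg v)) \<le> 1/2" by (simp add: field_simps)
  qed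
  also have "\<dots> = 1" using edge[OF assms] by simp
  finally show "inv_deg (\<lambda>v. deg v) e \<le> 1" .
qed

text \<open>The values lie between 0 and 1, so the second moment is at most the mean.\<close>

lemma ave_inv_deg_sq: "ave (\<lambda>e. (inv_deg (\<lambda>v. deg v) e)\<^sup>2) \<le> 1 / d"
proof -
  have "ave (\<lambda>e. (inv_deg (\<lambda>v. deg v) e)\<^sup>2) \<le> ave (inv_deg (\<lambda>v. deg v))"
    using inv_deg_bounds by (intro ave_mono) (simp add: power2_eq_square mult_left_le)
  then show ?thesis by (simp only: ave_inv_deg)
qed

abbreviation "g t v \<equiv> trunc_weight n t (\<lambda>v. deg v) v"
definition "h t v = real (deg v * g t v) / n"
abbreviation "hv t e \<equiv> heavy n t (\<lambda>v. deg v) e"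
definition "R t = ave (hv t)"

lemma hv_eq: "hv t e = (\<Prod>v\<in>e. h t v)"
  by (simp add: heavy_def h_def)

lemma n_h: "n * h t v = real (deg v) * real (g t v)"
  using n by (simp add: h_def)

lemma h_bounds: "0 \<le> h t v" "h t v \<le> 1"
proof -
  have "deg v * g t v \<le> n" by (simp add: trunc_weight_def)
  then show "h t v \<le> 1" using n of_nat_mono[of "deg v * g t v" n, where 'a=real] by (simp add: h_def)
qed (simp add: h_def)

text \<open>A degree is less than \<open>n\<close>, so \<open>n div deg v\<close> rounds down a
  number above 1 and keeps at least half of it.\<close>

lemma h_heavy:
  fixes t :: real
  assumes "v \<in> V" "t \<le> deg v" shows "1/2 \<le> h t v"
proof -
  let ?q = "n div deg v"
  have d: "1 \<le> deg v" "deg v < n" using deg_pos deg_less assms by auto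
  then have "1 \<le> ?q" by (simp add: less_eq_div_iff_mult_less_eq)
  then have "deg v * 1 \<le> deg v * ?q" by (rule mult_le_mono2)
  moreover have "n < deg v * ?q + deg v" using d by (metis dividend_less_times_div add.commute less_le_trans zero_less_one mult_Suc_right)
  ultimately have "n \<le> 2 * (deg v * ?q)" by linarith
  then have "real n \<le> 2 * (deg v * ?q)" by (metis of_nat_le_iff of_nat_mult of_nat_numeral)
  then show ?thesis using assms n by (simp add: h_def trunc_weight_def field_simps)
qed

lemma hv_bounds: "0 \<le> hv t e" "hv t e \<le> 1"
  unfolding hv_eq by (intro prod_nonneg h_bounds, intro prod_le_1 conjI h_bounds)

text \<open>Vertices of degree below \<open>t\<close> meet at most \<open>n * t\<close> edges, and
  this is at most half of all edges since \<open>4 * t \<le> d\<close>. Every other edge keeps a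
  factor of at least 1/2 at each endpoint, so a quarter of its weight.\<close>

lemma R_lower:
  assumes "4 * t \<le> d" "0 \<le> t" shows "1/8 \<le> R t"
proof -
  let ?L = "{v \<in> V. real (deg v) < t}"
  let ?bad = "\<lambda>e. \<exists>v\<in>e. real (deg v) < t"
  have "real (card {e \<in> E. ?bad e}) \<le> (\<Sum>e\<in>E. \<Sum>v\<in>e. if real (deg v) < t then 1 else 0)"
  proof -
    have "real (card {e \<in> E. ?bad e}) = (\<Sum>e\<in>E. if ?bad e then 1 else 0)"
      using finite_E by (simp add: sum.If_cases Int_def)
    also have "\<dots> \<le> (\<Sum>e\<in>E. \<Sum>v\<in>e. if real (deg v) < t then 1 else 0)"
    proof (rule sum_mono)
      fix e assume e: "e \<in> E"
      then have fe: "finite e" using edge finite_V finite_subset by blast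
      show "(if ?bad e then 1 else 0) \<le> (\<Sum>v\<in>e. if real (deg v) < t then 1 else (0::real))"
      proof (cases "?bad e")
        case True
        then obtain v where v: "v \<in> e" "real (deg v) < t" by blast
        have "(if real (deg v) < t then 1 else 0) \<le> (\<Sum>v\<in>e. if real (deg v) < t then 1 else (0::real))"
          by (rule member_le_sum[OF v(1) _ fe]) simp
        then show ?thesis using True v by simp
      qed (auto intro: sum_nonneg)
    qed
    finally show ?thesis .
  qed
  also have "\<dots> = (\<Sum>v\<in>V. real (deg v) * (if real (deg v) < t then 1 else 0))" by (rule sum_over_edges_deg)
  also have "\<dots> \<le> (\<Sum>v\<in>V. t)" using assms by (intro sum_mono) auto
  also have "\<dots> = n * t" using card_V by simp
  also have "\<dots> \<le> n * (d / 4)" using assms by (intro mult_left_mono) auto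
  also have "\<dots> = m / 2" using two_m by (simp add: algebra_simps)
  finally have bad: "real (card {e \<in> E. ?bad e}) \<le> m / 2" .
  have "(\<Sum>e\<in>E. 1 - (if ?bad e then 1 else 0)) = real m - card {e \<in> E. ?bad e}"
    using finite_E by (simp add: sum_subtractf sum.If_cases Int_def)
  then have "1/4 * (real m - card {e \<in> E. ?bad e}) = (\<Sum>e\<in>E. 1/4 * (1 - (if ?bad e then 1 else 0)))"
    by (simp only: sum_distrib_left[symmetric])
  also have "\<dots> \<le> (\<Sum>e\<in>E. hv t e)"
  proof (rule sum_mono)
    fix e assume e: "e \<in> E"
    show "1/4 * (1 - (if ?bad e then 1 else 0)) \<le> hv t e"
    proof (cases "?bad e")
      case True
      then show ?thesis using hv_bounds(1)[of t e] by simp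
    next
      case False
      obtain u v where uv: "e = {u, v}" "u \<noteq> v" "u \<in> V" "v \<in> V"
        using edge[OF e] by (auto simp: card_2_iff)
      then have "1/2 * (1/2) \<le> h t u * h t v"
        using False by (intro mult_mono h_heavy h_bounds(1)) (auto simp: not_less)
      then show ?thesis using False uv by (simp add: hv_eq)
    qed
  qed
  finally have good: "1/4 * (real m - card {e \<in> E. ?bad e}) \<le> (\<Sum>e\<in>E. hv t e)" .
  have "m / 8 = 1/4 * (real m - m / 2)" by simp
  also have "\<dots> \<le> 1/4 * (real m - card {e \<in> E. ?bad e})"
    using bad by (intro mult_left_mono diff_left_mono) auto
  finally have "m / 8 \<le> (\<Sum>e\<in>E. hv t e)" using good by (rule order_trans)
  then show ?thesis unfolding R_def ave_eq using m_pos by (simp add: field_simps)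
qed

definition "f t x y = (\<Sum>u\<in>x. \<Sum>v\<in>y. real (g t u) * real (g t v) * adj u v)"

lemma f_nonneg: "0 \<le> f t x y"
  unfolding f_def adj_def by (intro sum_nonneg) auto

lemma f_sym: "f t x y = f t y x"
  unfolding f_def by (subst sum.swap) (simp add: adj_sym mult_ac)

text \<open>This is the purpose of the truncation: with weights bounded by \<open>n / t\<close>,
  adjacent endpoints of low degree cannot dominate the second moment.\<close>

lemma f_le:
  assumes "0 < t" "x \<in> E" "y \<in> E" shows "f t x y \<le> 4 * (n / t)\<^sup>2"
proof -
  have g: "real (g t v) \<le> n / t" for v
  proof (cases "t \<le> deg v")
    case True
    have "real (n div deg v) \<le> n / deg v" by (rule of_nat_div_le_of_nat)
    also have "\<dots> \<le> n / t" using True assms(1) by (intro divide_left_mono) auto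
    finally show ?thesis using True by (simp add: trunc_weight_def)
  qed (use assms(1) in \<open>simp add: trunc_weight_def\<close>)
  have "f t x y \<le> (\<Sum>u\<in>x. \<Sum>v\<in>y. n / t * (n / t) * 1)"
    unfolding f_def using g assms(1) by (intro sum_mono mult_mono) (auto simp: adj_def)
  also have "\<dots> = 4 * (n / t)\<^sup>2" using edge[OF assms(2)] edge[OF assms(3)] by (simp add: power2_eq_square)
  finally show ?thesis .
qed

lemma ave_f: "ave (\<lambda>y. f t x y) = n / m * (\<Sum>u\<in>x. real (g t u) * (\<Sum>v\<in>nbrs G u. h t v))"
proof -
  have "(\<Sum>y\<in>E. f t x y) = (\<Sum>u\<in>x. \<Sum>y\<in>E. \<Sum>v\<in>y. real (g t u) * real (g t v) * adj u v)"
    unfolding f_def by (rule sum.swap)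
  also have "\<dots> = (\<Sum>u\<in>x. n * (real (g t u) * (\<Sum>v\<in>nbrs G u. h t v)))"
  proof (rule sum.cong[OF refl])
    fix u
    have "(\<Sum>y\<in>E. \<Sum>v\<in>y. real (g t u) * real (g t v) * adj u v)
      = (\<Sum>v\<in>V. deg v * (real (g t u) * real (g t v) * adj u v))" by (rule sum_over_edges_deg)
    also have "\<dots> = (\<Sum>v\<in>V. adj u v * (n * real (g t u) * h t v))"
      using n by (intro sum.cong) (auto simp: h_def)
    also have "\<dots> = (\<Sum>v\<in>nbrs G u. n * real (g t u) * h t v)" by (rule sum_adj_V)
    also have "\<dots> = n * (real (g t u) * (\<Sum>v\<in>nbrs G u. h t v))"
      by (simp only: sum_distrib_left mult.assoc)
    finally show "(\<Sum>y\<in>E. \<Sum>v\<in>y. real (g t u) * real (g t v) * adj u v)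
      = n * (real (g t u) * (\<Sum>v\<in>nbrs G u. h t v))" .
  qed
  also have "\<dots> = n * (\<Sum>u\<in>x. real (g t u) * (\<Sum>v\<in>nbrs G u. h t v))"
    by (simp only: sum_distrib_left)
  finally show ?thesis unfolding ave_eq by simp
qed

text \<open>An endpoint \<open>u\<close> has \<open>deg u\<close> neighbours, each contributing
  \<open>h \<le> 1\<close>, and \<open>deg u * g t u \<le> n\<close> cancels the degree. So the
  bound is uniform in \<open>x\<close>, even for endpoints of large degree.\<close>

lemma ave_f_le:
  assumes "x \<in> E" shows "ave (\<lambda>y. f t x y) \<le> 2 * (real n)\<^sup>2 / m"
proof -
  have "(\<Sum>u\<in>x. real (g t u) * (\<Sum>v\<in>nbrs G u. h t v)) \<le> (\<Sum>u\<in>x. real n)"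
  proof (rule sum_mono)
    fix u
    have "(\<Sum>v\<in>nbrs G u. h t v) \<le> (\<Sum>v\<in>nbrs G u. 1)" using h_bounds by (intro sum_mono) auto
    then have "real (g t u) * (\<Sum>v\<in>nbrs G u. h t v) \<le> real (g t u) * deg u"
      by (intro mult_left_mono) auto
    also have "\<dots> = n * h t u" unfolding n_h by simp
    also have "\<dots> \<le> real n * 1" by (intro mult_left_mono h_bounds) simp
    finally show "real (g t u) * (\<Sum>v\<in>nbrs G u. h t v) \<le> real n" by simp
  qed
  also have "\<dots> = 2 * real n" using edge[OF assms] by simp
  finally have "n / m * (\<Sum>u\<in>x. real (g t u) * (\<Sum>v\<in>nbrs G u. h t v)) \<le> n / m * (2 * real n)"
    by (intro mult_left_mono) auto
  also have "\<dots> = 2 * (real n)\<^sup>2 / m" by (simp add: power2_eq_square)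
  finally show ?thesis unfolding ave_f .
qed

definition "\<mu> t = 2 * (real n)\<^sup>2 * R t / m"

text \<open>A random edge meets \<open>u\<close> with probability \<open>deg u / m\<close>; times
  the weight \<open>g t u\<close> this is \<open>n * h t u / m\<close>. Both degree biases cancel
  and leave \<open>(n / m)^2\<close> times the sum of \<open>hv\<close> over ordered adjacent pairs,
  which counts every edge twice.\<close>

lemma ave_ave_f: "ave (\<lambda>x. ave (\<lambda>y. f t x y)) = \<mu> t"
proof -
  have "(\<Sum>x\<in>E. ave (\<lambda>y. f t x y)) = n / m * (\<Sum>x\<in>E. \<Sum>u\<in>x. real (g t u) * (\<Sum>v\<in>nbrs G u. h t v))"
    unfolding ave_f by (simp only: sum_distrib_left)
  also have "(\<Sum>x\<in>E. \<Sum>u\<in>x. real (g t u) * (\<Sum>v\<in>nbrs G u. h t v))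
      = (\<Sum>u\<in>V. deg u * (real (g t u) * (\<Sum>v\<in>nbrs G u. h t v)))" by (rule sum_over_edges_deg)
  also have "\<dots> = (\<Sum>u\<in>V. n * (\<Sum>e\<in>{e \<in> E. u \<in> e}. hv t e))"
  proof (rule sum.cong[OF refl])
    fix u
    have "deg u * (real (g t u) * (\<Sum>v\<in>nbrs G u. h t v)) = n * h t u * (\<Sum>v\<in>nbrs G u. h t v)"
      unfolding n_h by simp
    also have "\<dots> = n * (\<Sum>v\<in>nbrs G u. h t u * h t v)" by (simp add: sum_distrib_left mult.assoc)
    also have "(\<Sum>v\<in>nbrs G u. h t u * h t v) = (\<Sum>v\<in>nbrs G u. hv t {u, v})"
    proof (rule sum.cong[OF refl])
      fix v assume "v \<in> nbrs G u"
      then have "u \<noteq> v" using nbrs_subset by blast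
      then show "h t u * h t v = hv t {u, v}" by (simp add: hv_eq)
    qed
    finally show "deg u * (real (g t u) * (\<Sum>v\<in>nbrs G u. h t v)) = n * (\<Sum>e\<in>{e \<in> E. u \<in> e}. hv t e)"
      by (simp only: sum_incident)
  qed
  also have "\<dots> = n * (\<Sum>e\<in>E. \<Sum>v\<in>e. hv t e)"
    by (simp only: sum_over_edges sum_distrib_left)
  also have "(\<Sum>e\<in>E. \<Sum>v\<in>e. hv t e) = (\<Sum>e\<in>E. 2 * hv t e)"
    using edge by (intro sum.cong) auto
  also have "\<dots> = 2 * (m * R t)"
    unfolding R_def ave_eq sum_distrib_left[symmetric] using m_pos by simp
  finally show ?thesis unfolding ave_eq[of "\<lambda>x. ave (\<lambda>y. f t x y)"] \<mu>_def
    using m_pos by (simp add: power2_eq_square)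
qed

end

section \<open>Moments and concentration for batches\<close>

definition mean :: "('a \<Rightarrow> real) \<Rightarrow> 'a list \<Rightarrow> real" where
  "mean \<phi> xs = (\<Sum>x\<leftarrow>xs. \<phi> x) / length xs"

context simple_graph_without_isolated
begin

definition "cross_mean t b = (\<lambda>(xs, ys). (\<Sum>x\<leftarrow>xs. \<Sum>y\<leftarrow>ys. f t x y) / (real b)\<^sup>2)"

abbreviation "D b \<equiv> batch_pmf G b"

lemma finite_D: "finite (set_pmf (D b))"
  using finite_set_replicate_pmf[OF finite_P] by (simp add: batch_pmf_def)

lemma expectation_D: "measure_pmf.expectation (D b) F
   = measure_pmf.expectation (replicate_pmf b P) (\<lambda>xs. measure_pmf.expectation (replicate_pmf b P) (\<lambda>ys. F (xs, ys)))"
  for F :: "batch \<Rightarrow> real"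
  unfolding batch_pmf_def
  by (intro expectation_pair_pmf finite_set_replicate_pmf finite_P)

lemma expectation_D_swap: "measure_pmf.expectation (D b) F
   = measure_pmf.expectation (replicate_pmf b P) (\<lambda>ys. measure_pmf.expectation (replicate_pmf b P) (\<lambda>xs. F (xs, ys)))"
  for F :: "batch \<Rightarrow> real"
  unfolding expectation_D
  by (intro expectation_swap finite_set_replicate_pmf finite_P)

lemma integrable_P: "integrable (measure_pmf P) F"
  "integrable (measure_pmf (replicate_pmf b P)) F'"
  for F :: "nat set \<Rightarrow> real" and F' :: "nat set list \<Rightarrow> real"
  by (intro integrable_measure_pmf_finite finite_set_replicate_pmf finite_P)+

lemma moments_fst:
  fixes \<phi> :: "nat set \<Rightarrow> real"
  assumes b: "0 < b"
  shows "measure_pmf.expectation (D b) (\<lambda>(xs, ys). (\<Sum>x\<leftarrow>xs. \<phi> x) / b) = ave \<phi>"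
    and "measure_pmf.expectation (D b) (\<lambda>z. (case z of (xs, ys) \<Rightarrow> (\<Sum>x\<leftarrow>xs. \<phi> x) / b)\<^sup>2)
       \<le> (ave \<phi>)\<^sup>2 + ave (\<lambda>e. (\<phi> e)\<^sup>2) / b"
proof -
  show "measure_pmf.expectation (D b) (\<lambda>(xs, ys). (\<Sum>x\<leftarrow>xs. \<phi> x) / b) = ave \<phi>"
    unfolding expectation_D using b by (simp add: expectation_sum_list[OF finite_P])
  have "measure_pmf.expectation (D b) (\<lambda>z. (case z of (xs, ys) \<Rightarrow> (\<Sum>x\<leftarrow>xs. \<phi> x) / b)\<^sup>2)
    = (b * ave (\<lambda>e. (\<phi> e)\<^sup>2) + b * (real b - 1) * (ave \<phi>)\<^sup>2) / (real b)\<^sup>2"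
    unfolding expectation_D by (simp add: power_divide expectation_sum_list_sq[OF finite_P])
  also have "\<dots> \<le> (b * ave (\<lambda>e. (\<phi> e)\<^sup>2) + b * real b * (ave \<phi>)\<^sup>2) / (real b)\<^sup>2"
    by (intro divide_right_mono add_left_mono mult_right_mono mult_left_mono) auto
  also have "\<dots> = (ave \<phi>)\<^sup>2 + ave (\<lambda>e. (\<phi> e)\<^sup>2) / b"
    using b by (simp add: field_simps power2_eq_square)
  finally show "measure_pmf.expectation (D b) (\<lambda>z. (case z of (xs, ys) \<Rightarrow> (\<Sum>x\<leftarrow>xs. \<phi> x) / b)\<^sup>2)
       \<le> (ave \<phi>)\<^sup>2 + ave (\<lambda>e. (\<phi> e)\<^sup>2) / b" .
qed

lemma ave_sum_list: "ave (\<lambda>x. \<Sum>y\<leftarrow>ys. F x y) = (\<Sum>y\<leftarrow>ys. ave (\<lambda>x. F x y))"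
  for F :: "nat set \<Rightarrow> 'y \<Rightarrow> real"
  by (induction ys) (simp_all add: integrable_P)

text \<open>The square is split by coinciding samples. Both coincide in a fraction
  \<open>1 / b^2\<close> of the terms, where \<open>f_le\<close> bounds one factor; exactly one
  coincides in a fraction of at most \<open>2 / b\<close>, where \<open>ave_f_le\<close> bounds one
  factor; otherwise the factors are independent.\<close>

lemma moments_cross_mean:
  assumes b: "0 < b" and t: "0 < t"
  shows "measure_pmf.expectation (D b) (cross_mean t b) = \<mu> t"
    and "measure_pmf.expectation (D b) (\<lambda>z. (cross_mean t b z)\<^sup>2)
       \<le> (\<mu> t)\<^sup>2 + 4 * (n / t)\<^sup>2 * \<mu> t / (real b)\<^sup>2 + 4 * (real n)\<^sup>2 / m * \<mu> t / b"
proof -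
  let ?E = "\<lambda>F. measure_pmf.expectation (replicate_pmf b P) F"
  let ?f1 = "\<lambda>y. ave (\<lambda>x. f t x y)"
  let ?B = "real b"
  have f1: "?f1 y = ave (\<lambda>x. f t y x)" for y by (simp only: f_sym[of t _ y])
  have f1_0: "0 \<le> ?f1 y" for y using f_nonneg by (simp add: integral_nonneg_AE)
  have ave_f1: "ave ?f1 = \<mu> t" unfolding f1 by (rule ave_ave_f)
  have \<mu>0: "0 \<le> \<mu> t" unfolding ave_f1[symmetric] using f1_0 by (simp add: integral_nonneg_AE)
  show "measure_pmf.expectation (D b) (cross_mean t b) = \<mu> t"
    unfolding expectation_D_swap cross_mean_def using b
    by (simp add: expectation_sum_list[OF finite_P] ave_sum_list ave_f1 power2_eq_square)
  have inner: "?E (\<lambda>xs. (\<Sum>x\<leftarrow>xs. \<Sum>y\<leftarrow>ys. f t x y)\<^sup>2)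
     = ?B * ave (\<lambda>x. (\<Sum>y\<leftarrow>ys. f t x y)\<^sup>2) + ?B * (?B - 1) * (\<Sum>y\<leftarrow>ys. ?f1 y)\<^sup>2" for ys
    unfolding expectation_sum_list_sq[OF finite_P] ave_sum_list ..
  have "measure_pmf.expectation (D b) (\<lambda>z. (cross_mean t b z)\<^sup>2)
      = ?E (\<lambda>ys. ?B * ave (\<lambda>x. (\<Sum>y\<leftarrow>ys. f t x y)\<^sup>2) + ?B * (?B - 1) * (\<Sum>y\<leftarrow>ys. ?f1 y)\<^sup>2) / (?B\<^sup>2)\<^sup>2"
    unfolding expectation_D_swap cross_mean_def by (simp add: power_divide inner)
  also have "?E (\<lambda>ys. ?B * ave (\<lambda>x. (\<Sum>y\<leftarrow>ys. f t x y)\<^sup>2) + ?B * (?B - 1) * (\<Sum>y\<leftarrow>ys. ?f1 y)\<^sup>2)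
      = ?B * ?E (\<lambda>ys. ave (\<lambda>x. (\<Sum>y\<leftarrow>ys. f t x y)\<^sup>2)) + ?B * (?B - 1) * ?E (\<lambda>ys. (\<Sum>y\<leftarrow>ys. ?f1 y)\<^sup>2)"
    by (simp add: integrable_P)
  also have "?E (\<lambda>ys. ave (\<lambda>x. (\<Sum>y\<leftarrow>ys. f t x y)\<^sup>2)) = ave (\<lambda>x. ?E (\<lambda>ys. (\<Sum>y\<leftarrow>ys. f t x y)\<^sup>2))"
    by (intro expectation_swap finite_set_replicate_pmf finite_P)
  also have "\<dots> = ?B * ave (\<lambda>x. ave (\<lambda>y. (f t x y)\<^sup>2)) + ?B * (?B - 1) * ave (\<lambda>x. (ave (\<lambda>y. f t x y))\<^sup>2)"
    by (simp add: expectation_sum_list_sq[OF finite_P] integrable_P)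
  also have "ave (\<lambda>x. (ave (\<lambda>y. f t x y))\<^sup>2) = ave (\<lambda>y. (?f1 y)\<^sup>2)" by (simp only: f1)
  also have "?E (\<lambda>ys. (\<Sum>y\<leftarrow>ys. ?f1 y)\<^sup>2) = ?B * ave (\<lambda>y. (?f1 y)\<^sup>2) + ?B * (?B - 1) * (\<mu> t)\<^sup>2"
    unfolding expectation_sum_list_sq[OF finite_P] ave_f1 ..
  finally have eq: "measure_pmf.expectation (D b) (\<lambda>z. (cross_mean t b z)\<^sup>2)
    = (?B * (?B * ave (\<lambda>x. ave (\<lambda>y. (f t x y)\<^sup>2)) + ?B * (?B - 1) * ave (\<lambda>y. (?f1 y)\<^sup>2))
      + ?B * (?B - 1) * (?B * ave (\<lambda>y. (?f1 y)\<^sup>2) + ?B * (?B - 1) * (\<mu> t)\<^sup>2)) / (?B\<^sup>2)\<^sup>2" .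
  define p where "p = ave (\<lambda>x. ave (\<lambda>y. (f t x y)\<^sup>2))"
  define q where "q = ave (\<lambda>y. (?f1 y)\<^sup>2)"
  have p0: "0 \<le> p" and q0: "0 \<le> q" unfolding p_def q_def by (intro integral_nonneg_AE; simp)+
  have p: "p \<le> 4 * (n / t)\<^sup>2 * \<mu> t"
  proof -
    have "(f t x y)\<^sup>2 \<le> 4 * (n / t)\<^sup>2 * f t x y" if "x \<in> E" "y \<in> E" for x y
      unfolding power2_eq_square[of "f t x y"] using that by (intro mult_right_mono f_le[OF t] f_nonneg)
    then have "p \<le> ave (\<lambda>x. ave (\<lambda>y. 4 * (n / t)\<^sup>2 * f t x y))" unfolding p_def
      by (intro ave_mono)
    also have "\<dots> = 4 * (n / t)\<^sup>2 * \<mu> t" by (simp only: integral_mult_right_zero ave_ave_f)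
    finally show ?thesis .
  qed
  have q: "q \<le> 2 * (real n)\<^sup>2 / m * \<mu> t"
  proof -
    have "q \<le> ave (\<lambda>y. 2 * (real n)\<^sup>2 / m * ?f1 y)" unfolding q_def
    proof (rule ave_mono)
      fix y assume "y \<in> E"
      from ave_f_le[OF this, of t] f1_0[of y]
      show "(?f1 y)\<^sup>2 \<le> 2 * (real n)\<^sup>2 / m * ?f1 y"
        unfolding power2_eq_square[of "?f1 y"] by (intro mult_right_mono) (simp_all only: f1)
    qed
    also have "\<dots> = 2 * (real n)\<^sup>2 / m * \<mu> t" by (simp only: integral_mult_right_zero ave_f1)
    finally show ?thesis .
  qed
  have "?B * (?B * p + ?B * (?B - 1) * q) + ?B * (?B - 1) * (?B * q + ?B * (?B - 1) * (\<mu> t)\<^sup>2)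
     \<le> ?B * (?B * p + ?B * ?B * q) + ?B * ?B * (?B * q + ?B * ?B * (\<mu> t)\<^sup>2)"
    using b p0 q0 by (intro add_mono mult_mono mult_left_mono add_nonneg_nonneg mult_nonneg_nonneg) auto
  then have "measure_pmf.expectation (D b) (\<lambda>z. (cross_mean t b z)\<^sup>2)
     \<le> (?B * (?B * p + ?B * ?B * q) + ?B * ?B * (?B * q + ?B * ?B * (\<mu> t)\<^sup>2)) / (?B\<^sup>2)\<^sup>2"
    unfolding eq p_def[symmetric] q_def[symmetric] by (intro divide_right_mono) auto
  also have "\<dots> = (\<mu> t)\<^sup>2 + p / ?B\<^sup>2 + 2 * q / ?B"
    using b by (simp add: field_simps power2_eq_square)
  also have "\<dots> \<le> (\<mu> t)\<^sup>2 + 4 * (n / t)\<^sup>2 * \<mu> t / ?B\<^sup>2 + 2 * (2 * (real n)\<^sup>2 / m * \<mu> t) / ?B"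
    using p q b by (intro add_mono divide_right_mono mult_left_mono) auto
  also have "2 * (2 * (real n)\<^sup>2 / m * \<mu> t) / ?B = 4 * (real n)\<^sup>2 / m * \<mu> t / b" by simp
  finally show "measure_pmf.expectation (D b) (\<lambda>z. (cross_mean t b z)\<^sup>2)
       \<le> (\<mu> t)\<^sup>2 + 4 * (n / t)\<^sup>2 * \<mu> t / (real b)\<^sup>2 + 4 * (real n)\<^sup>2 / m * \<mu> t / b" .
qed

text \<open>The first deviation is measured against \<open>max (1 / d) (1 / b)\<close> because the
  variance is at most \<open>1 / (d * b)\<close>. The third is demanded only if enough weight
  survives, as the bound on the relative variance is of order \<open>1 / R t\<close>.\<close>

definition "good_stats t b \<epsilon> bs \<longleftrightarrow>
   \<bar>mean (\<lambda>(xs, ys). (\<Sum>x\<leftarrow>xs. inv_deg (\<lambda>v. deg v) x) / b) bs - 1 / d\<bar> < \<epsilon> / 8 * max (1 / d) (1 / b) \<and>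
   \<bar>mean (\<lambda>(xs, ys). (\<Sum>x\<leftarrow>xs. hv t x) / b) bs - R t\<bar> < \<epsilon> / 256 \<and>
   (1 / 32 \<le> R t \<longrightarrow> \<bar>mean (cross_mean t b) bs - \<mu> t\<bar> < \<epsilon> / 8 * \<mu> t)"

lemma chebyshev_D:
  fixes \<phi> :: "batch \<Rightarrow> real"
  assumes "0 < k" "0 < \<eta>" "measure_pmf.expectation (D b) (\<lambda>z. (\<phi> z)\<^sup>2) - (measure_pmf.expectation (D b) \<phi>)\<^sup>2 \<le> w"
  shows "measure_pmf.prob (replicate_pmf k (D b)) {bs. \<eta> \<le> \<bar>mean \<phi> bs - measure_pmf.expectation (D b) \<phi>\<bar>}
    \<le> w / (k * \<eta>\<^sup>2)"
proof -
  have len: "length bs = k" if "pmf (replicate_pmf k (D b)) bs \<noteq> 0" for bs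
    using that by (simp add: set_pmf_iff[symmetric] set_replicate_pmf)
  have "measure_pmf.prob (replicate_pmf k (D b)) {bs. \<eta> \<le> \<bar>mean \<phi> bs - measure_pmf.expectation (D b) \<phi>\<bar>}
      = measure_pmf.prob (replicate_pmf k (D b)) {bs. \<eta> \<le> \<bar>(\<Sum>z\<leftarrow>bs. \<phi> z) / k - measure_pmf.expectation (D b) \<phi>\<bar>}"
    using len by (intro measure_prob_cong_0) (force simp: mean_def)+
  also have "\<dots> \<le> (measure_pmf.expectation (D b) (\<lambda>z. (\<phi> z)\<^sup>2) - (measure_pmf.expectation (D b) \<phi>)\<^sup>2) / (k * \<eta>\<^sup>2)"
    by (rule chebyshev_sum_list[OF finite_D assms(1,2)])
  also have "\<dots> \<le> w / (k * \<eta>\<^sup>2)" using assms by (intro divide_right_mono) auto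
  finally show ?thesis .
qed

text \<open>With this \<open>t\<close> the term for coinciding pairs becomes
  \<open>64 * b^2 * \<mu> t\<close>. Since \<open>\<mu> t = 4 * n * R t / d\<close>, the hypothesis
  \<open>db\<close> gives \<open>b^2 * R t \<le> \<mu> t\<close>, so the term is at most
  \<open>64 / R t\<close> times the squared mean. The constant is
  \<open>64 + 65536 + 135168\<close>, rounded up.\<close>

lemma prob_good_stats:
  assumes b: "0 < b" and k: "0 < k" and \<epsilon>: "0 < \<epsilon>" and t: "t = n / (4 * (real b)\<^sup>2)"
    and db: "d * (real b)\<^sup>2 \<le> 4 * n"
  shows "measure_pmf.prob (replicate_pmf k (D b)) {bs. \<not> good_stats t b \<epsilon> bs} \<le> 210000 / (k * \<epsilon>\<^sup>2)"
proof -
  let ?Pr = "measure_pmf.prob (replicate_pmf k (D b))"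
  let ?a = "\<lambda>(xs, ys). (\<Sum>x\<leftarrow>xs. inv_deg (\<lambda>v. deg v) x) / b"
  let ?r = "\<lambda>(xs, ys). (\<Sum>x\<leftarrow>xs. hv t x) / b"
  let ?x = "max (1 / d) (1 / b)"
  let ?F1 = "{bs. \<epsilon> / 8 * ?x \<le> \<bar>mean ?a bs - 1 / d\<bar>}"
  let ?F2 = "{bs. \<epsilon> / 256 \<le> \<bar>mean ?r bs - R t\<bar>}"
  let ?F3 = "{bs. 1 / 32 \<le> R t \<and> \<epsilon> / 8 * \<mu> t \<le> \<bar>mean (cross_mean t b) bs - \<mu> t\<bar>}"
  have B: "0 < real b" using b by simp
  have d0: "0 < d" using d_ge_1 by simp
  have n0: "0 < real n" using n by simp
  have x0: "0 < ?x" using d0 by (simp add: less_max_iff_disj)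
  have 1: "?Pr ?F1 \<le> 64 / (k * \<epsilon>\<^sup>2)"
  proof -
    have "?Pr ?F1 \<le> ?x\<^sup>2 / (k * (\<epsilon> / 8 * ?x)\<^sup>2)"
    proof (subst ave_inv_deg[symmetric], subst moments_fst(1)[OF b, symmetric], rule chebyshev_D[OF k])
      have "measure_pmf.expectation (D b) (\<lambda>z. (?a z)\<^sup>2) - (measure_pmf.expectation (D b) ?a)\<^sup>2
          \<le> ave (\<lambda>e. (inv_deg (\<lambda>v. deg v) e)\<^sup>2) / b"
        using moments_fst[OF b, of "inv_deg (\<lambda>v. deg v)"] by simp
      also have "\<dots> \<le> 1 / d * (1 / b)" using divide_right_mono[OF ave_inv_deg_sq, of "real b"] by simp
      also have "\<dots> \<le> ?x * ?x" using d0 x0 by (intro mult_mono) auto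
      finally show "measure_pmf.expectation (D b) (\<lambda>z. (?a z)\<^sup>2) - (measure_pmf.expectation (D b) ?a)\<^sup>2 \<le> ?x\<^sup>2"
        by (simp add: power2_eq_square)
    qed (use \<epsilon> x0 in simp)
    also have "\<dots> = 64 / (k * \<epsilon>\<^sup>2)" using x0 by (simp add: power_mult_distrib power_divide)
    finally show ?thesis .
  qed
  have 2: "?Pr ?F2 \<le> 65536 / (k * \<epsilon>\<^sup>2)"
  proof -
    have "?Pr ?F2 \<le> 1 / (k * (\<epsilon> / 256)\<^sup>2)"
    proof (subst R_def, subst moments_fst(1)[OF b, symmetric], rule chebyshev_D[OF k])
      have "measure_pmf.expectation (D b) (\<lambda>z. (?r z)\<^sup>2) - (measure_pmf.expectation (D b) ?r)\<^sup>2
          \<le> ave (\<lambda>e. (hv t e)\<^sup>2) / b"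
        using moments_fst[OF b, of "hv t"] by simp
      also have "\<dots> \<le> ave (\<lambda>e. 1) / b"
        using hv_bounds by (intro divide_right_mono ave_mono power_le_one) auto
      also have "\<dots> \<le> 1" using b by simp
      finally show "measure_pmf.expectation (D b) (\<lambda>z. (?r z)\<^sup>2) - (measure_pmf.expectation (D b) ?r)\<^sup>2 \<le> 1" .
    qed (use \<epsilon> in simp)
    also have "\<dots> = 65536 / (k * \<epsilon>\<^sup>2)" by (simp add: power_divide)
    finally show ?thesis .
  qed
  have 3: "?Pr ?F3 \<le> 135168 / (k * \<epsilon>\<^sup>2)"
  proof (cases "1 / 32 \<le> R t")
    case False
    then show ?thesis by simp
  next
    case True
    have R: "0 < R t" using True by linarith
    have \<mu>: "0 < \<mu> t" unfolding \<mu>_def using R m_pos n0 by simp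
    have t0: "0 < t" unfolding t using n0 B by simp
    have m\<mu>: "m * \<mu> t = 2 * (real n)\<^sup>2 * R t" unfolding \<mu>_def using m_pos by simp
    have "measure_pmf.expectation (D b) (\<lambda>z. (cross_mean t b z)\<^sup>2) - (measure_pmf.expectation (D b) (cross_mean t b))\<^sup>2
        \<le> 4 * (n / t)\<^sup>2 * \<mu> t / (real b)\<^sup>2 + 4 * (real n)\<^sup>2 / m * \<mu> t / b"
      using moments_cross_mean[OF b t0] by simp
    also have "4 * (n / t)\<^sup>2 * \<mu> t / (real b)\<^sup>2 = 64 * (real b)\<^sup>2 * \<mu> t"
      unfolding t using n0 B by (simp add: power2_eq_square field_simps)
    also have "\<dots> \<le> 64 / R t * (\<mu> t)\<^sup>2"
    proof -
      have "(real b)\<^sup>2 * (2 * R t) * n = (real b)\<^sup>2 * (m * \<mu> t) / n"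
        unfolding m\<mu> using n0 by (simp add: power2_eq_square)
      also have "\<dots> = (real b)\<^sup>2 * (d / 2) * \<mu> t" using two_m n0 by (simp add: field_simps)
      also have "\<dots> = d * (real b)\<^sup>2 * (\<mu> t / 2)" by simp
      also have "\<dots> \<le> 4 * n * (\<mu> t / 2)" using db \<mu> by (intro mult_right_mono) auto
      finally have "n * ((real b)\<^sup>2 * R t) \<le> n * \<mu> t" by (simp add: algebra_simps)
      then have "(real b)\<^sup>2 * R t \<le> \<mu> t" using n0 by simp
      then have "(real b)\<^sup>2 \<le> \<mu> t / R t" using R by (simp add: field_simps)
      then have "64 * (real b)\<^sup>2 * \<mu> t \<le> 64 * (\<mu> t / R t) * \<mu> t"
        using \<mu> by (intro mult_right_mono mult_left_mono) auto
      then show ?thesis by (simp add: power2_eq_square)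
    qed
    also have "4 * (real n)\<^sup>2 / m * \<mu> t / b \<le> 2 / R t * (\<mu> t)\<^sup>2"
    proof -
      have "4 * (real n)\<^sup>2 / m = 2 / R t * \<mu> t" unfolding \<mu>_def using R by simp
      then have "4 * (real n)\<^sup>2 / m * \<mu> t / b = 2 / R t * (\<mu> t)\<^sup>2 / b" by (simp add: power2_eq_square)
      also have "\<dots> \<le> 2 / R t * (\<mu> t)\<^sup>2 / 1" using b R by (intro divide_left_mono) auto
      finally show ?thesis by simp
    qed
    finally have "measure_pmf.expectation (D b) (\<lambda>z. (cross_mean t b z)\<^sup>2) - (measure_pmf.expectation (D b) (cross_mean t b))\<^sup>2
        \<le> 66 / R t * (\<mu> t)\<^sup>2" by (simp add: algebra_simps)
    also have "\<dots> \<le> 66 * 32 * (\<mu> t)\<^sup>2"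
    proof (intro mult_right_mono)
      have "66 / R t \<le> 66 / (1 / 32)" using True by (intro divide_left_mono) auto
      then show "66 / R t \<le> 66 * 32" by simp
    qed simp
    finally have var: "measure_pmf.expectation (D b) (\<lambda>z. (cross_mean t b z)\<^sup>2)
       - (measure_pmf.expectation (D b) (cross_mean t b))\<^sup>2 \<le> 66 * 32 * (\<mu> t)\<^sup>2" .
    have "?Pr ?F3 \<le> 66 * 32 * (\<mu> t)\<^sup>2 / (k * (\<epsilon> / 8 * \<mu> t)\<^sup>2)"
      using chebyshev_D[OF k _ var, of "\<epsilon> / 8 * \<mu> t"] True \<mu> \<epsilon> moments_cross_mean(1)[OF b t0] by simp
    also have "\<dots> = 135168 / (k * \<epsilon>\<^sup>2)" using \<mu> by (simp add: power_mult_distrib power_divide)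
    finally show ?thesis .
  qed
  have "{bs. \<not> good_stats t b \<epsilon> bs} = ?F1 \<union> (?F2 \<union> ?F3)"
    by (auto simp: good_stats_def not_less)
  then have "?Pr {bs. \<not> good_stats t b \<epsilon> bs} = ?Pr (?F1 \<union> (?F2 \<union> ?F3))" by simp
  also have "\<dots> \<le> ?Pr ?F1 + ?Pr (?F2 \<union> ?F3)" by (rule measure_Un_le) auto
  also have "?Pr (?F2 \<union> ?F3) \<le> ?Pr ?F2 + ?Pr ?F3" by (rule measure_Un_le) auto
  finally have "?Pr {bs. \<not> good_stats t b \<epsilon> bs} \<le> 64 / (k * \<epsilon>\<^sup>2) + (65536 / (k * \<epsilon>\<^sup>2) + 135168 / (k * \<epsilon>\<^sup>2))"
    using 1 2 3 by linarith
  also have "\<dots> = 200768 / (k * \<epsilon>\<^sup>2)" by (simp add: add_divide_distrib[symmetric])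
  also have "\<dots> \<le> 210000 / (k * \<epsilon>\<^sup>2)" by (intro divide_right_mono) auto
  finally show ?thesis .
qed

end

section \<open>The search algorithm\<close>

text \<open>The weight that a sample puts on a vertex, counted as often as the vertex was drawn.
  Sums over pairs of samples become sums over pairs of vertices weighted by two loads.\<close>

definition load :: "nat \<Rightarrow> real \<Rightarrow> (nat \<Rightarrow> nat) \<Rightarrow> nat set list \<Rightarrow> nat \<Rightarrow> nat" where
  "load n t \<delta> xs v = (\<Sum>e\<leftarrow>xs. if v \<in> e then trunc_weight n t \<delta> v else 0)"

definition load_digit :: "nat \<Rightarrow> real \<Rightarrow> (nat \<Rightarrow> nat) \<Rightarrow> nat set list \<Rightarrow> nat \<Rightarrow> nat set" where
  "load_digit n t \<delta> xs = digit (load n t \<delta> xs) (\<Union>(set xs))"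

definition digit_queries :: "nat set \<Rightarrow> nat set \<Rightarrow> query list" where
  "digit_queries S T = map Additive [S \<union> T, S \<inter> T, S - T, T - S]"

definition batch_queries :: "nat \<Rightarrow> real \<Rightarrow> nat \<Rightarrow> (nat \<Rightarrow> nat) \<Rightarrow> batch \<Rightarrow> query list" where
  "batch_queries n t L \<delta> = (\<lambda>(xs, ys). concat (map (\<lambda>(b, c).
     digit_queries (load_digit n t \<delta> xs b) (load_digit n t \<delta> ys c)) (List.product [0..<L] [0..<L])))"

definition polarize :: "(query \<Rightarrow> nat) \<Rightarrow> nat set \<Rightarrow> nat set \<Rightarrow> real" where
  "polarize \<psi> S T = real (\<psi> (Additive (S \<union> T))) + real (\<psi> (Additive (S \<inter> T)))
     - real (\<psi> (Additive (S - T))) - real (\<psi> (Additive (T - S)))"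

definition cross_estimate ::
  "nat \<Rightarrow> real \<Rightarrow> nat \<Rightarrow> nat \<Rightarrow> (nat \<Rightarrow> nat) \<Rightarrow> (query \<Rightarrow> nat) \<Rightarrow> batch \<Rightarrow> real" where
  "cross_estimate n t b L \<delta> \<psi> = (\<lambda>(xs, ys). (\<Sum>i<L. \<Sum>j<L. 2 ^ i * (2 ^ j *
     polarize \<psi> (load_digit n t \<delta> xs i) (load_digit n t \<delta> ys j))) / (real b)\<^sup>2)"

text \<open>The first test certifies that \<open>d\<close> is at most of the order of
  \<open>b\<close>, where the mean inverse degree is reliable; the second that a constant part of
  the edges survives the truncation. The value \<open>4 * n * r / z\<close> solves
  \<open>\<mu> t = 4 * n * R t / d\<close> for \<open>d\<close>.\<close>

definition verdict :: "nat \<Rightarrow> nat \<Rightarrow> real \<Rightarrow> real \<Rightarrow> real \<Rightarrow> real option" where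
  "verdict n b a r z = (if 1 / (2 * real b) \<le> a then Some (1 / a)
     else if 1 / 16 \<le> r then Some (4 * n * r / z) else None)"

definition stage ::
  "nat \<Rightarrow> real \<Rightarrow> nat \<Rightarrow> nat \<Rightarrow> nat \<Rightarrow> (real option \<Rightarrow> algorithm) \<Rightarrow> algorithm" where
  "stage n t k b L K = sample_batches k b (\<lambda>bs.
     ask_all (map Degree (sorted_list_of_set (\<Union>(batch_verts ` set bs)))) (\<lambda>\<phi>.
     ask_all (concat (map (batch_queries n t L (\<lambda>v. \<phi> (Degree v))) bs)) (\<lambda>\<psi>.
       K (verdict n b
         (mean (\<lambda>(xs, ys). (\<Sum>x\<leftarrow>xs. inv_deg (\<lambda>v. \<phi> (Degree v)) x) / b) bs)
         (mean (\<lambda>(xs, ys). (\<Sum>x\<leftarrow>xs. heavy n t (\<lambda>v. \<phi> (Degree v)) x) / b) bs)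
         (mean (cross_estimate n t b L (\<lambda>v. \<phi> (Degree v)) \<psi>) bs)))))"

text \<open>With \<open>b = 2 ^ j\<close> the truncation is \<open>n / (4 * b^2)\<close>: it drops
  to \<open>d / 4\<close>, as \<open>R_lower\<close> requires, once \<open>b\<close> reaches
  \<open>sqrt (n / d)\<close>, and while \<open>b\<close> is small it keeps the weights small.
  \<open>Output 0\<close> is reached only when no stage has given a verdict.\<close>

primrec search :: "nat \<Rightarrow> nat \<Rightarrow> nat \<Rightarrow> nat \<Rightarrow> nat \<Rightarrow> algorithm" where
  "search n k L 0 j = Output 0"
| "search n k L (Suc i) j = stage n (n / (4 * (2 ^ j)\<^sup>2)) k (2 ^ j) L
     (\<lambda>v. case v of Some r \<Rightarrow> Output r | None \<Rightarrow> search n k L i (Suc j))"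

lemma batch_queries_Additive: "set (batch_queries n t L \<delta> z) \<subseteq> range Additive"
  by (auto simp: batch_queries_def digit_queries_def split: prod.splits)

lemma batch_queries_Additive': "set (concat (map (batch_queries n t L \<delta>) bs)) \<subseteq> range Additive"
proof
  fix q assume "q \<in> set (concat (map (batch_queries n t L \<delta>) bs))"
  then obtain z where "q \<in> set (batch_queries n t L \<delta> z)" by auto
  then show "q \<in> range Additive" by (rule subsetD[OF batch_queries_Additive])
qed

lemma uses_only_stage:
  assumes "\<And>v. uses_only additive_queries (K v)"
  shows "uses_only additive_queries (stage n t k b L K)"
proof -
  have 1: "RandEdge \<in> additive_queries" by (simp add: additive_queries_def basic_queries_def)
  have 2: "set (map Degree xs) \<subseteq> additive_queries" for xs
    by (auto simp: additive_queries_def basic_queries_def)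
  have 3: "set (concat (map (batch_queries n t L \<delta>) bs)) \<subseteq> additive_queries" for \<delta> bs
    by (rule subset_trans[OF batch_queries_Additive']) (simp add: additive_queries_def)
  show ?thesis unfolding stage_def
    by (rule uses_only_sample_batches[OF 1], rule uses_only_ask_all[OF 2], rule uses_only_ask_all[OF 3], rule assms)
qed

lemma uses_only_search: "uses_only additive_queries (search n k L i j)"
proof (induction i arbitrary: j)
  case (Suc i)
  show ?case unfolding search.simps
    by (rule uses_only_stage) (simp add: Suc split: option.split)
qed simp

lemma load_cong:
  assumes "\<delta> v = \<delta>' v" shows "load n t \<delta> xs v = load n t \<delta>' xs v"
proof -
  have "trunc_weight n t \<delta> v = trunc_weight n t \<delta>' v" using assms by (simp add: trunc_weight_def)
  then show ?thesis by (simp only: load_def)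
qed

lemma load_digit_cong:
  assumes "\<And>v. v \<in> \<Union>(set xs) \<Longrightarrow> \<delta> v = \<delta>' v"
  shows "load_digit n t \<delta> xs i = load_digit n t \<delta>' xs i"
proof -
  have "load n t \<delta> xs v = load n t \<delta>' xs v" if "v \<in> \<Union>(set xs)" for v
    by (rule load_cong) (rule assms[OF that])
  then show ?thesis unfolding load_digit_def digit_def
    by (intro Collect_cong conj_cong refl) (simp only:)
qed

lemma finite_digit: "finite X \<Longrightarrow> finite (digit w X i)"
  by (simp add: digit_def)

lemma load_le: "load n t \<delta> xs v \<le> length xs * n"
proof (induction xs)
  case (Cons e xs)
  have "(if v \<in> e then trunc_weight n t \<delta> v else 0) \<le> n" by (simp add: trunc_weight_def)
  then show ?case using Cons by (simp add: load_def)
qed (simp add: load_def)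

lemma sum_list_edges_eq_load:
  fixes \<psi> :: "nat \<Rightarrow> real"
  assumes "finite X" "\<Union>(set xs) \<subseteq> X"
  shows "(\<Sum>e\<leftarrow>xs. \<Sum>v\<in>e. trunc_weight n t \<delta> v * \<psi> v) = (\<Sum>v\<in>X. load n t \<delta> xs v * \<psi> v)"
  using assms(2)
proof (induction xs)
  case (Cons e xs)
  have e: "e \<subseteq> X" using Cons.prems by simp
  have "(\<Sum>v\<in>X. load n t \<delta> (e # xs) v * \<psi> v)
     = (\<Sum>v\<in>X. (if v \<in> e then trunc_weight n t \<delta> v * \<psi> v else 0) + load n t \<delta> xs v * \<psi> v)"
    by (intro sum.cong) (auto simp: load_def algebra_simps)
  also have "\<dots> = (\<Sum>v\<in>e. trunc_weight n t \<delta> v * \<psi> v) + (\<Sum>v\<in>X. load n t \<delta> xs v * \<psi> v)"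
    using assms(1) e by (simp add: sum.distrib sum.If_cases Int_absorb1)
  finally show ?case using Cons by simp
qed (simp add: load_def)

lemma sum_list_le_length:
  "(\<And>x. x \<in> set xs \<Longrightarrow> F x \<le> (c :: nat)) \<Longrightarrow> sum_list (map F xs) \<le> length xs * c"
  by (induction xs) (auto intro!: add_mono)

context simple_graph_without_isolated
begin

definition "true_verdict t b bs = verdict n b
   (mean (\<lambda>(xs, ys). (\<Sum>x\<leftarrow>xs. inv_deg (\<lambda>v. deg v) x) / b) bs)
   (mean (\<lambda>(xs, ys). (\<Sum>x\<leftarrow>xs. hv t x) / b) bs) (mean (cross_mean t b) bs)"

text \<open>The double sum over the samples is bilinear in the two loads. Each load is expanded in
  binary digits, and each pair of digit sets is evaluated by polarisation. \<open>L\<close> digits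
  suffice because a sampled edge adds at most \<open>n\<close> to a load.\<close>

lemma cross_estimate_eq:
  assumes xs: "set xs \<subseteq> E" "length xs * n < 2 ^ L" and ys: "set ys \<subseteq> E" "length ys * n < 2 ^ L"
    and \<delta>: "\<And>v. v \<in> batch_verts (xs, ys) \<Longrightarrow> \<delta> v = deg v"
    and \<psi>: "\<And>q. q \<in> set (batch_queries n t L \<delta> (xs, ys)) \<Longrightarrow> \<psi> q = counted G q"
  shows "cross_estimate n t b L \<delta> \<psi> (xs, ys) = cross_mean t b (xs, ys)"
proof -
  let ?X = "\<Union>(set xs)" let ?Y = "\<Union>(set ys)"
  let ?S = "load_digit n t \<delta> xs" let ?T = "load_digit n t \<delta> ys"
  have fin: "finite ?X" "finite ?Y"
  proof -
    have "?X \<subseteq> V" "?Y \<subseteq> V" using xs(1) ys(1) edge by blast+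
    then show "finite ?X" "finite ?Y" using finite_V finite_subset by blast+
  qed
  have dx: "?S i = digit (load n t (\<lambda>v. deg v) xs) ?X i" for i
    using load_digit_cong[of xs \<delta> "\<lambda>v. deg v" n t i] \<delta> by (simp add: batch_verts_def load_digit_def)
  have dy: "?T i = digit (load n t (\<lambda>v. deg v) ys) ?Y i" for i
    using load_digit_cong[of ys \<delta> "\<lambda>v. deg v" n t i] \<delta> by (simp add: batch_verts_def load_digit_def)
  have finST: "finite (?S i)" "finite (?T i)" for i
    unfolding dx dy by (rule finite_digit, rule fin)+
  have pol: "polarize \<psi> (?S i) (?T j) = cross (?S i) (?T j)" if ij: "i < L" "j < L" for i j
  proof -
    have "set (digit_queries (?S i) (?T j)) \<subseteq> set (batch_queries n t L \<delta> (xs, ys))"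
      using ij by (force simp: batch_queries_def)
    then have "\<psi> q = counted G q" if "q \<in> set (digit_queries (?S i) (?T j))" for q
      using \<psi> that by blast
    then show ?thesis
      unfolding cross_eq_induced[OF finST] polarize_def by (simp add: digit_queries_def)
  qed
  have lx: "load n t (\<lambda>v. deg v) xs v < 2 ^ L" and ly: "load n t (\<lambda>v. deg v) ys v < 2 ^ L" for v
    using load_le[of n t "\<lambda>v. deg v" xs v] load_le[of n t "\<lambda>v. deg v" ys v] xs(2) ys(2) by linarith+
  have "(\<Sum>x\<leftarrow>xs. \<Sum>y\<leftarrow>ys. f t x y)
      = (\<Sum>x\<leftarrow>xs. \<Sum>u\<in>x. g t u * (\<Sum>v\<in>?Y. load n t (\<lambda>v. deg v) ys v * adj u v))"
  proof (rule arg_cong[of _ _ sum_list], rule map_cong[OF refl])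
    fix x
    have "(\<Sum>y\<leftarrow>ys. f t x y) = (\<Sum>y\<leftarrow>ys. \<Sum>u\<in>x. g t u * (\<Sum>v\<in>y. g t v * adj u v))"
      by (simp add: f_def sum_distrib_left mult.assoc)
    also have "\<dots> = (\<Sum>u\<in>x. g t u * (\<Sum>y\<leftarrow>ys. \<Sum>v\<in>y. g t v * adj u v))"
    proof (induction ys)
      case (Cons y ys)
      then show ?case by (simp add: distrib_left sum.distrib)
    qed simp
    also have "\<dots> = (\<Sum>u\<in>x. g t u * (\<Sum>v\<in>?Y. load n t (\<lambda>v. deg v) ys v * adj u v))"
      by (simp only: sum_list_edges_eq_load[OF fin(2) subset_refl])
    finally show "(\<Sum>y\<leftarrow>ys. f t x y) = (\<Sum>u\<in>x. g t u * (\<Sum>v\<in>?Y. load n t (\<lambda>v. deg v) ys v * adj u v))" .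
  qed
  also have "\<dots> = (\<Sum>u\<in>?X. load n t (\<lambda>v. deg v) xs u * (\<Sum>v\<in>?Y. load n t (\<lambda>v. deg v) ys v * adj u v))"
    by (rule sum_list_edges_eq_load[OF fin(1) subset_refl])
  also have "\<dots> = (\<Sum>i<L. 2 ^ i * (\<Sum>u\<in>?S i. \<Sum>v\<in>?Y. load n t (\<lambda>v. deg v) ys v * adj u v))"
    unfolding dx using lx by (intro sum_digit[OF fin(1)])
  also have "\<dots> = (\<Sum>i<L. 2 ^ i * (\<Sum>u\<in>?S i. \<Sum>j<L. 2 ^ j * (\<Sum>v\<in>?T j. adj u v)))"
    unfolding dy using sum_digit[OF fin(2) ly, of "\<lambda>v. v" "\<lambda>_. 0"] ly by (simp only: sum_digit[OF fin(2) ly])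
  also have "\<dots> = (\<Sum>i<L. 2 ^ i * (\<Sum>j<L. 2 ^ j * cross (?S i) (?T j)))"
    unfolding cross_def by (subst sum.swap) (simp add: sum_distrib_left)
  also have "\<dots> = (\<Sum>i<L. \<Sum>j<L. 2 ^ i * (2 ^ j * polarize \<psi> (?S i) (?T j)))"
    by (simp add: pol sum_distrib_left)
  finally show ?thesis by (simp add: cross_estimate_def cross_mean_def)
qed

lemma batch_props:
  assumes "(xs, ys) \<in> set_pmf (D b)"
  shows "set xs \<subseteq> E" "length xs = b" "set ys \<subseteq> E" "length ys = b"
  using assms by (auto simp: batch_pmf_def set_replicate_pmf set_P)

lemma batch_verts_props:
  assumes "z \<in> set_pmf (D b)"
  shows "finite (batch_verts z)" "card (batch_verts z) \<le> 4 * b"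
proof -
  obtain xs ys where z: "z = (xs, ys)" by (cases z)
  note p = batch_props[OF assms[unfolded z]]
  have *: "finite (\<Union>(set xs)) \<and> card (\<Union>(set xs)) \<le> 2 * length xs" if "set xs \<subseteq> E" for xs
    using that
  proof (induction xs)
    case (Cons e xs)
    have "card (e \<union> \<Union>(set xs)) \<le> card e + card (\<Union>(set xs))" by (rule card_Un_le)
    moreover have "finite e" "card e = 2" using Cons.prems edge[of e] finite_V finite_subset by auto
    ultimately show ?case using Cons by simp
  qed simp
  show "finite (batch_verts z)" using * p by (simp add: z batch_verts_def)
  have "card (batch_verts z) \<le> card (\<Union>(set xs)) + card (\<Union>(set ys))"
    unfolding z batch_verts_def using card_Un_le by simp
  then show "card (batch_verts z) \<le> 4 * b" using *[OF p(1)] *[OF p(3)] p by simp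
qed

lemma query_args_batch_queries:
  assumes "q \<in> set (batch_queries n t L \<delta> z)"
  shows "query_args q \<subseteq> batch_verts z" "query_cost q = card (query_args q)"
proof -
  obtain xs ys where z: "z = (xs, ys)" by (cases z)
  obtain i j where ij: "q \<in> set (digit_queries (load_digit n t \<delta> xs i) (load_digit n t \<delta> ys j))"
    using assms by (auto simp: batch_queries_def z)
  then obtain S where S: "q = Additive S" "S \<subseteq> load_digit n t \<delta> xs i \<union> load_digit n t \<delta> ys j"
    by (auto simp: digit_queries_def)
  have "load_digit n t \<delta> zs i \<subseteq> \<Union>(set zs)" for zs i by (auto simp: load_digit_def digit_def)
  then have "S \<subseteq> \<Union>(set xs) \<union> \<Union>(set ys)" using S(2) by blast
  then show "query_args q \<subseteq> batch_verts z" by (simp add: S(1) z batch_verts_def)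
  show "query_cost q = card (query_args q)" by (simp add: S(1))
qed

text \<open>The 22 is \<open>2 + 4 + 16\<close>: \<open>2 * k * b\<close> random edges, at most
  \<open>4 * k * b\<close> degree queries, and per batch \<open>4 * L^2\<close> additive queries on
  at most \<open>4 * b\<close> vertices each. The cost is a function of the sample, as sampled edges
  may share vertices.\<close>

lemma run_stage:
  assumes L: "b * n < 2 ^ L" and L1: "1 \<le> L"
  shows "\<exists>cost. (\<forall>bs\<in>set_pmf (replicate_pmf k (D b)). cost bs \<le> 22 * k * b * L\<^sup>2) \<and>
    (\<forall>K seen. run_from G (stage n t k b L K) seen = bind_pmf (replicate_pmf k (D b))
       (\<lambda>bs. add_cost (cost bs) (run_from G (K (true_verdict t b bs)) (seen \<union> \<Union>(batch_verts ` set bs)))))"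
proof -
  let ?W = "\<lambda>bs. \<Union>(batch_verts ` set bs)"
  let ?dq = "\<lambda>bs. map Degree (sorted_list_of_set (?W bs))"
  define \<delta> where "\<delta> = (\<lambda>bs v. if Degree v \<in> set (?dq bs) then counted G (Degree v) else 0)"
  let ?aq = "\<lambda>bs. concat (map (batch_queries n t L (\<delta> bs)) bs)"
  define cost where "cost = (\<lambda>bs. 2 * k * b + (sum_list (map query_cost (?dq bs)) + sum_list (map query_cost (?aq bs))))"
  have supp: "length bs = k \<and> set bs \<subseteq> set_pmf (D b)" if "bs \<in> set_pmf (replicate_pmf k (D b))" for bs
    using that by (auto simp: set_replicate_pmf)
  have W: "finite (?W bs)" "card (?W bs) \<le> k * (4 * b)" if bs: "bs \<in> set_pmf (replicate_pmf k (D b))" for bs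
  proof -
    show "finite (?W bs)" using supp[OF bs] batch_verts_props(1) by blast
    have "card (?W bs) \<le> (\<Sum>z\<in>set bs. card (batch_verts z))" by (rule card_UN_le) simp
    also have "\<dots> \<le> (\<Sum>z\<in>set bs. 4 * b)" using supp[OF bs] batch_verts_props(2) by (intro sum_mono) blast
    also have "\<dots> \<le> k * (4 * b)" using supp[OF bs] card_length[of bs] by simp
    finally show "card (?W bs) \<le> k * (4 * b)" .
  qed
  show ?thesis
  proof (intro exI[of _ cost] conjI ballI allI)
    fix bs assume bs: "bs \<in> set_pmf (replicate_pmf k (D b))"
    have "sum_list (map query_cost (?dq bs)) \<le> length (?dq bs) * 1"
      by (rule sum_list_le_length) auto
    also have "\<dots> \<le> k * (4 * b)" using W[OF bs] by simp
    also have "\<dots> = 4 * (k * b)" by simp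
    finally have 1: "sum_list (map query_cost (?dq bs)) \<le> 4 * (k * b)" .
    have "sum_list (map query_cost (?aq bs)) \<le> length (?aq bs) * (4 * b)"
    proof (rule sum_list_le_length)
      fix q assume "q \<in> set (?aq bs)"
      then obtain z where z: "z \<in> set bs" "q \<in> set (batch_queries n t L (\<delta> bs) z)" by auto
      then have "z \<in> set_pmf (D b)" using supp[OF bs] by blast
      then show "query_cost q \<le> 4 * b"
        using query_args_batch_queries[OF z(2)] batch_verts_props[of z b] card_mono le_trans by metis
    qed
    also have "length (?aq bs) = k * (4 * L\<^sup>2)"
    proof -
      have "length (batch_queries n t L (\<delta> bs) z) = 4 * L\<^sup>2" for z
        by (cases z) (simp add: batch_queries_def digit_queries_def length_concat o_def case_prod_unfold
            sum_list_triv power2_eq_square)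
      then show ?thesis using supp[OF bs] by (simp add: length_concat o_def sum_list_triv)
    qed
    also have "k * (4 * L\<^sup>2) * (4 * b) = 16 * (k * b * L\<^sup>2)" by simp
    finally have 2: "sum_list (map query_cost (?aq bs)) \<le> 16 * (k * b * L\<^sup>2)" .
    have "1 \<le> L\<^sup>2" using L1 by simp
    then have "k * b * 1 \<le> k * b * L\<^sup>2" by (intro mult_le_mono2)
    moreover have "2 * k * b = 2 * (k * b)" "22 * k * b * L\<^sup>2 = 22 * (k * b * L\<^sup>2)" by simp_all
    ultimately show "cost bs \<le> 22 * k * b * L\<^sup>2" using 1 2 unfolding cost_def by linarith
  next
    fix K seen
    show "run_from G (stage n t k b L K) seen = bind_pmf (replicate_pmf k (D b))
       (\<lambda>bs. add_cost (cost bs) (run_from G (K (true_verdict t b bs)) (seen \<union> ?W bs)))"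
      unfolding stage_def run_sample_batches[OF finite_E E_nonempty]
    proof (rule bind_pmf_cong[OF refl])
      fix bs assume bs: "bs \<in> set_pmf (replicate_pmf k (D b))"
      have deg: "\<delta> bs v = deg v" if "v \<in> ?W bs" for v
        using that W[OF bs] by (auto simp: \<delta>_def)
      let ?\<psi> = "\<lambda>q. if q \<in> set (?aq bs) then counted G q else 0"
      have in_W: "batch_verts z \<subseteq> ?W bs" if "z \<in> set bs" for z using that by blast
      have v1: "mean (\<lambda>(xs, ys). (\<Sum>x\<leftarrow>xs. inv_deg (\<delta> bs) x) / b) bs
          = mean (\<lambda>(xs, ys). (\<Sum>x\<leftarrow>xs. inv_deg (\<lambda>v. deg v) x) / b) bs"
      proof -
        have "inv_deg (\<delta> bs) x = inv_deg (\<lambda>v. deg v) x" if "(xs, ys) \<in> set bs" "x \<in> set xs" for xs ys x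
          unfolding inv_deg_def
        proof (rule sum.cong[OF refl])
          fix v assume "v \<in> x"
          then have "v \<in> batch_verts (xs, ys)" using that(2) by (auto simp: batch_verts_def)
          then have "v \<in> ?W bs" using in_W[OF that(1)] by blast
          then show "1 / (2 * real (\<delta> bs v)) = 1 / (2 * real (deg v))" by (simp only: deg)
        qed
        then show ?thesis unfolding mean_def
          by (intro arg_cong[where f="\<lambda>x. x / _"] arg_cong[where f=sum_list] map_cong refl)
            (auto intro!: arg_cong[where f="\<lambda>x. x / _"] arg_cong[where f=sum_list] map_cong)
      qed
      have v2: "mean (\<lambda>(xs, ys). (\<Sum>x\<leftarrow>xs. heavy n t (\<delta> bs) x) / b) bs
          = mean (\<lambda>(xs, ys). (\<Sum>x\<leftarrow>xs. hv t x) / b) bs"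
      proof -
        have "heavy n t (\<delta> bs) x = hv t x" if "(xs, ys) \<in> set bs" "x \<in> set xs" for xs ys x
          unfolding heavy_def
        proof (rule prod.cong[OF refl])
          fix v assume "v \<in> x"
          then have "v \<in> batch_verts (xs, ys)" using that(2) by (auto simp: batch_verts_def)
          then have "v \<in> ?W bs" using in_W[OF that(1)] by blast
          then show "real (\<delta> bs v * trunc_weight n t (\<delta> bs) v) / n = real (deg v * g t v) / n"
            by (simp only: deg trunc_weight_def)
        qed
        then show ?thesis unfolding mean_def
          by (intro arg_cong[where f="\<lambda>x. x / _"] arg_cong[where f=sum_list] map_cong refl)
            (auto intro!: arg_cong[where f="\<lambda>x. x / _"] arg_cong[where f=sum_list] map_cong)
      qed
      have v3: "mean (cross_estimate n t b L (\<delta> bs) ?\<psi>) bs = mean (cross_mean t b) bs"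
      proof -
        have "cross_estimate n t b L (\<delta> bs) ?\<psi> z = cross_mean t b z" if z: "z \<in> set bs" for z
        proof -
          obtain xs ys where xy: "z = (xs, ys)" by (cases z)
          then have "(xs, ys) \<in> set_pmf (D b)" using z supp[OF bs] by blast
          note p = batch_props[OF this]
          show ?thesis unfolding xy
          proof (rule cross_estimate_eq)
            show "\<delta> bs v = deg v" if "v \<in> batch_verts (xs, ys)" for v
              using deg in_W[OF z] that xy by blast
            show "?\<psi> q = counted G q" if "q \<in> set (batch_queries n t L (\<delta> bs) (xs, ys))" for q
              using that z xy by auto
          qed (use p L in auto)
        qed
        then show ?thesis unfolding mean_def
          by (intro arg_cong[where f="\<lambda>x. x / _"] arg_cong[where f=sum_list] map_cong refl)
      qed
      let ?K\<psi> = "\<lambda>\<delta> \<psi>. K (verdict n b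
            (mean (\<lambda>(xs, ys). (\<Sum>x\<leftarrow>xs. inv_deg \<delta> x) / b) bs)
            (mean (\<lambda>(xs, ys). (\<Sum>x\<leftarrow>xs. heavy n t \<delta> x) / b) bs)
            (mean (cross_estimate n t b L \<delta> \<psi>) bs))"
      let ?K\<phi> = "\<lambda>\<phi>. ask_all (concat (map (batch_queries n t L (\<lambda>v. \<phi> (Degree v))) bs))
         (?K\<psi> (\<lambda>v. \<phi> (Degree v)))"
      have "run_from G (ask_all (?dq bs) ?K\<phi>) (seen \<union> ?W bs)
        = add_cost (sum_list (map query_cost (?dq bs)))
           (run_from G (?K\<phi> (\<lambda>q. if q \<in> set (?dq bs) then counted G q else 0)) (seen \<union> ?W bs))"
        using W[OF bs] by (intro run_ask_all) auto
      also have "?K\<phi> (\<lambda>q. if q \<in> set (?dq bs) then counted G q else 0) = ask_all (?aq bs) (?K\<psi> (\<delta> bs))"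
        by (simp only: \<delta>_def)
      also have "run_from G (ask_all (?aq bs) (?K\<psi> (\<delta> bs))) (seen \<union> ?W bs)
        = add_cost (sum_list (map query_cost (?aq bs)))
           (run_from G (?K\<psi> (\<delta> bs) ?\<psi>) (seen \<union> ?W bs))"
      proof (rule run_ask_all)
        show "set (?aq bs) \<subseteq> range Degree \<union> range Additive"
          by (rule subset_trans[OF batch_queries_Additive']) simp
        show "query_args q \<subseteq> seen \<union> ?W bs" if q: "q \<in> set (?aq bs)" for q
        proof -
          obtain z where z: "z \<in> set bs" "q \<in> set (batch_queries n t L (\<delta> bs) z)" using q by auto
          show ?thesis using query_args_batch_queries(1)[OF z(2)] in_W[OF z(1)] by blast
        qed
      qed
      also have "?K\<psi> (\<delta> bs) ?\<psi> = K (true_verdict t b bs)"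
        by (simp only: v1 v2 v3 true_verdict_def)
      finally have "run_from G (ask_all (?dq bs) ?K\<phi>) (seen \<union> ?W bs)
        = add_cost (sum_list (map query_cost (?dq bs))) (add_cost (sum_list (map query_cost (?aq bs)))
            (run_from G (K (true_verdict t b bs)) (seen \<union> ?W bs)))" .
      then show "add_cost (2 * k * b) (run_from G (ask_all (?dq bs) ?K\<phi>) (seen \<union> ?W bs))
        = add_cost (cost bs) (run_from G (K (true_verdict t b bs)) (seen \<union> ?W bs))"
        by (simp only: add_cost_add_cost cost_def add.assoc)
    qed
  qed
qed

end

section \<open>Accuracy, stopping and cost of the search\<close>

lemma prob_bind_ge:
  assumes bad: "measure_pmf.prob p {x. \<not> Good x} \<le> \<eta>" and \<eta>': "0 \<le> \<eta>'"
    and good: "\<And>x. x \<in> set_pmf p \<Longrightarrow> Good x \<Longrightarrow> 1 - \<eta>' \<le> measure_pmf.prob (q x) X"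
  shows "1 - \<eta>' - \<eta> \<le> measure_pmf.prob (bind_pmf p q) X"
proof -
  have int: "integrable (measure_pmf p) (\<lambda>x. 1 - \<eta>' - indicator {x. \<not> Good x} x)"
    by (intro Bochner_Integration.integrable_diff) (auto intro!: measure_pmf.integrable_const_bound[where B=1])
  have "1 - \<eta>' - \<eta> \<le> 1 - \<eta>' - measure_pmf.prob p {x. \<not> Good x}" using bad by simp
  also have "\<dots> = measure_pmf.expectation p (\<lambda>x. 1 - \<eta>' - indicator {x. \<not> Good x} x)"
    by (subst Bochner_Integration.integral_diff) (auto intro!: measure_pmf.integrable_const_bound[where B=1])
  also have "\<dots> \<le> measure_pmf.expectation p (\<lambda>x. measure_pmf.prob (q x) X)"
  proof (rule integral_mono_AE[OF int])
    have "1 - \<eta>' - indicator {x. \<not> Good x} x \<le> measure_pmf.prob (q x) X" if "x \<in> set_pmf p" for x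
      using good[OF that] \<eta>' by (cases "Good x") (auto intro: order_trans[of _ 0])
    then show "AE x in p. 1 - \<eta>' - indicator {x. \<not> Good x} x \<le> measure_pmf.prob (q x) X"
      by (simp add: AE_measure_pmf_iff)
  qed simp
  finally show ?thesis by (simp only: measure_bind_pmf)
qed

text \<open>If \<open>1 / b\<close> were much larger than \<open>1 / d\<close>, the deviation bound
  would force \<open>a\<close> below \<open>1 / (2 * b)\<close>. So the test makes the error
  relative to \<open>1 / d\<close>, of size at most \<open>\<epsilon> / 2\<close>, which leaves room
  for the inversion.\<close>

lemma inverse_estimate:
  fixes a b d \<epsilon> :: real
  assumes d: "0 < d" and b: "0 < b" and \<epsilon>: "0 < \<epsilon>" "\<epsilon> < 1"
    and dev: "\<bar>a - 1 / d\<bar> < \<epsilon> / 8 * max (1 / d) (1 / b)" and a: "1 / (2 * b) \<le> a"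
  shows "1 / a \<in> {(1 - \<epsilon>) * d .. (1 + \<epsilon>) * d}"
proof -
  define p where "p = 1 / d"
  define q where "q = 1 / b"
  have p: "0 < p" "p * d = 1" and q: "0 < q" using d b by (simp_all add: p_def q_def)
  have aq: "q / 2 \<le> a" using a by (simp add: q_def)
  have dev: "\<bar>a - p\<bar> < \<epsilon> / 8 * max p q" using dev by (simp only: p_def q_def)
  have "max p q \<le> 4 * p"
  proof (cases "q \<le> p")
    case False
    then have "max p q = q" by simp
    then have "\<bar>a - p\<bar> < \<epsilon> / 8 * q" using dev by (simp only:)
    then have "a - p < \<epsilon> / 8 * q" by linarith
    also have "\<dots> \<le> 1 / 8 * q" using \<epsilon> q by (intro mult_right_mono) auto
    finally show ?thesis using aq False q p by linarith
  qed (use p in simp)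
  then have "\<epsilon> / 8 * max p q \<le> \<epsilon> / 8 * (4 * p)" using \<epsilon> by (intro mult_left_mono) auto
  then have ap: "\<bar>a - p\<bar> < \<epsilon> / 2 * p" using dev by simp
  have expand: "(1 - \<epsilon> / 2) * y = y - \<epsilon> / 2 * y" "(1 + \<epsilon> / 2) * y = y + \<epsilon> / 2 * y" for y
    by (simp_all add: left_diff_distrib distrib_right)
  have 1: "(1 - \<epsilon> / 2) * p < a" "a < (1 + \<epsilon> / 2) * p"
    unfolding expand using ap by linarith+
  have "(1 - \<epsilon> / 2) * p * d < a * d" "a * d < (1 + \<epsilon> / 2) * p * d"
    by (rule mult_strict_right_mono[OF 1(1) d], rule mult_strict_right_mono[OF 1(2) d])
  then have ad: "1 - \<epsilon> / 2 < a * d" "a * d < 1 + \<epsilon> / 2" using p by (simp_all only: mult.assoc mult_1_right)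
  have a0: "0 < a" using aq q by linarith
  have "\<epsilon> * \<epsilon> \<le> \<epsilon> * 1" using \<epsilon> by (intro mult_left_mono) auto
  have "(1 - \<epsilon>) * (a * d) \<le> (1 - \<epsilon>) * (1 + \<epsilon> / 2)" using ad \<epsilon> by (intro mult_left_mono) auto
  also have "\<dots> = 1 - \<epsilon> / 2 - \<epsilon> * \<epsilon> / 2" by (simp add: field_simps)
  also have "\<dots> \<le> 1" using \<epsilon> mult_pos_pos[OF \<epsilon>(1) \<epsilon>(1)] by linarith
  finally have lo: "(1 - \<epsilon>) * d * a \<le> 1" by (simp only: mult_ac)
  have "1 \<le> 1 + \<epsilon> / 2 - \<epsilon> * \<epsilon> / 2" using \<open>\<epsilon> * \<epsilon> \<le> \<epsilon> * 1\<close> by simp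
  also have "\<dots> = (1 + \<epsilon>) * (1 - \<epsilon> / 2)" by (simp add: field_simps)
  also have "\<dots> \<le> (1 + \<epsilon>) * (a * d)" using ad \<epsilon> by (intro mult_left_mono) auto
  finally have hi: "1 \<le> (1 + \<epsilon>) * d * a" by (simp only: mult_ac)
  show ?thesis using lo hi a0 by (simp add: pos_le_divide_eq pos_divide_le_eq)
qed

lemma ratio_estimate:
  fixes c r R z \<mu> d \<epsilon> :: real
  assumes d: "0 < d" and \<epsilon>: "0 < \<epsilon>" "\<epsilon> < 1" and R: "0 < R" and \<mu>: "0 < \<mu>" and c: "0 \<le> c" "c * R = d * \<mu>"
    and r: "\<bar>r - R\<bar> \<le> \<epsilon> / 8 * R" and z: "\<bar>z - \<mu>\<bar> \<le> \<epsilon> / 8 * \<mu>"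
  shows "c * r / z \<in> {(1 - \<epsilon>) * d .. (1 + \<epsilon>) * d}"
proof -
  define e where "e = \<epsilon> / 8"
  have e: "0 < e" "8 * e = \<epsilon>" "e \<le> 1/8" using \<epsilon> by (auto simp: e_def)
  have expand: "(1 - e) * y = y - e * y" "(1 + e) * y = y + e * y" for y
    by (simp_all add: left_diff_distrib distrib_right)
  have r': "(1 - e) * R \<le> r" "r \<le> (1 + e) * R"
    unfolding expand using r[folded e_def] by linarith+
  have z': "(1 - e) * \<mu> \<le> z" "z \<le> (1 + e) * \<mu>"
    unfolding expand using z[folded e_def] by linarith+
  have "0 < (1 - e) * \<mu>" using e \<mu> by simp
  then have z0: "0 < z" using z' by linarith
  have cR: "0 \<le> c * R" using c(1) R by (intro mult_nonneg_nonneg) auto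
  have ee: "e * e \<le> e * (1/8)" using e by (intro mult_left_mono) auto
  have "(1 - 8 * e) * d * z \<le> (1 - 8 * e) * d * ((1 + e) * \<mu>)"
    using z' e d by (intro mult_left_mono) auto
  also have "\<dots> = (1 - 8 * e) * (1 + e) * (c * R)" unfolding c(2) by simp
  also have "\<dots> \<le> (1 - e) * (c * R)"
  proof (rule mult_right_mono[OF _ cR])
    have "(1 - 8 * e) * (1 + e) = 1 - 7 * e - 8 * (e * e)" by (simp add: algebra_simps)
    then show "(1 - 8 * e) * (1 + e) \<le> 1 - e" using e by (smt (verit) mult_pos_pos)
  qed
  also have "\<dots> = c * ((1 - e) * R)" by simp
  also have "\<dots> \<le> c * r" using r' c by (intro mult_left_mono) auto
  finally have lo: "(1 - \<epsilon>) * d * z \<le> c * r" unfolding e(2) .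
  have "c * r \<le> c * ((1 + e) * R)" using r' c by (intro mult_left_mono) auto
  also have "\<dots> = (1 + e) * (c * R)" by simp
  also have "\<dots> \<le> (1 + 8 * e) * (1 - e) * (c * R)"
  proof (rule mult_right_mono[OF _ cR])
    have "(1 + 8 * e) * (1 - e) = 1 + 7 * e - 8 * (e * e)" by (simp add: algebra_simps)
    then show "1 + e \<le> (1 + 8 * e) * (1 - e)" using e ee by linarith
  qed
  also have "\<dots> = (1 + 8 * e) * d * ((1 - e) * \<mu>)" unfolding c(2) by simp
  also have "\<dots> \<le> (1 + 8 * e) * d * z" using z' e d by (intro mult_left_mono) auto
  finally have hi: "c * r \<le> (1 + \<epsilon>) * d * z" unfolding e(2) .
  show ?thesis using lo hi z0 by (simp add: pos_le_divide_eq pos_divide_le_eq)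
qed

context simple_graph_without_isolated
begin

abbreviation "accurate \<epsilon> r \<equiv> r \<in> {(1 - \<epsilon>) * d .. (1 + \<epsilon>) * d}"

text \<open>In the second case \<open>1 / 16 \<le> r\<close> and a deviation below 1/256 give
  \<open>1 / 32 \<le> R t\<close>, the condition under which \<open>good_stats\<close> controls the
  cross count; it also turns the deviation of \<open>r\<close> into a relative one.\<close>

lemma true_verdict_accurate:
  assumes \<epsilon>: "0 < \<epsilon>" "\<epsilon> < 1" and b: "0 < b" and good: "good_stats t b \<epsilon> bs"
    and v: "true_verdict t b bs = Some v"
  shows "accurate \<epsilon> v"
proof -
  define a where "a = mean (\<lambda>(xs, ys). (\<Sum>x\<leftarrow>xs. inv_deg (\<lambda>v. deg v) x) / b) bs"
  define r where "r = mean (\<lambda>(xs, ys). (\<Sum>x\<leftarrow>xs. hv t x) / b) bs"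
  define z where "z = mean (cross_mean t b) bs"
  have d0: "0 < d" using d_ge_1 by linarith
  have b0: "0 < real b" using b by simp
  have dev: "\<bar>a - 1 / d\<bar> < \<epsilon> / 8 * max (1 / d) (1 / b)" "\<bar>r - R t\<bar> < \<epsilon> / 256"
    "1 / 32 \<le> R t \<Longrightarrow> \<bar>z - \<mu> t\<bar> < \<epsilon> / 8 * \<mu> t"
    using good unfolding good_stats_def a_def r_def z_def by blast+
  have v: "verdict n b a r z = Some v" using v by (simp only: true_verdict_def a_def r_def z_def)
  show ?thesis
  proof (cases "1 / (2 * real b) \<le> a")
    case True
    then have "v = 1 / a" using v by (simp add: verdict_def)
    then show ?thesis using inverse_estimate[OF d0 b0 \<epsilon> dev(1) True] by (simp only:)
  next
    case False
    then have r: "1 / 16 \<le> r" "v = 4 * n * r / z"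
      using v by (auto simp: verdict_def split: if_splits)
    have R: "1 / 32 \<le> R t" using dev(2) r(1) \<epsilon> by linarith
    have "\<epsilon> / 256 = \<epsilon> / 8 * (1 / 32)" by simp
    also have "\<dots> \<le> \<epsilon> / 8 * R t" using R \<epsilon> by (intro mult_left_mono) auto
    finally have rR: "\<bar>r - R t\<bar> \<le> \<epsilon> / 8 * R t" using dev(2) by linarith
    have R0: "0 < R t" using R by linarith
    have \<mu>: "0 < \<mu> t" unfolding \<mu>_def using R0 m_pos n by simp
    have c: "real (4 * n) * R t = d * \<mu> t" unfolding d_eq \<mu>_def using m_pos n by (simp add: power2_eq_square)
    have "real (4 * n) * r / z \<in> {(1 - \<epsilon>) * d .. (1 + \<epsilon>) * d}"
      by (rule ratio_estimate[OF d0 \<epsilon> R0 \<mu> _ c rR less_imp_le[OF dev(3)[OF R]]]) simp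
    then show ?thesis unfolding r(2) by simp
  qed
qed

text \<open>If \<open>d \<le> b\<close>, then \<open>a\<close> is at least \<open>7 / 8\<close> of
  \<open>1 / d\<close> and passes the first test. If \<open>n \<le> d * b^2\<close>, then
  \<open>4 * t \<le> d\<close>, so \<open>R t\<close> is at least 1/8 and \<open>r\<close> at least
  1/16: the slack between these two absorbs the sampling error.\<close>

lemma true_verdict_decides:
  assumes \<epsilon>: "0 < \<epsilon>" "\<epsilon> < 1" and b: "0 < b" and good: "good_stats t b \<epsilon> bs"
    and t: "t = n / (4 * (real b)\<^sup>2)" and db: "d \<le> b \<or> n \<le> d * (real b)\<^sup>2"
  shows "true_verdict t b bs \<noteq> None"
proof -
  let ?a = "mean (\<lambda>(xs, ys). (\<Sum>x\<leftarrow>xs. inv_deg (\<lambda>v. deg v) x) / b) bs"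
  let ?r = "mean (\<lambda>(xs, ys). (\<Sum>x\<leftarrow>xs. hv t x) / b) bs"
  have d0: "0 < d" using d_ge_1 by simp
  have b0: "0 < real b" using b by simp
  have "1 / (2 * real b) \<le> ?a \<or> 1 / 16 \<le> ?r"
    using db
  proof
    assume "d \<le> b"
    then have inv: "1 / b \<le> 1 / d" using d0 by (intro divide_left_mono) auto
    have "\<bar>?a - 1 / d\<bar> < \<epsilon> / 8 * max (1 / d) (1 / b)" using good by (simp add: good_stats_def)
    also have "max (1 / d) (1 / b) = 1 / d" using inv by simp
    also have "\<epsilon> / 8 * (1 / d) \<le> 1 / 8 * (1 / d)" using \<epsilon> d0 by (intro mult_right_mono) auto
    finally have "7 / 8 * (1 / d) \<le> ?a" by (simp add: abs_less_iff)
    moreover have "1 / 2 * (1 / b) \<le> 7 / 8 * (1 / d)" using inv b0 by (intro mult_mono) auto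
    ultimately show ?thesis by simp
  next
    assume "n \<le> d * (real b)\<^sup>2"
    then have "4 * t \<le> d" unfolding t using b0 by (simp add: field_simps)
    moreover have "0 \<le> t" unfolding t by simp
    ultimately have "1 / 8 \<le> R t" by (rule R_lower)
    moreover have "\<bar>?r - R t\<bar> < \<epsilon> / 256" using good by (simp add: good_stats_def)
    ultimately have "1 / 16 \<le> ?r" using \<epsilon> by linarith
    then show ?thesis ..
  qed
  then show ?thesis by (auto simp: true_verdict_def verdict_def)
qed

text \<open>At level \<open>J\<close> a verdict must come, and \<open>x\<close> levels are left
  before it. Each level fails with probability at most \<eta>, and the costs double, so that they
  sum to a multiple of \<open>2 ^ Suc J - 2 ^ j\<close>. A verdict at an earlier level is just as
  accurate and costs less.\<close>

lemma search_correct: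
  fixes J k L :: nat and \<eta> \<epsilon> :: real
  assumes \<epsilon>: "0 < \<epsilon>" "\<epsilon> < 1" and L: "2 ^ J * n < 2 ^ L" "1 \<le> L" and k: "0 < k"
    and \<eta>: "210000 / (k * \<epsilon>\<^sup>2) \<le> \<eta>"
    and before: "\<And>j. j \<le> J \<Longrightarrow> d * (2 ^ j)\<^sup>2 \<le> 4 * n"
    and at: "d \<le> 2 ^ J \<or> n \<le> d * (2 ^ J)\<^sup>2"
    and j: "J = j + x" and i: "x < i"
  shows "1 - (real x + 1) * \<eta> \<le> measure_pmf.prob (run_from G (search n k L i j) seen)
     {(r, c). accurate \<epsilon> r \<and> c \<le> 22 * k * L\<^sup>2 * (2 ^ Suc J - 2 ^ j)}"
proof -
  define U where "U = 22 * k * L\<^sup>2"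
  define bound where "bound = (\<lambda>j. U * (2 ^ Suc J - 2 ^ j))"
  have "0 \<le> 210000 / (k * \<epsilon>\<^sup>2)" by (intro divide_nonneg_nonneg mult_nonneg_nonneg) auto
  then have \<eta>0: "0 \<le> \<eta>" using \<eta> by linarith
  have bound_ge: "U * 2 ^ j \<le> bound j" if "j \<le> J" for j
  proof -
    have "2 ^ j \<le> (2 :: nat) ^ J" using that by (intro power_increasing) auto
    then have "2 ^ j \<le> (2 :: nat) ^ Suc J - 2 ^ j" unfolding power_Suc by linarith
    then show ?thesis unfolding bound_def by (rule mult_le_mono2)
  qed
  have bound_step: "U * 2 ^ j + bound (Suc j) = bound j" if "j < J" for j
  proof -
    have "2 ^ Suc j \<le> (2 :: nat) ^ Suc J" using that by (intro power_increasing) auto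
    then have "2 ^ j + (2 ^ Suc J - 2 ^ Suc j) = (2 :: nat) ^ Suc J - 2 ^ j" unfolding power_Suc by linarith
    then show ?thesis unfolding bound_def by (metis distrib_left)
  qed
  have "1 - (real x + 1) * \<eta> \<le> measure_pmf.prob (run_from G (search n k L i j) seen)
     {(r, c). accurate \<epsilon> r \<and> c \<le> bound j}"
    using j i
  proof (induction x arbitrary: i j seen rule: less_induct)
    case (less x)
    note J = \<open>J = j + x\<close> and i = \<open>x < i\<close>
    define b :: nat where "b = 2 ^ j"
    define t where "t = real n / (4 * (2 ^ j)\<^sup>2)"
    have t: "t = n / (4 * (real b)\<^sup>2)" by (simp add: t_def b_def)
    obtain i' where i': "i = Suc i'" "x \<le> i'" using i by (cases i) auto
    have jJ: "j \<le> J" using J by linarith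
    have b: "0 < b" by (simp add: b_def)
    have "b \<le> 2 ^ J" unfolding b_def using jJ by (intro power_increasing) auto
    then have "b * n \<le> 2 ^ J * n" by (rule mult_le_mono1)
    then have bL: "b * n < 2 ^ L" using L by linarith
    from run_stage[OF bL L(2), of k t] obtain cost where
      cost: "\<forall>bs\<in>set_pmf (replicate_pmf k (D b)). cost bs \<le> 22 * k * b * L\<^sup>2"
      and run: "\<forall>K seen. run_from G (stage n t k b L K) seen = bind_pmf (replicate_pmf k (D b))
         (\<lambda>bs. add_cost (cost bs) (run_from G (K (true_verdict t b bs)) (seen \<union> \<Union>(batch_verts ` set bs))))"
      by (elim exE conjE) (rule that)
    note run = run[rule_format]
    have "22 * k * b * L\<^sup>2 = U * 2 ^ j" by (simp add: U_def b_def)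
    then have cost: "cost bs \<le> U * 2 ^ j" if "bs \<in> set_pmf (replicate_pmf k (D b))" for bs
      using bspec[OF cost that] by (simp only:)
    have "1 - real x * \<eta> - \<eta> \<le> measure_pmf.prob (run_from G (search n k L i j) seen)
        {(r, c). accurate \<epsilon> r \<and> c \<le> bound j}"
      unfolding i'(1) search.simps t_def[symmetric] b_def[symmetric] run
    proof (rule prob_bind_ge[where Good="good_stats t b \<epsilon>"])
      have "d * (real b)\<^sup>2 \<le> 4 * n" using before[OF jJ] by (simp add: b_def)
      from prob_good_stats[OF b k \<epsilon>(1) t this] \<eta>
      show "measure_pmf.prob (replicate_pmf k (D b)) {bs. \<not> good_stats t b \<epsilon> bs} \<le> \<eta>"
        by (rule order_trans)
      show "0 \<le> real x * \<eta>" using \<eta>0 by simp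
      fix bs assume bs: "bs \<in> set_pmf (replicate_pmf k (D b))" and good: "good_stats t b \<epsilon> bs"
      let ?S = "seen \<union> \<Union>(batch_verts ` set bs)"
      show "1 - real x * \<eta> \<le> measure_pmf.prob (add_cost (cost bs) (run_from G
          (case true_verdict t b bs of None \<Rightarrow> search n k L i' (Suc j) | Some r \<Rightarrow> Output r) ?S))
          {(r, c). accurate \<epsilon> r \<and> c \<le> bound j}"
      proof (cases "true_verdict t b bs")
        case (Some r)
        have "accurate \<epsilon> r" by (rule true_verdict_accurate[OF \<epsilon> b good Some])
        moreover have "cost bs + 0 \<le> bound j" using cost[OF bs] bound_ge[OF jJ] by linarith
        ultimately have "measure_pmf.prob (add_cost (cost bs) (run_from G (Output r) ?S))
            {(r, c). accurate \<epsilon> r \<and> c \<le> bound j} = 1"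
          unfolding prob_add_cost by (simp add: indicator_def)
        then show ?thesis using Some \<eta>0 by simp
      next
        case None
        have x: "x \<noteq> 0"
        proof
          assume "x = 0"
          then have "j = J" using J by simp
          then have "d \<le> b \<or> n \<le> d * (real b)\<^sup>2" using at by (simp add: b_def)
          from true_verdict_decides[OF \<epsilon> b good t this] None show False by simp
        qed
        then have "j < J" using J by simp
        note step = bound_step[OF this]
        have "x - 1 < x" "J = Suc j + (x - 1)" "x - 1 < i'" "real (x - 1) + 1 = real x"
          using x J i'(2) by (simp_all add: of_nat_diff)
        then have "1 - real x * \<eta> \<le> measure_pmf.prob (run_from G (search n k L i' (Suc j)) ?S)
            {(r, c). accurate \<epsilon> r \<and> c \<le> bound (Suc j)}"
          using less.IH[of "x - 1" "Suc j" i' ?S] by (simp only:)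
        also have "\<dots> \<le> measure_pmf.prob (run_from G (search n k L i' (Suc j)) ?S)
            {(r, c). accurate \<epsilon> r \<and> cost bs + c \<le> bound j}"
        proof (intro measure_pmf.finite_measure_mono subsetI)
          fix y assume "y \<in> {(r, c). accurate \<epsilon> r \<and> c \<le> bound (Suc j)}"
          then obtain r c where "y = (r, c)" "accurate \<epsilon> r" "c \<le> bound (Suc j)" by blast
          moreover from this have "cost bs + c \<le> bound j" using cost[OF bs] step by linarith
          ultimately show "y \<in> {(r, c). accurate \<epsilon> r \<and> cost bs + c \<le> bound j}" by blast
        qed simp
        finally show ?thesis unfolding None option.case prob_add_cost .
      qed
    qed
    then show ?case by (simp only: distrib_right diff_diff_eq mult_1)
  qed
  then show ?thesis by (simp only: bound_def U_def)
qed

end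

text \<open>The first term increases with \<open>d\<close> and the second decreases; they meet at
  \<open>d = n powr (1/3)\<close>.\<close>

lemma min_le_cube_root:
  fixes d n :: real
  assumes "0 < d" "0 < n"
  shows "min d (sqrt (n / d)) \<le> n powr (1/3)"
proof (cases "d \<le> n powr (1/3)")
  case False
  then have "n / d \<le> n / n powr (1/3)" using assms by (intro divide_left_mono) auto
  also have "\<dots> = n powr (2/3)" using assms powr_diff[of n 1 "1/3"] by simp
  finally have "sqrt (n / d) \<le> sqrt (n powr (2/3))" by (rule real_sqrt_le_mono)
  also have "\<dots> = n powr (1/3)" using assms by (simp add: powr_half_sqrt[symmetric] powr_powr)
  finally show ?thesis by simp
qed simp

definition log_ceil :: "nat \<Rightarrow> nat" where
  "log_ceil n = nat \<lceil>log 2 (real n)\<rceil>"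

lemma log_ceil:
  assumes "2 \<le> n"
  shows "n \<le> 2 ^ log_ceil n" "real (log_ceil n) + 1 \<le> 5 * ln n"
proof -
  have l1: "1 \<le> log 2 (real n)" using assms by (simp add: le_log_iff)
  have n0: "0 < real n" using assms by simp
  have "log 2 (real n) \<le> log_ceil n" unfolding log_ceil_def by linarith
  then have "2 powr log 2 (real n) \<le> 2 powr real (log_ceil n)" by (intro powr_mono) auto
  then have "real n \<le> real (2 ^ log_ceil n)" using n0 by (simp add: powr_realpow)
  then show "n \<le> 2 ^ log_ceil n" by (simp only: of_nat_le_iff)
  have "real (log_ceil n) + 1 \<le> 3 * log 2 n" using l1 unfolding log_ceil_def by linarith
  also have "\<dots> = ln n * (3 / ln 2)" by (simp add: log_def)
  also have "\<dots> \<le> ln n * (3 / (2/3))" using ln2_ge_two_thirds assms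
    by (intro mult_left_mono divide_left_mono mult_pos_pos) auto
  also have "\<dots> \<le> 5 * ln n" using assms by simp
  finally show "real (log_ceil n) + 1 \<le> 5 * ln n" .
qed

text \<open>A stage fails with probability at most \<open>210000 / (k * \<epsilon>\<^sup>2)\<close>, and there are at most
  \<open>log_ceil n + 1\<close> stages; the repetitions make the total at most \<open>1/100\<close>.\<close>

definition repetitions :: "nat \<Rightarrow> real \<Rightarrow> nat" where
  "repetitions n \<epsilon> = nat \<lceil>21000000 * (real (log_ceil n) + 1) / \<epsilon>\<^sup>2\<rceil>"

text \<open>At level \<open>log_ceil n\<close> a verdict is due since
  \<open>d \<le> n \<le> 2 ^ log_ceil n\<close>; levels start at 0, hence \<open>Suc\<close>. Loads
  are at most \<open>2 ^ J * n\<close>, a product of two factors bounded by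
  \<open>2 ^ log_ceil n\<close>, and the extra digit makes the inequality strict.\<close>

definition estimate_degree :: "nat \<Rightarrow> real \<Rightarrow> algorithm" where
  "estimate_degree n \<epsilon> = search n (repetitions n \<epsilon>) (2 * log_ceil n + 1) (Suc (log_ceil n)) 0"

lemma (in simple_graph_without_isolated) estimate_degree_correct:
  assumes \<epsilon>: "0 < \<epsilon>" "\<epsilon> < 1"
  shows "approximates_within_cost (estimate_degree n \<epsilon>) G \<epsilon>
    (88000 * 21000000 * ln n ^ 3 * (1 / \<epsilon>\<^sup>2) * min d (sqrt (n / d)))"
proof -
  define l where "l = log_ceil n"
  define k where "k = repetitions n \<epsilon>"
  define L where "L = 2 * l + 1"
  note nl = log_ceil(1)[OF n, folded l_def] and ll = log_ceil(2)[OF n, folded l_def]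
  have d1: "1 \<le> d" by (rule d_ge_1)
  have n0: "0 < real n" using n by simp
  let ?done = "\<lambda>j::nat. d \<le> 2 ^ j \<or> n \<le> d * (2 ^ j)\<^sup>2"
  have "real n \<le> 2 ^ l" using nl by (metis of_nat_le_iff of_nat_numeral of_nat_power)
  then have done_l: "?done l" using d_less by linarith
  \<comment> \<open>By minimality both conditions fail at level \<open>J - 1\<close>, so
    \<open>2 ^ J\<close> is at most twice the minimum of \<open>d\<close> and
    \<open>sqrt (n / d)\<close>, and \<open>d * (2 ^ J)^2\<close> exceeds \<open>n\<close> by at
    most the factor 4 that \<open>prob_good_stats\<close> allows.\<close>
  define J where "J = (LEAST j. ?done j)"
  have J: "?done J" unfolding J_def by (rule LeastI[of ?done, OF done_l])
  have Jl: "J \<le> l" unfolding J_def by (rule Least_le[of ?done, OF done_l])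
  have before_J: "2 ^ j < d \<and> d * (2 ^ j)\<^sup>2 < n" if "j < J" for j
    using not_less_Least[of j ?done] that unfolding J_def by auto
  have before: "d * (2 ^ j)\<^sup>2 \<le> 4 * n" if "j \<le> J" for j
  proof (cases j)
    case 0
    then show ?thesis using d_less n0 by simp
  next
    case (Suc i)
    then have "d * (2 ^ i)\<^sup>2 < n" using before_J[of i] that by simp
    then show ?thesis using Suc by (simp add: power_mult_distrib)
  qed
  have size: "2 ^ J \<le> 2 * min d (sqrt (n / d))"
  proof (cases J)
    case 0
    have "1 \<le> n / d" using d_less d1 by simp
    then have "1 \<le> sqrt (n / d)" by simp
    then have "1 \<le> min d (sqrt (n / d))" using d1 by (intro min.boundedI)
    then have "1 \<le> 2 * min d (sqrt (n / d))" by linarith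
    then show ?thesis using 0 by (simp only: power_0)
  next
    case (Suc i)
    then have i: "2 ^ i < d" "d * (2 ^ i)\<^sup>2 < n" using before_J[of i] by auto
    have "(2 ^ i)\<^sup>2 \<le> n / d" using i(2) d1 by (simp add: pos_le_divide_eq mult.commute)
    then have "2 ^ i \<le> sqrt (n / d)" by (rule real_le_rsqrt)
    then show ?thesis using i Suc by simp
  qed
  define c where "c = 21000000 * (real l + 1)"
  have c0: "1 \<le> c" by (simp add: c_def)
  have \<epsilon>2: "0 < \<epsilon>\<^sup>2" "\<epsilon>\<^sup>2 \<le> 1" using \<epsilon> by (auto simp: power_le_one)
  have "1 \<le> c / \<epsilon>\<^sup>2" using c0 \<epsilon>2 by (simp add: pos_le_divide_eq)
  then have k: "c / \<epsilon>\<^sup>2 \<le> k" "real k \<le> 2 * (c / \<epsilon>\<^sup>2)" "0 < k"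
    unfolding k_def repetitions_def l_def[symmetric] c_def[symmetric] by linarith+
  define \<eta> where "\<eta> = 1 / (100 * (real l + 1))"
  have \<eta>: "210000 / (k * \<epsilon>\<^sup>2) \<le> \<eta>"
  proof -
    have "c \<le> k * \<epsilon>\<^sup>2" using k(1) \<epsilon>2 by (simp add: pos_divide_le_eq)
    then have "210000 / (k * \<epsilon>\<^sup>2) \<le> 210000 / c" using c0 k(3) \<epsilon>2 by (intro divide_left_mono mult_pos_pos) auto
    also have "c = 210000 * (100 * (real l + 1))" by (simp add: c_def)
    also have "210000 / (210000 * (100 * (real l + 1))) = \<eta>"
    proof -
      have "210000 / (210000 * (100 * q)) = 1 / (100 * q)" for q :: real by simp
      then show ?thesis unfolding \<eta>_def .
    qed
    finally show ?thesis .
  qed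
  have bits: "2 ^ J * n < 2 ^ L"
  proof -
    have "2 ^ J * n \<le> 2 ^ l * 2 ^ l" using Jl nl by (intro mult_le_mono power_increasing) auto
    also have "\<dots> < 2 ^ L" unfolding L_def power_add[symmetric] by (intro power_strict_increasing) auto
    finally show ?thesis .
  qed
  have L1: "1 \<le> L" by (simp add: L_def)
  have "1 - (real J + 1) * \<eta> \<le> measure_pmf.prob (run_from G (search n k L (Suc l) 0) {})
     {(r, x). accurate \<epsilon> r \<and> x \<le> 22 * k * L\<^sup>2 * (2 ^ Suc J - 2 ^ 0)}"
    using Jl by (intro search_correct[OF \<epsilon> bits L1 k(3) \<eta> before J]) auto
  moreover have "99/100 \<le> 1 - (real J + 1) * \<eta>"
  proof -
    have "(real J + 1) * \<eta> \<le> (real l + 1) * \<eta>" using Jl by (intro mult_right_mono) (auto simp: \<eta>_def)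
    also have "\<dots> = 1/100" by (simp add: \<eta>_def add_pos_nonneg)
    finally show ?thesis by simp
  qed
  moreover have "measure_pmf.prob (run_from G (search n k L (Suc l) 0) {})
       {(r, x). accurate \<epsilon> r \<and> x \<le> 22 * k * L\<^sup>2 * (2 ^ Suc J - 2 ^ 0)}
     \<le> measure_pmf.prob (run_from G (search n k L (Suc l) 0) {})
       {(r, x). accurate \<epsilon> r \<and> real x \<le> 88000 * 21000000 * ln n ^ 3 * (1 / \<epsilon>\<^sup>2) * min d (sqrt (n / d))}"
  proof (intro measure_pmf.finite_measure_mono subsetI)
    fix y assume "y \<in> {(r, x). accurate \<epsilon> r \<and> x \<le> 22 * k * L\<^sup>2 * (2 ^ Suc J - 2 ^ 0)}"
    then obtain r x where y: "y = (r, x)" "accurate \<epsilon> r" "x \<le> 22 * k * L\<^sup>2 * (2 ^ Suc J - 2 ^ 0)" by blast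
    let ?M = "min d (sqrt (n / d))"
    have M0: "0 \<le> ?M" using d1 n0 by simp
    have "22 * k * L\<^sup>2 * (2 ^ Suc J - 2 ^ 0) \<le> 22 * k * L\<^sup>2 * (2 * 2 ^ J)" by (intro mult_le_mono2) simp
    then have "x \<le> 22 * k * L\<^sup>2 * (2 * 2 ^ J)" using y(3) by linarith
    then have "real x \<le> real (22 * k * L\<^sup>2 * (2 * 2 ^ J))" by (simp only: of_nat_le_iff)
    also have "\<dots> = 44 * (real k * ((real L)\<^sup>2 * 2 ^ J))" by simp
    also have "\<dots> \<le> 44 * (2 * (c / \<epsilon>\<^sup>2) * ((2 * (real l + 1))\<^sup>2 * (2 * ?M)))"
      using k(2) size by (intro mult_mono mult_left_mono power_mono) (auto simp: L_def)
    also have "\<dots> = 704 * 21000000 * (real l + 1) ^ 3 * (1 / \<epsilon>\<^sup>2) * ?M"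
    proof -
      have "44 * (2 * (21000000 * q / \<epsilon>\<^sup>2) * ((2 * q)\<^sup>2 * (2 * ?M)))
          = 704 * 21000000 * q ^ 3 * (1 / \<epsilon>\<^sup>2) * ?M" for q :: real
        by (simp add: power2_eq_square power3_eq_cube)
      then show ?thesis unfolding c_def .
    qed
    also have "\<dots> \<le> 704 * 21000000 * (5 * ln n) ^ 3 * (1 / \<epsilon>\<^sup>2) * ?M"
      using ll M0 by (intro mult_right_mono mult_left_mono power_mono) auto
    \<comment> \<open>\<open>88000 = 704 * 5 ^ 3\<close>, the 5 coming from the comparison of
      \<open>log_ceil\<close> with \<open>ln\<close>.\<close>
    also have "\<dots> = 88000 * 21000000 * ln n ^ 3 * (1 / \<epsilon>\<^sup>2) * ?M"
      by (simp add: power_mult_distrib)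
    finally show "y \<in> {(r, x). accurate \<epsilon> r \<and> real x \<le> 88000 * 21000000 * ln n ^ 3 * (1 / \<epsilon>\<^sup>2) * ?M}"
      using y by blast
  qed simp
  ultimately have "99/100 \<le> measure_pmf.prob (run_from G (search n k L (Suc l) 0) {})
       {(r, x). accurate \<epsilon> r \<and> real x \<le> 88000 * 21000000 * ln n ^ 3 * (1 / \<epsilon>\<^sup>2) * min d (sqrt (n / d))}"
    by linarith
  then show ?thesis
    unfolding approximates_within_cost_def run_def estimate_degree_def k_def L_def l_def .
qed

lemma approximates_within_cost_mono:
  assumes "approximates_within_cost A G \<epsilon> B" "B \<le> B'"
  shows "approximates_within_cost A G \<epsilon> B'"
proof -
  have "measure_pmf.prob (run G A)
       {(r, c). r \<in> {(1 - \<epsilon>) * avg_degree G .. (1 + \<epsilon>) * avg_degree G} \<and> real c \<le> B}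
     \<le> measure_pmf.prob (run G A)
       {(r, c). r \<in> {(1 - \<epsilon>) * avg_degree G .. (1 + \<epsilon>) * avg_degree G} \<and> real c \<le> B'}"
    using assms(2) by (intro measure_pmf.finite_measure_mono) auto
  then show ?thesis using assms(1) unfolding approximates_within_cost_def by linarith
qed

theorem degree_upper_bound:
  "\<exists>(A :: nat \<Rightarrow> real \<Rightarrow> algorithm) (C :: real) (k :: nat).
        \<forall>n\<ge>2. \<forall>\<epsilon>. 0 < \<epsilon> \<and> \<epsilon> < 1 \<longrightarrow>
          uses_only additive_queries (A n \<epsilon>) \<and>
          (\<forall>G\<in>graphs n.
             approximates_within_cost (A n \<epsilon>) G \<epsilon>
               (C * ln (real n) ^ k * (1 / \<epsilon>\<^sup>2) *
                  min (avg_degree G) (sqrt (real n / avg_degree G))) \<and>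
             approximates_within_cost (A n \<epsilon>) G \<epsilon>
               (C * ln (real n) ^ k * (1 / \<epsilon>\<^sup>2) * real n powr (1/3)))"
proof (intro exI[of _ estimate_degree] exI[of _ "88000 * 21000000 :: real"] exI[of _ "3 :: nat"] allI impI conjI ballI)
  fix n :: nat and \<epsilon> :: real
  assume n: "2 \<le> n" and \<epsilon>: "0 < \<epsilon> \<and> \<epsilon> < 1"
  show "uses_only additive_queries (estimate_degree n \<epsilon>)"
    unfolding estimate_degree_def by (rule uses_only_search)
  fix G assume G: "G \<in> graphs n"
  interpret simple_graph_without_isolated G n by unfold_locales (rule G, rule n)
  show 1: "approximates_within_cost (estimate_degree n \<epsilon>) G \<epsilon>
      (88000 * 21000000 * ln (real n) ^ 3 * (1 / \<epsilon>\<^sup>2) * min d (sqrt (real n / d)))"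
    using \<epsilon> by (intro estimate_degree_correct) auto
  have "min d (sqrt (real n / d)) \<le> real n powr (1/3)"
    using d_ge_1 n by (intro min_le_cube_root) auto
  then have "88000 * 21000000 * ln (real n) ^ 3 * (1 / \<epsilon>\<^sup>2) * min d (sqrt (real n / d))
      \<le> 88000 * 21000000 * ln (real n) ^ 3 * (1 / \<epsilon>\<^sup>2) * real n powr (1/3)"
    using n by (intro mult_left_mono) auto
  then show "approximates_within_cost (estimate_degree n \<epsilon>) G \<epsilon>
      (88000 * 21000000 * ln (real n) ^ 3 * (1 / \<epsilon>\<^sup>2) * real n powr (1/3))"
    by (rule approximates_within_cost_mono[OF 1])
qed

theorem theorem1p6:
  shows
    "(\<exists>(A :: nat \<Rightarrow> real \<Rightarrow> algorithm) (C :: real) (k :: nat).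
        \<forall>n\<ge>2. \<forall>\<epsilon>. 0 < \<epsilon> \<and> \<epsilon> < 1 \<longrightarrow>
          uses_only additive_queries (A n \<epsilon>) \<and>
          (\<forall>G\<in>graphs n.
             approximates_within_cost (A n \<epsilon>) G \<epsilon>
               (C * ln (real n) ^ k * (1 / \<epsilon>\<^sup>2) *
                  min (avg_degree G) (sqrt (real n / avg_degree G))) \<and>
             approximates_within_cost (A n \<epsilon>) G \<epsilon>
               (C * ln (real n) ^ k * (1 / \<epsilon>\<^sup>2) * real n powr (1/3))))
     \<and>
     (\<forall>Q \<in> {additive_queries, full_nbrhood_queries}. \<forall>\<gamma>\<ge>1.
        \<exists>\<kappa>>0. \<exists>n\<^sub>0. \<forall>n\<ge>n\<^sub>0. \<forall>A. estimator Q \<gamma> n A \<longrightarrow>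
          (\<exists>G\<in>graphs n. needs_cost A G (\<kappa> * real n powr (1/3))))
     \<and>
     (\<forall>\<gamma>\<ge>1. \<exists>\<kappa>>0. \<exists>K\<ge>1. \<exists>n\<^sub>0. \<forall>n\<ge>n\<^sub>0. \<forall>A. estimator pair_queries \<gamma> n A \<longrightarrow>
        (\<forall>D. 1 \<le> D \<and> D \<le> real n - 1 \<longrightarrow>
          (\<exists>G\<in>graphs n.
             max D (sqrt (real n)) / K \<le> avg_degree G \<and>
             avg_degree G \<le> K * max D (sqrt (real n)) \<and>
             needs_cost A G (\<kappa> * min (sqrt (real n)) (real n / avg_degree G)))))"
proof (intro conjI ballI allI impI)
  show "\<exists>\<kappa>>0. \<exists>n\<^sub>0. \<forall>n\<ge>n\<^sub>0. \<forall>A. estimator Q \<gamma> n A \<longrightarrow>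
      (\<exists>G\<in>graphs n. needs_cost A G (\<kappa> * real n powr (1/3)))" if "1 \<le> \<gamma>" for Q and \<gamma> :: real
    by (rule cube_root_lower_bound[OF that])
qed (rule degree_upper_bound, rule pair_query_lower_bound)

end
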